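(* Let $\Bbbk$ be an algebraically closed field of characteristic $2$ and let $\mathfrak{u}(\mathfrak{m})$ be the algebra generated by $a,b,c$ with relations $ab+ba=c$, $ac+ca=a$, $bc+cb=b$, $a^4=b^4=0$, $c^2+c=0$. The set of isomorphism classes of finite-dimensional indecomposable left $\mathfrak{u}(\mathfrak{m})$-modules consists of the classes of: (i) the simple modules $V_0,V_1$ and their projective covers $P(V_0)\simeq M$, $P(V_1)\simeq N$; (ii) the string modules $\mathtt U_{i,r}$ ($i\in\{1,2,3,4\}$, $r\ge1$), $\mathtt V_{j,t}$, $\mathtt W_{j,t}$ ($j\in\{1,2\}$, $t\ge0$); (iii) the band modules $\mathtt A_{\lambda,n}$, $\mathtt B_{\lambda,n}$ ($n\ge1$, $\lambda\in\Bbbk^\times$).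
   Context: $V_0$: one-dimensional, $a,b,c$ act by $0$. $V_1$: basis $v_1,v_2,v_3$, $av_1=v_2$, $av_2=v_3$, $av_3=0$, $bv_1=0$, $bv_2=v_1$, $bv_3=v_2$, $cv_1=v_1$, $cv_2=0$, $cv_3=v_3$. $M$: basis $v_1..v_4,w_1..w_4$, $av_i=v_{i+1}$ ($i\le3$), $av_4=0$, $bv_1=bv_4=0$, $bv_i=v_{i-1}$ ($i=2,3$), $cv_i=v_i$ ($i=1,3$), $cv_i=0$ ($i=2,4$), $aw_i=w_{i+1}$ ($i\le3$), $aw_4=0$, $bw_i=v_{i+2}$ ($i=1,2$), $bw_i=w_{i-1}$ ($i=3,4$), $cw_i=0$ ($i=1,3$), $cw_i=w_i$ ($i=2,4$). $N$: basis $v_1..v_4,w_1..w_4$, $av_i=v_{i+1}$ ($i\le3$), $av_4=0$, $bv_i=0$ ($i=1,2$), $bv_i=v_{i-1}$ ($i=3,4$), $cv_i=0$ ($i=1,3$), $cv_i=v_i$ ($i=2,4$), $aw_i=w_{i+1}$ ($i\le3$), $aw_4=0$, $bw_i=v_i$ ($i=1,4$), $bw_i=v_i+w_{i-1}$ ($i=2,3$), $cw_i=w_i$ ($i=1,3$), $cw_i=0$ ($i=2,4$). String modules: each has a basis $z_1,\dots,z_d$ with $az_i=\kappa_i z_{i+1}$, $bz_i=\mu_i z_{i-1}$, $cz_i=\nu_i z_i$, where $\kappa_i,\mu_i,\nu_i\in\{0,1\}$, $\kappa_i=1$ and $\mu_i=1$ except for the listed indices where they are $0$, and $\nu_i$ is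 the residue mod 2 indicated ("$\nu_i\equiv i+1$" or "$\nu_i\equiv i$"): $\mathtt U_{1,r}$: $d=4r+1$; $\kappa_i=0$ iff $i\equiv0\ (4)$ or $i=4r+1$; $\mu_i=0$ iff $i\equiv2\ (4)$ or $i=1$; $\nu_i\equiv i+1$. $\mathtt U_{2,r}$: $d=4r+3$; $\kappa_i=0$ iff $i\equiv3\ (4)$; $\mu_i=0$ iff $i\equiv1\ (4)$; $\nu_i\equiv i$. $\mathtt U_{3,r}$: $d=4r+3$; $\kappa_i=0$ iff $i\equiv0\ (4)$ or $i=4r+3$; $\mu_i=0$ iff $i\equiv0\ (4)$ or $i=1$; $\nu_i\equiv i$. $\mathtt U_{4,r}$: $d=4r+1$; $\kappa_i=0$ iff $i\equiv1\ (4)$; $\mu_i=0$ iff $i\equiv1\ (4)$; $\nu_i\equiv i+1$. $\mathtt V_{1,t}$: $d=4(t+1)$; $\kappa_i=0$ iff $i\equiv0\ (4)$; $\mu_i=0$ iff $i\equiv2\ (4)$ or $i=1$; $\nu_i\equiv i+1$. $\mathtt V_{2,t}$: $d=4(t+1)$; $\kappa_i=0$ iff $i\equiv3\ (4)$ or $i=4(t+1)$; $\mu_i=0$ iff $i\equiv1\ (4)$; $\nu_i\equiv i$. $\mathtt W_{1,t}$: $d=4(t+1)$; $\kappa_i=0$ iff $i\equiv0\ (4)$ or $i=4(t+1)$; $\mu_i=0$ iff $i\equiv0\ (4)$ or $i=1$; $\nu_i\equiv i$. $\mathtt W_{2,t}$: $d=4(t+1)$; $\kappa_i=0$ iff $i\equiv1\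 (4)$ or $i=4(t+1)$; $\mu_i=0$ iff $i\equiv1\ (4)$ or $i=1$; $\nu_i\equiv i+1$. Band modules: $\mathtt A_{\lambda,n}$ and $\mathtt B_{\lambda,n}$ have a basis $z_1,\dots,z_{4n}$ with $az_i=\kappa_iz_{i+1}$, $bz_i=\mu_iz_{i-1}+\xi_i\lambda z_{i+3}$, $cz_i=\nu_iz_i$, $\kappa_i,\mu_i,\xi_i,\nu_i\in\{0,1\}$, equal to $1$ except at listed indices: $\mathtt A_{\lambda,n}$: $\kappa_i=0$ iff $i\equiv0\ (4)$; $\mu_i=0$ iff $i\equiv2\ (4)$ or $i=1$; $\xi_i=0$ iff $i\equiv0,2,3\ (4)$; $\nu_i\equiv i+1$. $\mathtt B_{\lambda,n}$: $\kappa_i=0$ iff $i\equiv0\ (4)$; $\mu_i=0$ iff $i\equiv0\ (4)$ or $i=1$; $\xi_i=0$ iff $i\equiv0,2,3\ (4)$; $\nu_i\equiv i$. *)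

theory Defs
  imports "Jordan_Normal_Form.Matrix" "HOL-Computational_Algebra.Polynomial"
begin

text \<open>A finite-dimensional left module over u(m) is a triple (A,B,C) of n x n matrices
  over the field (the actions of a, b, c on k^n w.r.t. a chosen basis) satisfying the
  defining relations.  Matrix convention: column i is the image of the i-th basis vector.\<close>

type_synonym 'k rep = "'k mat \<times> 'k mat \<times> 'k mat"

definition rdim :: "'k rep \<Rightarrow> nat" where
  "rdim X = dim_row (fst X)"

definition is_umod :: "'k::field rep \<Rightarrow> bool" where
  "is_umod X = (case X of (A, B, C) \<Rightarrow>
     let n = dim_row A in
     A \<in> carrier_mat n n \<and> B \<in> carrier_mat n n \<and> C \<in> carrier_mat n n \<and>
     A * B + B * A = C \<and> A * C + C * A = A \<and> B * C + C * B = B \<and>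
     A ^\<^sub>m 4 = 0\<^sub>m n n \<and> B ^\<^sub>m 4 = 0\<^sub>m n n \<and> C * C + C = 0\<^sub>m n n)"

definition well_formed :: "'k rep \<Rightarrow> bool" where
  "well_formed X = (case X of (A, B, C) \<Rightarrow>
     A \<in> carrier_mat (rdim X) (rdim X) \<and> B \<in> carrier_mat (rdim X) (rdim X) \<and>
     C \<in> carrier_mat (rdim X) (rdim X))"

definition is_hom :: "'k::field rep \<Rightarrow> 'k rep \<Rightarrow> 'k mat \<Rightarrow> bool" where
  "is_hom X Y F = (case X of (A, B, C) \<Rightarrow> case Y of (A', B', C') \<Rightarrow>
     well_formed X \<and> well_formed Y \<and> F \<in> carrier_mat (rdim Y) (rdim X) \<and>
     F * A = A' * F \<and> F * B = B' * F \<and> F * C = C' * F)"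

definition surj_mat :: "'k::field mat \<Rightarrow> bool" where
  "surj_mat F = (\<forall>w \<in> carrier_vec (dim_row F). \<exists>v \<in> carrier_vec (dim_col F). F *\<^sub>v v = w)"

definition mod_iso :: "'k::field rep \<Rightarrow> 'k rep \<Rightarrow> bool" where
  "mod_iso X Y = (rdim X = rdim Y \<and> (\<exists>P. is_hom X Y P \<and> invertible_mat P))"

definition dsum :: "'k::field rep \<Rightarrow> 'k rep \<Rightarrow> 'k rep" where
  "dsum X Y = (case X of (A, B, C) \<Rightarrow> case Y of (A', B', C') \<Rightarrow>
     let n = rdim X; m = rdim Y in
     (four_block_mat A (0\<^sub>m n m) (0\<^sub>m m n) A',
      four_block_mat B (0\<^sub>m n m) (0\<^sub>m m n) B',
      four_block_mat C (0\<^sub>m n m) (0\<^sub>m m n) C'))"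

definition indecomposable :: "'k::field rep \<Rightarrow> bool" where
  "indecomposable X = (is_umod X \<and> rdim X > 0 \<and>
     \<not> (\<exists>Y Z. is_umod Y \<and> is_umod Z \<and> rdim Y > 0 \<and> rdim Z > 0 \<and> mod_iso X (dsum Y Z)))"

definition is_submod :: "'k::field rep \<Rightarrow> 'k vec set \<Rightarrow> bool" where
  "is_submod X W = (case X of (A, B, C) \<Rightarrow>
     W \<subseteq> carrier_vec (rdim X) \<and> 0\<^sub>v (rdim X) \<in> W \<and>
     (\<forall>v\<in>W. \<forall>w\<in>W. v + w \<in> W) \<and> (\<forall>s. \<forall>v\<in>W. s \<cdot>\<^sub>v v \<in> W) \<and>
     (\<forall>v\<in>W. A *\<^sub>v v \<in> W \<and> B *\<^sub>v v \<in> W \<and> C *\<^sub>v v \<in> W))"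

definition simple_mod :: "'k::field rep \<Rightarrow> bool" where
  "simple_mod X = (is_umod X \<and> rdim X > 0 \<and>
     (\<forall>W. is_submod X W \<longrightarrow> W = {0\<^sub>v (rdim X)} \<or> W = carrier_vec (rdim X)))"

definition projective_mod :: "'k::field rep \<Rightarrow> bool" where
  "projective_mod P = (is_umod P \<and>
     (\<forall>X Y f g. is_umod X \<and> is_umod Y \<and> is_hom X Y f \<and> surj_mat f \<and> is_hom P Y g \<longrightarrow>
        (\<exists>h. is_hom P X h \<and> f * h = g)))"

definition projective_cover :: "'k::field rep \<Rightarrow> 'k rep \<Rightarrow> bool" where
  "projective_cover P S = (projective_mod P \<and> is_umod S \<and>
     (\<exists>f. is_hom P S f \<and> surj_mat f \<and>
        (\<forall>W. is_submod P W \<and>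
             (\<forall>v \<in> carrier_vec (rdim P). \<exists>w\<in>W. \<exists>k \<in> carrier_vec (rdim P).
                  f *\<^sub>v k = 0\<^sub>v (rdim S) \<and> v = w + k)
             \<longrightarrow> W = carrier_vec (rdim P))))"

text \<open>Operator on basis z_1..z_d given by coefficients: f j i = coefficient of z_j in x z_i.\<close>
definition op_mat :: "nat \<Rightarrow> (nat \<Rightarrow> nat \<Rightarrow> 'k::field) \<Rightarrow> 'k mat" where
  "op_mat d f = mat d d (\<lambda>(r, c). f (Suc r) (Suc c))"

definition V0 :: "'k::field rep" where
  "V0 = (0\<^sub>m 1 1, 0\<^sub>m 1 1, 0\<^sub>m 1 1)"

definition gen_mod :: "nat \<Rightarrow> (nat \<Rightarrow> bool) \<Rightarrow> (nat \<Rightarrow> bool) \<Rightarrow> (nat \<Rightarrow> bool)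
    \<Rightarrow> 'k::field \<Rightarrow> (nat \<Rightarrow> bool) \<Rightarrow> 'k rep" where
  "gen_mod d \<kappa> \<mu> \<xi> lam \<nu> =
     (op_mat d (\<lambda>j i. of_bool (j = i + 1 \<and> \<kappa> i)),
      op_mat d (\<lambda>j i. of_bool (i = j + 1 \<and> \<mu> i) + (if j = i + 3 \<and> \<xi> i then lam else 0)),
      op_mat d (\<lambda>j i. of_bool (j = i \<and> \<nu> i)))"

definition string_mod :: "nat \<Rightarrow> (nat \<Rightarrow> bool) \<Rightarrow> (nat \<Rightarrow> bool) \<Rightarrow> (nat \<Rightarrow> bool) \<Rightarrow> 'k::field rep" where
  "string_mod d \<kappa> \<mu> \<nu> = gen_mod d \<kappa> \<mu> (\<lambda>_. False) 0 \<nu>"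

definition V1 :: "'k::field rep" where
  "V1 = string_mod 3 (\<lambda>i. i < 3) (\<lambda>i. i > 1) (\<lambda>i. odd i)"

text \<open>M and N: basis v1..v4, w1..w4 indexed as 1..4, 5..8.\<close>
definition M_mod :: "'k::field rep" where
  "M_mod =
     (op_mat 8 (\<lambda>j i. of_bool (i \<in> {1,2,3,5,6,7} \<and> j = i + 1)),
      op_mat 8 (\<lambda>j i. of_bool ((i \<in> {2,3} \<and> j = i - 1) \<or> (i \<in> {5,6} \<and> j = i - 2)
                               \<or> (i \<in> {7,8} \<and> j = i - 1))),
      op_mat 8 (\<lambda>j i. of_bool (j = i \<and> i \<in> {1,3,6,8})))"

definition N_mod :: "'k::field rep" where
  "N_mod =
     (op_mat 8 (\<lambda>j i. of_bool (i \<in> {1,2,3,5,6,7} \<and> j = i + 1)),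
      op_mat 8 (\<lambda>j i. of_bool ((i \<in> {3,4} \<and> j = i - 1) \<or> (i \<in> {5,8} \<and> j = i - 4)
                               \<or> (i \<in> {6,7} \<and> j = i - 4))
                     + of_bool (i \<in> {6,7} \<and> j = i - 1)),
      op_mat 8 (\<lambda>j i. of_bool (j = i \<and> i \<in> {2,4,5,7})))"

definition U_mod :: "nat \<Rightarrow> nat \<Rightarrow> 'k::field rep" where
  "U_mod k r =
     (if k = 1 then string_mod (4*r+1) (\<lambda>i. \<not> (i mod 4 = 0 \<or> i = 4*r+1))
                     (\<lambda>i. \<not> (i mod 4 = 2 \<or> i = 1)) (\<lambda>i. even i)
      else if k = 2 then string_mod (4*r+3) (\<lambda>i. i mod 4 \<noteq> 3) (\<lambda>i. i mod 4 \<noteq> 1) (\<lambda>i. odd i)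
      else if k = 3 then string_mod (4*r+3) (\<lambda>i. \<not> (i mod 4 = 0 \<or> i = 4*r+3))
                     (\<lambda>i. \<not> (i mod 4 = 0 \<or> i = 1)) (\<lambda>i. odd i)
      else string_mod (4*r+1) (\<lambda>i. i mod 4 \<noteq> 1) (\<lambda>i. i mod 4 \<noteq> 1) (\<lambda>i. even i))"

definition V_mod :: "nat \<Rightarrow> nat \<Rightarrow> 'k::field rep" where
  "V_mod k t =
     (if k = 1 then string_mod (4*(t+1)) (\<lambda>i. i mod 4 \<noteq> 0) (\<lambda>i. \<not> (i mod 4 = 2 \<or> i = 1)) (\<lambda>i. even i)
      else string_mod (4*(t+1)) (\<lambda>i. \<not> (i mod 4 = 3 \<or> i = 4*(t+1))) (\<lambda>i. i mod 4 \<noteq> 1) (\<lambda>i. odd i))"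

definition W_mod :: "nat \<Rightarrow> nat \<Rightarrow> 'k::field rep" where
  "W_mod k t =
     (if k = 1 then string_mod (4*(t+1)) (\<lambda>i. \<not> (i mod 4 = 0 \<or> i = 4*(t+1)))
                      (\<lambda>i. \<not> (i mod 4 = 0 \<or> i = 1)) (\<lambda>i. odd i)
      else string_mod (4*(t+1)) (\<lambda>i. \<not> (i mod 4 = 1 \<or> i = 4*(t+1)))
                      (\<lambda>i. \<not> (i mod 4 = 1 \<or> i = 1)) (\<lambda>i. even i))"

definition A_band :: "'k::field \<Rightarrow> nat \<Rightarrow> 'k rep" where
  "A_band lam n = gen_mod (4*n) (\<lambda>i. i mod 4 \<noteq> 0) (\<lambda>i. \<not> (i mod 4 = 2 \<or> i = 1))
                     (\<lambda>i. i mod 4 = 1) lam (\<lambda>i. even i)"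

definition B_band :: "'k::field \<Rightarrow> nat \<Rightarrow> 'k rep" where
  "B_band lam n = gen_mod (4*n) (\<lambda>i. i mod 4 \<noteq> 0) (\<lambda>i. \<not> (i mod 4 = 0 \<or> i = 1))
                     (\<lambda>i. i mod 4 = 1) lam (\<lambda>i. odd i)"

end

(*
  A module V over u(m) is graded by Z/4: c is idempotent, ab has generalized eigenvalues 0 and 1 on each
  eigenspace of c, and so V = X0 + X1 + X2 + X3 with a : Xi -> X(i+1) and b : X(i+1) -> Xi. The element a
  identifies X1 = X2 = X3 =: Y; with U := X0 a module is the same as four maps p = a, q = b^3 : U -> Y and
  s = b, t = a^3 : Y -> U with ps = qt, sp = tq and tp = pt = sq = qs = 0. If sp is nonzero then M splits off, and
  if ps is nonzero then N splits off. Otherwise the projection of U onto the common kernel of p and q lifts to an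
  idempotent endomorphism, so that an indecomposable module has s = t = 0 or p = q = 0 and is a
  Kronecker module.

  Kronecker modules are classified by splitting off a standard one. If the pencil has a polynomial kernel
  vector, one of minimal degree splits off: the functionals needed for a retraction exist by the Fredholm
  alternative, because an obstruction would be a shorter kernel vector. Transposition treats pencils with
  dim U < dim Y; the remaining pencils are regular, and there an eigenvector splits off a Jordan block.
  Conversely, the listed modules have no idempotent endomorphisms except 0 and 1.
*)

theory Submission
  imports Defs "HOL-Library.Function_Algebras" "Jordan_Normal_Form.Char_Poly"
begin

section \<open>Finite-dimensional linear algebra\<close>

text \<open>Direct sums are handled through retracts: homomorphisms \<open>L -> X -> L\<close> with
  composite the identity make an indecomposable \<open>X\<close> a copy of \<open>L\<close>, so it
  is enough to split off one standard summand. Retracts of pencils give retracts of quadruples, and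
  these give retracts of modules. The delicate point of the reduction is that \<open>b\<close> does
  not invert \<open>a\<close> between X1, X2 and X3; it does so up to the factor
  \<open>1 + ps\<close>. As \<open>(ps)^2 = 0\<close>, this factor is an involution in
  characteristic 2. Therefore \<open>(ab)^2\<close> is exactly the projection onto X2 + X3, and
  homomorphisms respect the four pieces. The families of the list are the normal forms of pencils,
  placed in (p, q) or in (t, s). The U-families are the pencils with dim U and dim Y differing by
  one, the smallest of them being V0 and V1. \<open>A_band\<close> and \<open>B_band\<close> are
  Jordan blocks at \<lambda>, \<open>V_mod 1\<close> and \<open>W_mod 1\<close> their cases
  \<lambda> = 0, and \<open>V_mod 2\<close>, \<open>W_mod 2\<close> the blocks at infinity. M and N
  are the free quadruples on one generator in U and in Y.\<close>

text \<open>Gaussian elimination on the unknowns. A pivot \<open>M i0 j0\<close> clears its column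
  in the other rows; a solution of the reduced system fixes \<open>c j0\<close> through row
  \<open>i0\<close>, and a certificate of the reduced system extends to row \<open>i0\<close> by the
  weight that annihilates column \<open>j0\<close>. The lemma supplies one-sided inverses in
  \<open>rank_factorization\<close> and functionals for the retractions of pencils.\<close>

lemma fredholm_alternative:
  fixes M :: "'i \<Rightarrow> 'j \<Rightarrow> 'k::field"
  assumes "finite J" "finite I"
  shows "(\<exists>c. \<forall>i\<in>I. (\<Sum>j\<in>J. M i j * c j) = b i) \<or>
    (\<exists>w. (\<forall>j\<in>J. (\<Sum>i\<in>I. w i * M i j) = 0) \<and> (\<Sum>i\<in>I. w i * b i) \<noteq> 0)"
  using assms
proof (induction J arbitrary: I M b rule: finite_induct)
  case empty
  show ?case
  proof (cases "\<forall>i\<in>I. b i = 0")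
    case False
    then obtain i0 where i0: "i0 \<in> I" "b i0 \<noteq> 0" by blast
    have "(\<Sum>i\<in>I. of_bool (i = i0) * b i) = b i0"
      using i0 empty by (simp add: of_bool_def if_distrib[of "\<lambda>x. x * _"] sum.delta cong: if_cong)
    with i0 show ?thesis by (intro disjI2 exI[of _ "\<lambda>i. of_bool (i = i0)"]) simp
  qed simp
next
  case (insert j0 J)
  show ?case
  proof (cases "\<forall>i\<in>I. M i j0 = 0")
    case True
    from insert.IH[OF insert.prems, of M b] show ?thesis
    proof
      assume "\<exists>c. \<forall>i\<in>I. (\<Sum>j\<in>J. M i j * c j) = b i"
      then obtain c where "\<forall>i\<in>I. (\<Sum>j\<in>J. M i j * c j) = b i" by blast
      then show ?thesis using insert.hyps True by (intro disjI1 exI[of _ c]) simp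
    next
      assume "\<exists>w. (\<forall>j\<in>J. (\<Sum>i\<in>I. w i * M i j) = 0) \<and> (\<Sum>i\<in>I. w i * b i) \<noteq> 0"
      then obtain w where "\<forall>j\<in>J. (\<Sum>i\<in>I. w i * M i j) = 0" "(\<Sum>i\<in>I. w i * b i) \<noteq> 0" by blast
      then show ?thesis using True by (intro disjI2 exI[of _ w]) simp
    qed
  next
    case False
    then obtain i0 where i0: "i0 \<in> I" and nz: "M i0 j0 \<noteq> 0" by blast
    define M' where "M' i j = M i j - M i j0 * M i0 j / M i0 j0" for i j
    define b' where "b' i = b i - M i j0 * b i0 / M i0 j0" for i
    let ?I = "I - {i0}"
    from insert.IH[OF finite_Diff[OF insert.prems, of "{i0}"], of M' b'] show ?thesis
    proof
      assume "\<exists>c. \<forall>i\<in>?I. (\<Sum>j\<in>J. M' i j * c j) = b' i"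
      then obtain c where c: "\<And>i. i \<in> ?I \<Longrightarrow> (\<Sum>j\<in>J. M' i j * c j) = b' i" by blast
      define S where "S i = (\<Sum>j\<in>J. M i j * c j)" for i
      define d where "d = c(j0 := (b i0 - S i0) / M i0 j0)"
      have sd: "(\<Sum>j\<in>insert j0 J. M i j * d j) = M i j0 * ((b i0 - S i0) / M i0 j0) + S i" for i
      proof -
        have "(\<Sum>j\<in>J. M i j * d j) = S i"
          unfolding S_def d_def using insert.hyps by (intro sum.cong) auto
        then show ?thesis using insert.hyps by (simp add: d_def)
      qed
      have "(\<Sum>j\<in>insert j0 J. M i j * d j) = b i" if "i \<in> I" for i
      proof (cases "i = i0")
        case True then show ?thesis using nz by (simp add: sd)
      next
        case False
        then have "(\<Sum>j\<in>J. M' i j * c j) = b' i" using c that by simp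
        moreover have "(\<Sum>j\<in>J. M' i j * c j) = S i - M i j0 / M i0 j0 * S i0"
          unfolding M'_def S_def by (simp add: algebra_simps sum_subtractf sum_distrib_left)
        ultimately have "S i = b i - M i j0 * b i0 / M i0 j0 + M i j0 / M i0 j0 * S i0"
          unfolding b'_def by (metis diff_add_cancel)
        then show ?thesis unfolding sd by (simp add: diff_divide_distrib right_diff_distrib)
      qed
      then show ?thesis by blast
    next
      assume "\<exists>w. (\<forall>j\<in>J. (\<Sum>i\<in>?I. w i * M' i j) = 0) \<and> (\<Sum>i\<in>?I. w i * b' i) \<noteq> 0"
      then obtain w where w: "\<And>j. j \<in> J \<Longrightarrow> (\<Sum>i\<in>?I. w i * M' i j) = 0"
        and wb: "(\<Sum>i\<in>?I. w i * b' i) \<noteq> 0" by blast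
      define R where "R = (\<Sum>i\<in>?I. w i * M i j0)"
      define v where "v = w(i0 := - R / M i0 j0)"
      have sv: "(\<Sum>i\<in>I. v i * f i) = - R / M i0 j0 * f i0 + (\<Sum>i\<in>?I. w i * f i)" for f
      proof -
        have "(\<Sum>i\<in>?I. v i * f i) = (\<Sum>i\<in>?I. w i * f i)"
          unfolding v_def by (intro sum.cong) auto
        then show ?thesis using insert.prems i0 by (simp add: sum.remove v_def)
      qed
      have e: "(\<Sum>i\<in>?I. w i * (f i - M i j0 * x / M i0 j0)) = (\<Sum>i\<in>I. v i * f i)"
        if "x = f i0" for f x
        unfolding sv that R_def by (simp add: algebra_simps sum_subtractf sum_distrib_left sum_distrib_right sum_divide_distrib)
      have "(\<Sum>i\<in>I. v i * M i j) = 0" if "j \<in> insert j0 J" for j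
      proof (cases "j = j0")
        case True then show ?thesis using nz by (simp add: sv R_def)
      next
        case False
        then show ?thesis using w[of j] that e[of "M i0 j" "\<lambda>i. M i j"] by (simp add: M'_def)
      qed
      moreover have "(\<Sum>i\<in>I. v i * b i) \<noteq> 0" using wb e[of "b i0" b] by (simp add: b'_def)
      ultimately show ?thesis by blast
    qed
  qed
qed

text \<open>Over a domain, because it is applied to matrices of polynomials in
  \<open>chain_if_wide\<close>. Elimination therefore cross-multiplies with the pivot instead of
  dividing by it.\<close>

lemma homogeneous_system_nontrivial:
  fixes M :: "'i \<Rightarrow> 'j \<Rightarrow> 'k::idom"
  assumes "finite I" "finite J" "card I < card J"
  shows "\<exists>c. (\<exists>j\<in>J. c j \<noteq> 0) \<and> (\<forall>i\<in>I. (\<Sum>j\<in>J. M i j * c j) = 0)"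
  using assms
proof (induction I arbitrary: J M rule: finite_induct)
  case empty
  then obtain j where "j \<in> J" by fastforce
  then show ?case by (intro exI[of _ "\<lambda>_. 1"]) auto
next
  case (insert i0 I)
  show ?case
  proof (cases "\<forall>j\<in>J. M i0 j = 0")
    case True
    have "card I < card J" using insert.prems insert.hyps by simp
    then obtain c where "\<exists>j\<in>J. c j \<noteq> 0" "\<forall>i\<in>I. (\<Sum>j\<in>J. M i j * c j) = 0"
      using insert.IH[of J M] insert.prems by blast
    with True show ?thesis by (intro exI[of _ c]) simp
  next
    case False
    then obtain j0 where j0: "j0 \<in> J" "M i0 j0 \<noteq> 0" by blast
    define d where "d = M i0 j0"
    let ?J = "J - {j0}"
    define M' where "M' i j = d * M i j - M i j0 * M i0 j" for i j
    have "card I < card ?J" using insert.prems insert.hyps j0 by simp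
    then obtain c where c: "\<exists>j\<in>?J. c j \<noteq> 0" "\<And>i. i \<in> I \<Longrightarrow> (\<Sum>j\<in>?J. M' i j * c j) = 0"
      using insert.IH[of ?J M'] insert.prems by auto
    define S where "S i = (\<Sum>j\<in>?J. M i j * c j)" for i
    \<comment> \<open>With the factor \<open>d\<close> at the other unknowns, row \<open>i0\<close>
      reads \<open>d * (- S i0) + d * S i0 = 0\<close>. The factor keeps the solution nonzero, since
      \<open>d\<close> is not a zero divisor.\<close>
    define e where "e j = (if j = j0 then - S i0 else d * c j)" for j
    have se: "(\<Sum>j\<in>J. M i j * e j) = - M i j0 * S i0 + d * S i" for i
    proof -
      have "(\<Sum>j\<in>?J. M i j * e j) = d * S i"
        unfolding e_def S_def sum_distrib_left by (intro sum.cong) auto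
      then show ?thesis using insert.prems j0 by (simp add: sum.remove e_def)
    qed
    have "(\<Sum>j\<in>J. M i j * e j) = 0" if "i \<in> insert i0 I" for i
    proof (cases "i = i0")
      case True then show ?thesis by (simp add: se d_def)
    next
      case False
      have "(\<Sum>j\<in>?J. M' i j * c j) = - M i j0 * S i0 + d * S i"
        unfolding M'_def S_def
        by (simp add: left_diff_distrib sum_subtractf sum_distrib_left mult.assoc sum_negf)
      then show ?thesis using c(2) that False by (simp add: se)
    qed
    moreover have "\<exists>j\<in>J. e j \<noteq> 0" using c(1) j0 by (auto simp: e_def d_def)
    ultimately show ?thesis by blast
  qed
qed

text \<open>In a factorization of minimal inner size \<open>r\<close> both factors have one-sided
  inverses: if one is missing, the Fredholm alternative yields a linear dependency among the columns
  of \<open>K\<close> or the rows of \<open>H\<close>, and this shortens the factorization.\<close>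

lemma rank_factorization:
  fixes R :: "nat \<Rightarrow> nat \<Rightarrow> 'k::field"
  obtains r :: nat and K H L G where
    "\<And>i j. i < m \<Longrightarrow> j < n \<Longrightarrow> R i j = (\<Sum>l<r. K i l * H l j)"
    "\<And>l l'. l < r \<Longrightarrow> l' < r \<Longrightarrow> (\<Sum>i<m. L l i * K i l') = of_bool (l = l')"
    "\<And>l l'. l < r \<Longrightarrow> l' < r \<Longrightarrow> (\<Sum>j<n. H l j * G j l') = of_bool (l = l')"
proof -
  define fac where "fac r \<longleftrightarrow> (\<exists>K H. \<forall>i<m. \<forall>j<n. R i j = (\<Sum>l<r. K i l * H l j))" for r :: nat
  have "fac n" unfolding fac_def
    by (intro exI[of _ R] exI[of _ "\<lambda>l j. of_bool (l = j)"]) (simp add: of_bool_def if_distrib[of "(*) _"] cong: if_cong)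
  define r where "r = (LEAST r. fac r)"
  have "fac r" unfolding r_def using \<open>fac n\<close> by (rule LeastI)
  then obtain K H where KH: "\<And>i j. i < m \<Longrightarrow> j < n \<Longrightarrow> R i j = (\<Sum>l<r. K i l * H l j)"
    unfolding fac_def by blast
  have least: False if S: "finite S" "card S < r"
    "\<And>i j. i < m \<Longrightarrow> j < n \<Longrightarrow> R i j = (\<Sum>l\<in>S. K' i l * H' l j)" for K' H' and S :: "nat set"
  proof -
    obtain g where g: "bij_betw g {..<card S} S"
      using ex_bij_betw_nat_finite[OF S(1)] by (auto simp: lessThan_atLeast0)
    have "fac (card S)" unfolding fac_def
    proof (intro exI allI impI)
      fix i j assume "i < m" "j < n"
      then show "R i j = (\<Sum>l<card S. K' i (g l) * H' (g l) j)"
        using S(3) sum.reindex_bij_betw[OF g, of "\<lambda>l. K' i l * H' l j"] by simp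
    qed
    then show False using S(2) not_less_Least unfolding r_def by blast
  qed
  have L: "\<exists>c. \<forall>l'<r. (\<Sum>i<m. c i * K i l') = of_bool (l = l')" if "l < r" for l
  proof (rule ccontr)
    assume neg: "\<not> ?thesis"
    have "\<not> (\<exists>c. \<forall>l'\<in>{..<r}. (\<Sum>i<m. K i l' * c i) = of_bool (l = l'))"
      using neg by (simp only: mult.commute[of "K _ _"] Ball_def lessThan_iff) blast
    with fredholm_alternative[of "{..<m}" "{..<r}" "\<lambda>l' i. K i l'" "\<lambda>l'. of_bool (l = l')"]
    obtain w where w0: "\<And>i. i < m \<Longrightarrow> (\<Sum>l'<r. w l' * K i l') = 0"
      and "(\<Sum>l'<r. w l' * of_bool (l = l')) \<noteq> 0" by auto
    then have wl: "w l \<noteq> 0" using that by (simp add: of_bool_def if_distrib[of "(*) _"] cong: if_cong)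
    let ?S = "{..<r} - {l}"
    \<comment> \<open>Column \<open>l\<close> of \<open>K\<close> is the combination of the other
      columns with coefficients \<open>- w l' / w l\<close>; absorbing these into \<open>H\<close>
      drops the index \<open>l\<close>.\<close>
    have "R i j = (\<Sum>l'\<in>?S. K i l' * (H l' j - w l' / w l * H l j))" if "i < m" "j < n" for i j
    proof -
      have "(\<Sum>l'<r. w l' * K i l') = w l * K i l + (\<Sum>l'\<in>?S. w l' * K i l')"
        using \<open>l < r\<close> by (simp add: sum.remove)
      then have 1: "(\<Sum>l'\<in>?S. w l' * K i l') = - w l * K i l"
        using w0[OF \<open>i < m\<close>] by (simp add: eq_neg_iff_add_eq_0 add.commute)
      have "(\<Sum>l'\<in>?S. K i l' * (H l' j - w l' / w l * H l j)) =
        (\<Sum>l'\<in>?S. K i l' * H l' j) - (\<Sum>l'\<in>?S. w l' * K i l') / w l * H l j"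
        by (simp add: algebra_simps sum_subtractf sum_distrib_left sum_distrib_right sum_divide_distrib)
      also have "\<dots> = (\<Sum>l'<r. K i l' * H l' j)"
        unfolding 1 using wl \<open>l < r\<close> by (simp add: sum.remove)
      finally show ?thesis using KH that by simp
    qed
    moreover have "card ?S < r" using that by simp
    ultimately show False using least[of ?S K "\<lambda>l' j. H l' j - w l' / w l * H l j"] by simp
  qed
  have G: "\<exists>c. \<forall>l'<r. (\<Sum>j<n. H l' j * c j) = of_bool (l' = l)" if "l < r" for l
  proof (rule ccontr)
    assume neg: "\<not> ?thesis"
    then have "\<not> (\<exists>c. \<forall>l'\<in>{..<r}. (\<Sum>j<n. H l' j * c j) = of_bool (l' = l))"
      by (simp only: Ball_def lessThan_iff) blast
    with fredholm_alternative[of "{..<n}" "{..<r}" H "\<lambda>l'. of_bool (l' = l)"]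
    obtain w where w0: "\<And>j. j < n \<Longrightarrow> (\<Sum>l'<r. w l' * H l' j) = 0"
      and "(\<Sum>l'<r. w l' * of_bool (l' = l)) \<noteq> 0" by auto
    then have wl: "w l \<noteq> 0" using that by (simp add: of_bool_def if_distrib[of "(*) _"] cong: if_cong)
    let ?S = "{..<r} - {l}"
    have "R i j = (\<Sum>l'\<in>?S. (K i l' - w l' / w l * K i l) * H l' j)" if "i < m" "j < n" for i j
    proof -
      have "(\<Sum>l'<r. w l' * H l' j) = w l * H l j + (\<Sum>l'\<in>?S. w l' * H l' j)"
        using \<open>l < r\<close> by (simp add: sum.remove)
      then have 1: "(\<Sum>l'\<in>?S. w l' * H l' j) = - w l * H l j"
        using w0[OF \<open>j < n\<close>] by (simp add: eq_neg_iff_add_eq_0 add.commute)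
      have "(\<Sum>l'\<in>?S. (K i l' - w l' / w l * K i l) * H l' j) =
        (\<Sum>l'\<in>?S. K i l' * H l' j) - (\<Sum>l'\<in>?S. w l' * H l' j) / w l * K i l"
        by (simp add: algebra_simps sum_subtractf sum_distrib_left sum_distrib_right sum_divide_distrib)
      also have "\<dots> = (\<Sum>l'<r. K i l' * H l' j)"
        unfolding 1 using wl \<open>l < r\<close> by (simp add: sum.remove)
      finally show ?thesis using KH that by simp
    qed
    moreover have "card ?S < r" using that by simp
    ultimately show False using least[of ?S "\<lambda>i l'. K i l' - w l' / w l * K i l" H] by simp
  qed
  from L obtain L' where L': "\<And>l l'. l < r \<Longrightarrow> l' < r \<Longrightarrow> (\<Sum>i<m. L' l i * K i l') = of_bool (l = l')"
    by metis
  from G obtain G' where G': "\<And>l l'. l < r \<Longrightarrow> l' < r \<Longrightarrow> (\<Sum>j<n. H l' j * G' l j) = of_bool (l' = l)"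
    by metis
  show thesis by (rule that[of K H r L' "\<lambda>j l. G' l j"]) (use KH L' G' in auto)
qed

section \<open>Vectors as functions on the natural numbers, and linear maps between coordinate
  spaces\<close>

text \<open>A vector of k^n is a function \<open>x\<close> with \<open>restr n x = x\<close>, and
  addition is pointwise. Padding by 0 below the last row makes the operators of two matrices of one
  shape equal as functions only if the matrices are equal.\<close>

definition act :: "'k::field mat \<Rightarrow> (nat \<Rightarrow> 'k) \<Rightarrow> nat \<Rightarrow> 'k" where
  "act M x = (\<lambda>i. if i < dim_row M then \<Sum>j<dim_col M. M $$ (i, j) * x j else 0)"

definition restr :: "nat \<Rightarrow> (nat \<Rightarrow> 'k::zero) \<Rightarrow> nat \<Rightarrow> 'k" where
  "restr n x = (\<lambda>i. if i < n then x i else 0)"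

text \<open>Such an \<open>f\<close> ignores the coordinates from \<open>m\<close> on and has values
  supported below \<open>n\<close>. Hence \<open>restr n\<close> is the identity of k^n, and inverse
  laws take the form \<open>g (f x) = restr m x\<close> for arbitrary \<open>x\<close>.\<close>

definition lin :: "nat \<Rightarrow> nat \<Rightarrow> ((nat \<Rightarrow> 'k::field) \<Rightarrow> nat \<Rightarrow> 'k) \<Rightarrow> bool" where
  "lin m n f \<longleftrightarrow> (\<exists>M\<in>carrier_mat n m. f = act M)"

definition mat_of :: "nat \<Rightarrow> nat \<Rightarrow> ((nat \<Rightarrow> 'k::field) \<Rightarrow> nat \<Rightarrow> 'k) \<Rightarrow> 'k mat" where
  "mat_of m n f = mat n m (\<lambda>(i, j). f (\<lambda>l. of_bool (l = j)) i)"

lemma sum_of_bool_mult [simp]: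
  fixes f :: "nat \<Rightarrow> 'k::semiring_1"
  assumes "finite S"
  shows "(\<Sum>j\<in>S. f j * of_bool (j = l)) = (if l \<in> S then f l else 0)"
    "(\<Sum>j\<in>S. of_bool (j = l) * f j) = (if l \<in> S then f l else 0)"
    "(\<Sum>j\<in>S. f j * of_bool (l = j)) = (if l \<in> S then f l else 0)"
    "(\<Sum>j\<in>S. of_bool (l = j) * f j) = (if l \<in> S then f l else 0)"
  using assms by (simp_all add: of_bool_def if_distrib[of "(*) _"] if_distrib[of "\<lambda>x. x * _"] cong: if_cong)

lemma act_mult: "dim_col A = dim_row B \<Longrightarrow> act (A * B) x = act A (act B x)"
proof -
  assume d: "dim_col A = dim_row B"
  have "(\<Sum>j<dim_col B. (\<Sum>l<dim_row B. A $$ (i, l) * B $$ (l, j)) * x j) =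
    (\<Sum>l<dim_row B. A $$ (i, l) * (\<Sum>j<dim_col B. B $$ (l, j) * x j))" for i
    unfolding sum_distrib_left sum_distrib_right by (subst sum.swap) (simp add: mult.assoc)
  then show ?thesis using d
    by (auto simp: act_def fun_eq_iff scalar_prod_def lessThan_atLeast0 intro!: sum.cong)
qed

lemma act_add: "A \<in> carrier_mat n m \<Longrightarrow> B \<in> carrier_mat n m \<Longrightarrow> act (A + B) x = act A x + act B x"
  by (auto simp: act_def fun_eq_iff sum.distrib algebra_simps)

lemma act_zero_mat [simp]: "act (0\<^sub>m n m) x = 0"
  by (auto simp: act_def fun_eq_iff)

lemma act_one_mat [simp]: "act (1\<^sub>m n) x = restr n x"
  by (auto simp: act_def fun_eq_iff restr_def if_distrib[of "\<lambda>x. x * _"] cong: if_cong)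

lemma act_eqD:
  assumes "A \<in> carrier_mat n m" "B \<in> carrier_mat n m" "\<And>x. act A x = act B x"
  shows "A = B"
proof (rule eq_matI)
  fix i j assume "i < dim_row B" "j < dim_col B"
  then show "A $$ (i, j) = B $$ (i, j)"
    using fun_cong[OF assms(3)[of "\<lambda>l. of_bool (l = j)"], of i] assms(1,2) by (simp add: act_def)
qed (use assms in auto)

text \<open>The last two conditions confine the domain to the first \<open>m\<close> and the values
  to the first \<open>n\<close> coordinates; the matrix is then read off at the unit
  vectors.\<close>

lemma linI:
  assumes "\<And>x y. f (x + y) = f x + f y" "\<And>s x. f (\<lambda>i. s * x i) = (\<lambda>i. s * f x i)"
    "\<And>x. f (restr m x) = f x" "\<And>x. restr n (f x) = f x"
  shows "lin m n f"
proof -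
  have "f (restr l x) = (\<lambda>i. \<Sum>j<l. f (\<lambda>l. of_bool (l = j)) i * x j)" for l x
  proof (induction l)
    case 0
    have "restr 0 x = (\<lambda>i. 0 * x i)" by (simp add: restr_def)
    then show ?case using assms(2)[of 0 x] by simp
  next
    case (Suc l)
    have "restr (Suc l) x = restr l x + (\<lambda>i. x l * of_bool (i = l))"
      by (auto simp: restr_def fun_eq_iff less_Suc_eq)
    then have "f (restr (Suc l) x) = f (restr l x) + (\<lambda>i. x l * f (\<lambda>i. of_bool (i = l)) i)"
      by (simp only: assms(1,2))
    then show ?case by (simp add: Suc fun_eq_iff mult.commute)
  qed
  then have "f x = (\<lambda>i. \<Sum>j<m. f (\<lambda>l. of_bool (l = j)) i * x j)" for x
    using assms(3) by metis
  note eq = this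
  have "act (mat_of m n f) x = restr n (f x)" for x
    by (subst eq[of x]) (auto simp: act_def mat_of_def restr_def fun_eq_iff)
  then have "f x = act (mat_of m n f) x" for x
    using assms(4)[of x] by simp
  then have "f = act (mat_of m n f)" by (rule ext)
  then show ?thesis unfolding lin_def by (intro bexI[of _ "mat_of m n f"]) (simp_all add: mat_of_def)
qed

lemma mat_of_carrier [simp]: "mat_of m n f \<in> carrier_mat n m"
  by (simp add: mat_of_def)

lemma act_mat_of: assumes "lin m n f" shows "act (mat_of m n f) = f"
proof -
  obtain M where M: "M \<in> carrier_mat n m" "f = act M" using assms unfolding lin_def by blast
  have "mat_of m n f = M" using M by (intro eq_matI) (auto simp: mat_of_def act_def)
  then show ?thesis using M by simp
qed

lemma mat_of_act: "M \<in> carrier_mat n m \<Longrightarrow> mat_of m n (act M) = M"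
  by (intro eq_matI) (auto simp: mat_of_def act_def)

lemma lin_act: "M \<in> carrier_mat n m \<Longrightarrow> lin m n (act M)"
  unfolding lin_def by blast

lemma restr_simps [simp]: "restr n (restr n x) = restr n x" "restr n 0 = 0"
  "restr n (x + y :: nat \<Rightarrow> 'k::field) = restr n x + restr n y"
  "restr 0 x = 0"
  by (auto simp: restr_def fun_eq_iff)

lemma restr_scale: "restr n (\<lambda>i. s * x i) = (\<lambda>i. s * restr n x i :: 'k::field)"
  by (auto simp: restr_def fun_eq_iff)

lemma lin_simps:
  assumes "lin m n f"
  shows lin_add: "f (x + y) = f x + f y" and lin_scale: "f (\<lambda>i. s * x i) = (\<lambda>i. s * f x i)"
    and lin_restr: "f (restr m x) = f x" and restr_lin: "restr n (f x) = f x" and lin_zero: "f 0 = 0"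
    and lin_uminus: "f (- x) = - f x" and lin_diff: "f (x - y) = f x - f y"
proof -
  obtain M where M: "M \<in> carrier_mat n m" "f = act M" using assms unfolding lin_def by blast
  show add: "f (x + y) = f x + f y" for x y
    using M by (auto simp: act_def fun_eq_iff sum.distrib algebra_simps)
  show "f (\<lambda>i. s * x i) = (\<lambda>i. s * f x i)" "f (restr m x) = f x" "restr n (f x) = f x"
    and zero: "f 0 = 0"
    using M by (auto simp: act_def fun_eq_iff restr_def sum_distrib_left algebra_simps)
  show um: "f (- x) = - f x" for x using add[of x "- x"] zero by (simp add: eq_neg_iff_add_eq_0 add.commute)
  show "f (x - y) = f x - f y" using add[of x "- y"] um[of y] by simp
qed

lemma lin_sum:
  assumes "lin m n f"
  shows "f (\<lambda>i. \<Sum>j\<in>S. c j * v j i) = (\<lambda>i. \<Sum>j\<in>S. c j * f (v j) i)"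
proof (cases "finite S")
  case True
  then show ?thesis
  proof (induction S rule: finite_induct)
    case empty
    show ?case using lin_zero[OF assms] by (simp add: zero_fun_def)
  next
    case (insert k S)
    have "(\<lambda>i. \<Sum>j\<in>insert k S. c j * v j i) = (\<lambda>i. c k * v k i) + (\<lambda>i. \<Sum>j\<in>S. c j * v j i)"
      using insert by (auto simp: fun_eq_iff)
    then have "f (\<lambda>i. \<Sum>j\<in>insert k S. c j * v j i) = f (\<lambda>i. c k * v k i) + f (\<lambda>i. \<Sum>j\<in>S. c j * v j i)"
      by (simp only: lin_add[OF assms])
    then show ?case unfolding insert.IH lin_scale[OF assms] using insert.hyps by (auto simp: fun_eq_iff)
  qed
next
  case False
  then show ?thesis using lin_zero[OF assms] by (simp add: zero_fun_def)
qed

lemma lin_comp: "lin n p g \<Longrightarrow> lin m n f \<Longrightarrow> lin m p (\<lambda>x. g (f x))"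
proof -
  assume g: "lin n p g" and f: "lin m n f"
  show ?thesis by (rule linI) (simp_all add: lin_simps[OF f] lin_simps[OF g])
qed

lemma lin_plus: "lin m n f \<Longrightarrow> lin m n g \<Longrightarrow> lin m n (\<lambda>x. f x + g x)"
proof -
  assume f: "lin m n f" and g: "lin m n g"
  show ?thesis
    by (rule linI) (simp_all add: lin_simps[OF f] lin_simps[OF g] algebra_simps fun_eq_iff)
qed

lemma lin_minus:
  fixes f g :: "(nat \<Rightarrow> 'k::field) \<Rightarrow> nat \<Rightarrow> 'k"
  assumes f: "lin m n f" and g: "lin m n g"
  shows "lin m n (\<lambda>x. f x - g x)"
proof -
  have [simp]: "restr n (x - y) = restr n x - restr n y" for x y :: "nat \<Rightarrow> 'k"
    by (auto simp: restr_def fun_eq_iff)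
  show ?thesis
    by (rule linI) (simp_all add: lin_simps[OF f] lin_simps[OF g] algebra_simps fun_eq_iff)
qed

lemma lin_0 [simp]: "lin m n (\<lambda>x. 0)"
  by (rule linI) (auto simp: fun_eq_iff)

lemma lin_id [simp]: "lin n n (restr n)"
  by (rule linI) (auto simp: restr_scale)

lemma lin_eqI:
  assumes "lin m n f" "lin m n g" "\<And>j. j < m \<Longrightarrow> f (\<lambda>l. of_bool (l = j)) = g (\<lambda>l. of_bool (l = j))"
  shows "f = g"
proof -
  have "mat_of m n f = mat_of m n g" using assms(3) by (auto simp: mat_of_def intro!: eq_matI)
  then show ?thesis using act_mat_of[OF assms(1)] act_mat_of[OF assms(2)] by metis
qed

text \<open>The image of \<open>f\<close> as an abstract space of dimension \<open>r\<close>: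
  \<open>h\<close> maps onto it and has the section \<open>g\<close>, while \<open>k\<close>
  includes it and has the retraction \<open>l\<close>.\<close>

lemma lin_factorization:
  assumes "lin n m f"
  obtains r :: nat and k h l g where "lin r m k" "lin n r h" "lin m r l" "lin r n g"
    "\<And>x. f x = k (h x)" "\<And>x. l (k x) = restr r x" "\<And>x. h (g x) = restr r x"
proof -
  define R where "R i j = mat_of n m f $$ (i, j)" for i j
  obtain r :: nat and K H L G where KH: "\<And>i j. i < m \<Longrightarrow> j < n \<Longrightarrow> R i j = (\<Sum>l<r. K i l * H l j)"
    and L: "\<And>l l'. l < r \<Longrightarrow> l' < r \<Longrightarrow> (\<Sum>i<m. L l i * K i l') = of_bool (l = l')"
    and G: "\<And>l l'. l < r \<Longrightarrow> l' < r \<Longrightarrow> (\<Sum>j<n. H l j * G j l') = of_bool (l = l')"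
    by (rule rank_factorization[of m n R]) (rule that)
  let ?K = "mat m r (\<lambda>(i, l). K i l)" let ?H = "mat r n (\<lambda>(i, l). H i l)"
  let ?L = "mat r m (\<lambda>(i, l). L i l)" let ?G = "mat n r (\<lambda>(i, l). G i l)"
  have "mat_of n m f = ?K * ?H"
    using KH by (intro eq_matI) (auto simp: R_def scalar_prod_def lessThan_atLeast0 mat_of_def)
  then have 1: "f x = act ?K (act ?H x)" for x
    using act_mat_of[OF assms] act_mult[of ?K ?H x] by simp
  have "?L * ?K = 1\<^sub>m r" "?H * ?G = 1\<^sub>m r"
    using L G by (auto intro!: eq_matI simp: scalar_prod_def lessThan_atLeast0)
  then have "act ?L (act ?K x) = restr r x" "act ?H (act ?G x) = restr r x" for x
    using act_mult[of ?L ?K x] act_mult[of ?H ?G x] by simp_all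
  then show thesis using 1
    by (intro that[of r "act ?K" "act ?H" "act ?L" "act ?G"]) (auto intro!: lin_act)
qed

lemma idempotent_factorization:
  assumes e: "lin n n e" and idem: "\<And>x. e (e x) = e x"
  obtains r :: nat and k h where "lin r n k" "lin n r h" "\<And>x. k (h x) = e x" "\<And>x. h (k x) = restr r x"
proof -
  obtain r k h l g where k: "lin r n k" and h: "lin n r h" and l: "lin n r l" and g: "lin r n g"
    and e': "\<And>x. e x = k (h x)" and lk: "\<And>x. l (k x) = restr r x" and hg: "\<And>x. h (g x) = restr r x"
    using lin_factorization[OF e] by blast
  have "h (k x) = restr r x" for x
  proof -
    \<comment> \<open>In \<open>k h k h = k h\<close>, the map \<open>l\<close> cancels
      \<open>k\<close> on the left and \<open>g\<close> cancels \<open>h\<close> on the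
      right.\<close>
    have "l (e (e (g x))) = l (e (g x))" using idem by simp
    then have "restr r (h (k (restr r x))) = restr r (restr r x)" by (simp add: e' lk hg)
    then show ?thesis by (simp add: restr_lin[OF h] lin_restr[OF k])
  qed
  then show thesis using that k h e' by auto
qed

text \<open>The point is that \<open>g f\<close> is an idempotent with the same kernel as
  \<open>f\<close>. In \<open>indecomposable_cases\<close> both \<open>1 - g f\<close> and
  \<open>g f\<close> serve as projections.\<close>

lemma generalized_inverse:
  assumes f: "lin n m f"
  obtains g where "lin m n g" "\<And>x. f (g (f x)) = f x"
proof -
  obtain r k h l g where k: "lin r m k" and h: "lin n r h" and l: "lin m r l" and g: "lin r n g"
    and e': "\<And>x. f x = k (h x)" and lk: "\<And>x. l (k x) = restr r x" and hg: "\<And>x. h (g x) = restr r x"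
    using lin_factorization[OF f] by blast
  show thesis
    by (rule that[of "\<lambda>x. g (l x)"]) (simp_all add: lin_comp[OF g l] e' lk hg lin_restr[OF k] restr_lin[OF h])
qed

lemma lin_kernel_nontrivial:
  assumes f: "lin m n f" and "n < m"
  obtains x where "restr m x = x" "x \<noteq> 0" "f x = (0 :: nat \<Rightarrow> 'k::field)"
proof -
  obtain M where M: "M \<in> carrier_mat n m" "f = act M" using f unfolding lin_def by blast
  obtain c where c: "\<exists>j<m. c j \<noteq> 0" "\<And>i. i < n \<Longrightarrow> (\<Sum>j<m. M $$ (i, j) * c j) = 0"
    using homogeneous_system_nontrivial[of "{..<n}" "{..<m}" "\<lambda>i j. M $$ (i, j)"] \<open>n < m\<close> by auto
  show thesis
  proof (rule that[of "restr m c"])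
    show "restr m c \<noteq> 0" using c(1) by (auto simp: restr_def fun_eq_iff)
    show "f (restr m c) = 0" using c(2) M by (auto simp: fun_eq_iff act_def restr_def)
  qed simp
qed

text \<open>A map with a left inverse has no kernel, whereas a map to a smaller space has one. Used
  twice, this gives invariance of dimension.\<close>

lemma retract_dim_le:
  assumes f: "lin m n f" and g: "lin n m g" and gf: "\<And>x. g (f x) = restr m (x :: nat \<Rightarrow> 'k::field)"
  shows "m \<le> n"
proof (rule ccontr)
  assume "\<not> m \<le> n"
  then obtain x where "restr m x = x" "x \<noteq> 0" "f x = 0" using lin_kernel_nontrivial[OF f] by (metis not_le)
  then show False using gf[of x] lin_zero[OF g] by simp
qed

definition pairing :: "nat \<Rightarrow> (nat \<Rightarrow> 'k::field) \<Rightarrow> (nat \<Rightarrow> 'k) \<Rightarrow> 'k" where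
  "pairing n \<phi> x = (\<Sum>i<n. \<phi> i * x i)"

lemma pairing_simps: "pairing n \<phi> (x + y) = pairing n \<phi> x + pairing n \<phi> y"
  "pairing n \<phi> (\<lambda>i. s * x i) = s * pairing n \<phi> x" "pairing n \<phi> (restr n x) = pairing n \<phi> x"
  "pairing n \<phi> 0 = 0"
  "pairing n \<phi> (\<lambda>i. \<Sum>j\<in>S. c j * v j i) = (\<Sum>j\<in>S. c j * pairing n \<phi> (v j))"
proof -
  show "pairing n \<phi> (\<lambda>i. \<Sum>j\<in>S. c j * v j i) = (\<Sum>j\<in>S. c j * pairing n \<phi> (v j))"
    unfolding pairing_def sum_distrib_left by (subst sum.swap) (simp add: algebra_simps)
qed (auto simp: pairing_def restr_def sum.distrib sum_distrib_left algebra_simps)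

lemma exists_functional:
  assumes "restr n x = x" "x \<noteq> (0 :: nat \<Rightarrow> 'k::field)"
  obtains \<phi> where "pairing n \<phi> x = 1"
proof -
  obtain i where "x i \<noteq> 0" using assms(2) by (auto simp: fun_eq_iff)
  moreover have "i < n" using assms(1) calculation by (auto simp: restr_def fun_eq_iff) metis
  ultimately have "pairing n (\<lambda>j. (1 / x i) * of_bool (j = i)) x = 1"
    unfolding pairing_def by (simp add: mult.assoc mult.left_commute[of _ "of_bool _"])
      (simp add: sum_distrib_left[symmetric] sum_divide_distrib[symmetric])
  then show thesis by (rule that)
qed

section \<open>Modules, idempotents and retracts\<close>

abbreviation opA :: "'k::field rep \<Rightarrow> (nat \<Rightarrow> 'k) \<Rightarrow> nat \<Rightarrow> 'k" where "opA X \<equiv> act (fst X)"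
abbreviation opB :: "'k::field rep \<Rightarrow> (nat \<Rightarrow> 'k) \<Rightarrow> nat \<Rightarrow> 'k" where "opB X \<equiv> act (fst (snd X))"
abbreviation opC :: "'k::field rep \<Rightarrow> (nat \<Rightarrow> 'k) \<Rightarrow> nat \<Rightarrow> 'k" where "opC X \<equiv> act (snd (snd X))"

definition hm :: "'k::field rep \<Rightarrow> 'k rep \<Rightarrow> ((nat \<Rightarrow> 'k) \<Rightarrow> nat \<Rightarrow> 'k) \<Rightarrow> bool" where
  "hm X Y f \<longleftrightarrow> well_formed X \<and> well_formed Y \<and> lin (rdim X) (rdim Y) f \<and>
     (\<forall>x. f (opA X x) = opA Y (f x)) \<and> (\<forall>x. f (opB X x) = opB Y (f x)) \<and> (\<forall>x. f (opC X x) = opC Y (f x))"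

text \<open>The relations are stated for operators on an additive group, so that they can be checked
  vector by vector on retracts and on the pieces of a frame.\<close>

definition umod_rel :: "('v::ab_group_add \<Rightarrow> 'v) \<Rightarrow> ('v \<Rightarrow> 'v) \<Rightarrow> ('v \<Rightarrow> 'v) \<Rightarrow> bool" where
  "umod_rel a b c \<longleftrightarrow> (\<forall>x. a (b x) + b (a x) = c x \<and> a (c x) + c (a x) = a x \<and> b (c x) + c (b x) = b x \<and>
     a (a (a (a x))) = 0 \<and> b (b (b (b x))) = 0 \<and> c (c x) + c x = 0)"

lemma well_formed_carrier:
  assumes "well_formed X"
  shows "fst X \<in> carrier_mat (rdim X) (rdim X)" "fst (snd X) \<in> carrier_mat (rdim X) (rdim X)"
    "snd (snd X) \<in> carrier_mat (rdim X) (rdim X)"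
  using assms by (auto simp: well_formed_def split: prod.splits)

lemma lin_ops:
  assumes "well_formed X"
  shows "lin (rdim X) (rdim X) (opA X)" "lin (rdim X) (rdim X) (opB X)" "lin (rdim X) (rdim X) (opC X)"
  using well_formed_carrier[OF assms] lin_act by blast+

lemma mat_eq_iff_act:
  assumes "A \<in> carrier_mat n m" "B \<in> carrier_mat n m"
  shows "A = B \<longleftrightarrow> (\<forall>x. act A x = act B x)"
  using act_eqD[OF assms] by auto

lemma act_pow4: "A \<in> carrier_mat n n \<Longrightarrow> act (A ^\<^sub>m 4) x = act A (act A (act A (act A x)))"
proof -
  assume A: "A \<in> carrier_mat n n"
  have "A ^\<^sub>m 4 = A * A * A * A"
    using A by (simp add: eval_nat_numeral)
  then show ?thesis using A by (simp add: act_mult)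
qed

lemma is_umod_iff: "is_umod X \<longleftrightarrow> well_formed X \<and> umod_rel (opA X) (opB X) (opC X)"
proof -
  obtain A B C where X: "X = (A, B, C)" by (cases X)
  show ?thesis
  proof (cases "well_formed X")
    case True
    define n where "n = dim_row A"
    have c: "A \<in> carrier_mat n n" "B \<in> carrier_mat n n" "C \<in> carrier_mat n n"
      using True unfolding X n_def by (auto simp: well_formed_def rdim_def)
    have d: "A * B \<in> carrier_mat n n" "B * A \<in> carrier_mat n n" "A * C \<in> carrier_mat n n"
      "C * A \<in> carrier_mat n n" "B * C \<in> carrier_mat n n" "C * B \<in> carrier_mat n n" "C * C \<in> carrier_mat n n"
      using c by auto
    have p: "A ^\<^sub>m 4 \<in> carrier_mat n n" "B ^\<^sub>m 4 \<in> carrier_mat n n"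
      using c by (auto intro: pow_carrier_mat)
    have "is_umod X \<longleftrightarrow> A * B + B * A = C \<and> A * C + C * A = A \<and> B * C + C * B = B \<and>
       A ^\<^sub>m 4 = 0\<^sub>m n n \<and> B ^\<^sub>m 4 = 0\<^sub>m n n \<and> C * C + C = 0\<^sub>m n n"
      using c unfolding X is_umod_def by (auto simp: Let_def n_def[symmetric])
    also have "\<dots> \<longleftrightarrow> umod_rel (act A) (act B) (act C)"
    proof -
      have "A * B + B * A = C \<longleftrightarrow> (\<forall>x. act A (act B x) + act B (act A x) = act C x)"
        "A * C + C * A = A \<longleftrightarrow> (\<forall>x. act A (act C x) + act C (act A x) = act A x)"
        "B * C + C * B = B \<longleftrightarrow> (\<forall>x. act B (act C x) + act C (act B x) = act B x)"
        "A ^\<^sub>m 4 = 0\<^sub>m n n \<longleftrightarrow> (\<forall>x. act A (act A (act A (act A x))) = 0)"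
        "B ^\<^sub>m 4 = 0\<^sub>m n n \<longleftrightarrow> (\<forall>x. act B (act B (act B (act B x))) = 0)"
        "C * C + C = 0\<^sub>m n n \<longleftrightarrow> (\<forall>x. act C (act C x) + act C x = 0)"
        unfolding mat_eq_iff_act[OF add_carrier_mat[OF d(2)] c(3)] mat_eq_iff_act[OF add_carrier_mat[OF d(4)] c(1)]
          mat_eq_iff_act[OF add_carrier_mat[OF d(6)] c(2)] mat_eq_iff_act[OF p(1) zero_carrier_mat]
          mat_eq_iff_act[OF p(2) zero_carrier_mat] mat_eq_iff_act[OF add_carrier_mat[OF c(3)] zero_carrier_mat]
          act_add[OF d(1) d(2)] act_add[OF d(3) d(4)] act_add[OF d(5) d(6)]
          act_add[OF d(7) c(3)] act_pow4[OF c(1)] act_pow4[OF c(2)] act_zero_mat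
        by (simp_all only: act_mult carrier_matD[OF c(1)] carrier_matD[OF c(2)] carrier_matD[OF c(3)])
      then show ?thesis unfolding umod_rel_def by (simp only: all_conj_distrib)
    qed
    finally show ?thesis using True by (simp add: X)
  next
    case False
    moreover have "is_umod X \<Longrightarrow> well_formed X"
      unfolding X is_umod_def well_formed_def rdim_def Let_def prod.case fst_conv by blast
    ultimately show ?thesis by blast
  qed
qed

lemma is_hom_imp_hm: "is_hom X Y F \<Longrightarrow> hm X Y (act F)"
proof -
  assume h: "is_hom X Y F"
  obtain A B C A' B' C' where X: "X = (A, B, C)" "Y = (A', B', C')" by (cases X, cases Y)
  have c: "well_formed X" "well_formed Y" "F \<in> carrier_mat (rdim Y) (rdim X)"
    "F * A = A' * F" "F * B = B' * F" "F * C = C' * F"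
    using h unfolding X is_hom_def by auto
  have w: "act (F * A) x = act (A' * F) x" "act (F * B) x = act (B' * F) x" "act (F * C) x = act (C' * F) x" for x
    using c by simp_all
  show ?thesis using well_formed_carrier[OF c(1)] well_formed_carrier[OF c(2)] c(1-3) w
    unfolding hm_def by (auto simp: X act_mult intro!: lin_act)
qed

lemma act_intertwineD:
  assumes "F \<in> carrier_mat m n" "A \<in> carrier_mat n n" "A' \<in> carrier_mat m m"
    "\<And>x. act F (act A x) = act A' (act F x)"
  shows "F * A = A' * F"
  using assms by (intro act_eqD[of _ m n]) (auto simp: act_mult)

lemma hm_imp_is_hom: "hm X Y f \<Longrightarrow> is_hom X Y (mat_of (rdim X) (rdim Y) f)"
proof -
  assume h: "hm X Y f"
  obtain A B C A' B' C' where X: "X = (A, B, C)" "Y = (A', B', C')" by (cases X, cases Y)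
  let ?F = "mat_of (rdim X) (rdim Y) f"
  have c: "well_formed X" "well_formed Y" and F: "?F \<in> carrier_mat (rdim Y) (rdim X)" "act ?F = f"
    and eq: "\<And>x. f (act A x) = act A' (f x)" "\<And>x. f (act B x) = act B' (f x)" "\<And>x. f (act C x) = act C' (f x)"
    using h act_mat_of unfolding hm_def X by auto
  note cc = well_formed_carrier[OF c(1)] well_formed_carrier[OF c(2)]
  have "?F * A = A' * ?F" "?F * B = B' * ?F" "?F * C = C' * ?F"
    using cc eq F(2) by (auto simp: X intro!: act_intertwineD[OF F(1)[unfolded X]])
  then show ?thesis using c F unfolding is_hom_def X by auto
qed

lemma hm_comp: "hm X Y f \<Longrightarrow> hm Y Z g \<Longrightarrow> hm X Z (\<lambda>x. g (f x))"
  unfolding hm_def by (auto intro: lin_comp)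

lemma hm_id:
  assumes w: "well_formed X"
  shows "hm X X (restr (rdim X))"
  unfolding hm_def using w
  by (simp add: lin_simps(3,4)[OF lin_ops(1)[OF w]] lin_simps(3,4)[OF lin_ops(2)[OF w]] lin_simps(3,4)[OF lin_ops(3)[OF w]])

text \<open>The matrix inverse of a homomorphism commutes with the operators as well. Conversely,
  two inverse maps force equal dimensions by \<open>retract_dim_le\<close>.\<close>

lemma mod_iso_iff:
  "mod_iso X Y \<longleftrightarrow> (\<exists>f g. hm X Y f \<and> hm Y X g \<and> (\<forall>x. g (f x) = restr (rdim X) x) \<and> (\<forall>y. f (g y) = restr (rdim Y) y))"
  (is "_ \<longleftrightarrow> ?R")
proof
  assume "mod_iso X Y"
  then obtain P where d: "rdim X = rdim Y" and P: "is_hom X Y P" "invertible_mat P"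
    unfolding mod_iso_def by blast
  define n where "n = rdim X"
  have Pc: "P \<in> carrier_mat n n" using P(1) d unfolding is_hom_def n_def by (auto split: prod.splits)
  obtain Q where Q: "inverts_mat P Q" "inverts_mat Q P" using P(2) unfolding invertible_mat_def by blast
  have "dim_row Q = n" "dim_col Q = n"
    using arg_cong[OF Q(1)[unfolded inverts_mat_def], of dim_col] arg_cong[OF Q(2)[unfolded inverts_mat_def], of dim_col] Pc
    by auto
  then have Qc: "Q \<in> carrier_mat n n" by blast
  have PQ: "P * Q = 1\<^sub>m n" "Q * P = 1\<^sub>m n" using Q Pc Qc unfolding inverts_mat_def by auto
  have pq: "act P (act Q x) = restr n x" "act Q (act P x) = restr n x" for x
    using act_mult[of P Q x] act_mult[of Q P x] PQ Pc Qc by auto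
  have hP: "hm X Y (act P)" using is_hom_imp_hm[OF P(1)] .
  have "act Q (opA Y x) = opA X (act Q x)" "act Q (opB Y x) = opB X (act Q x)" "act Q (opC Y x) = opC X (act Q x)" for x
  proof -
    have w: "well_formed X" "well_formed Y" using hP unfolding hm_def by auto
    have *: "act Q (op2 x) = op1 (act Q x)"
      if "lin n n op1" "lin n n op2" "\<And>x. act P (op1 x) = op2 (act P x)" for op1 op2
    proof -
      have "op2 x = op2 (act P (act Q x))" using pq(1) lin_restr[OF that(2)] by simp
      then have "act Q (op2 x) = act Q (act P (op1 (act Q x)))" using that(3) by simp
      then show ?thesis using pq(2) restr_lin[OF that(1)] by simp
    qed
    show "act Q (opA Y x) = opA X (act Q x)" "act Q (opB Y x) = opB X (act Q x)" "act Q (opC Y x) = opC X (act Q x)"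
      using lin_ops[OF w(1)] lin_ops[OF w(2)] hP d unfolding hm_def n_def[symmetric]
      by (auto intro!: *)
  qed
  then have "hm Y X (act Q)" using hP Qc d lin_act[OF Qc] unfolding hm_def n_def by auto
  then show ?R using hP pq d n_def by (intro exI[of _ "act P"] exI[of _ "act Q"]) auto
next
  assume ?R
  then obtain f g where fg: "hm X Y f" "hm Y X g" "\<And>x. g (f x) = restr (rdim X) x" "\<And>y. f (g y) = restr (rdim Y) y"
    by blast
  have l: "lin (rdim X) (rdim Y) f" "lin (rdim Y) (rdim X) g" using fg unfolding hm_def by auto
  have d: "rdim X = rdim Y"
    using retract_dim_le[OF l fg(3)] retract_dim_le[OF l(2,1) fg(4)] by simp
  let ?P = "mat_of (rdim X) (rdim Y) f" let ?Q = "mat_of (rdim Y) (rdim X) g"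
  have "?P * ?Q = 1\<^sub>m (rdim X)" "?Q * ?P = 1\<^sub>m (rdim X)"
    by (rule act_eqD[of _ "rdim X" "rdim X"]; use d fg l in \<open>simp add: act_mult act_mat_of carrier_matD[OF mat_of_carrier] mult_carrier_mat[OF mat_of_carrier mat_of_carrier]\<close>)+
  then have "invertible_mat ?P"
    unfolding invertible_mat_def inverts_mat_def using d
    by (auto simp: carrier_matD[OF mat_of_carrier] intro!: exI[of _ ?Q])
  then show "mod_iso X Y" unfolding mod_iso_def using d hm_imp_is_hom[OF fg(1)] by blast
qed

lemma mod_iso_sym: "mod_iso X Y \<Longrightarrow> mod_iso Y X"
  unfolding mod_iso_iff by blast

lemma mod_iso_trans:
  assumes "mod_iso X Y" "mod_iso Y Z" shows "mod_iso X Z"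
proof -
  obtain f g where fg: "hm X Y f" "hm Y X g" "\<And>x. g (f x) = restr (rdim X) x" "\<And>y. f (g y) = restr (rdim Y) y"
    using assms(1) unfolding mod_iso_iff by blast
  obtain f' g' where fg': "hm Y Z f'" "hm Z Y g'" "\<And>x. g' (f' x) = restr (rdim Y) x" "\<And>y. f' (g' y) = restr (rdim Z) y"
    using assms(2) unfolding mod_iso_iff by blast
  have l: "lin (rdim X) (rdim Y) f" "lin (rdim Y) (rdim Z) f'" "lin (rdim Y) (rdim X) g" using fg fg' unfolding hm_def by auto
  show ?thesis unfolding mod_iso_iff
    using hm_comp[OF fg(1) fg'(1)] hm_comp[OF fg'(2) fg(2)] fg fg' restr_lin[OF l(1)] lin_restr[OF l(2)] lin_restr[OF l(3)]
    by (intro exI[of _ "\<lambda>x. f' (f x)"] exI[of _ "\<lambda>x. g (g' x)"]) auto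
qed

text \<open>\<open>k\<close> is injective and commutes with the operators, so each relation can be
  tested after applying \<open>k\<close>, where it holds in \<open>X\<close>.\<close>

lemma umod_retract:
  assumes X: "is_umod X" and k: "hm Y X k" and h: "hm X Y h" and hk: "\<And>x. h (k x) = restr (rdim Y) x"
  shows "is_umod Y"
proof -
  have w: "well_formed Y" "well_formed X" and lk: "lin (rdim Y) (rdim X) k"
    using k h unfolding hm_def by auto
  note ops = lin_ops[OF w(1)]
  have rel: "umod_rel (opA X) (opB X) (opC X)" using X is_umod_iff by blast
  have kk: "k (opA Y x) = opA X (k x)" "k (opB Y x) = opB X (k x)" "k (opC Y x) = opC X (k x)"
    "k (x + y) = k x + k y" "k 0 = 0" for x y
    using k lin_simps[OF lk] unfolding hm_def by auto
  have inj: "u = v" if "k u = k v" "restr (rdim Y) u = u" "restr (rdim Y) v = v" for u v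
    using that hk by metis
  have "umod_rel (opA Y) (opB Y) (opC Y)"
    unfolding umod_rel_def
    by (intro allI conjI; rule inj) (simp_all add: rel[unfolded umod_rel_def, rule_format] kk restr_lin[OF ops(1)] restr_lin[OF ops(2)] restr_lin[OF ops(3)])
  then show ?thesis using w is_umod_iff by blast
qed

lemma mod_iso_umod: "mod_iso X Y \<Longrightarrow> is_umod Y \<Longrightarrow> is_umod X"
  unfolding mod_iso_iff by (auto intro: umod_retract)

lemma mod_iso_rdim: "mod_iso X Y \<Longrightarrow> rdim X = rdim Y"
  by (simp add: mod_iso_def)

lemma indecomposable_iso:
  assumes "mod_iso X Y" "indecomposable Y" shows "indecomposable X"
  using assms mod_iso_umod mod_iso_rdim mod_iso_trans mod_iso_sym unfolding indecomposable_def by metis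

section \<open>Direct sums and idempotent endomorphisms\<close>

definition glue :: "nat \<Rightarrow> (nat \<Rightarrow> 'k) \<Rightarrow> (nat \<Rightarrow> 'k) \<Rightarrow> nat \<Rightarrow> 'k" where
  "glue n x y = (\<lambda>i. if i < n then x i else y (i - n))"

lemma act_four_block:
  assumes "A \<in> carrier_mat n n" "B \<in> carrier_mat m m"
  shows "act (four_block_mat A (0\<^sub>m n m) (0\<^sub>m m n) B) x = glue n (act A x) (act B (\<lambda>i. x (n + i)))"
proof (rule ext)
  fix i
  have s: "(\<Sum>j<n + m. f j) = (\<Sum>j<n. f j) + (\<Sum>j<m. f (n + j))" for f :: "nat \<Rightarrow> 'a"
    using sum.atLeastLessThan_concat[of 0 n "n + m" f] sum.shift_bounds_nat_ivl[of f 0 n m]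
    by (simp add: lessThan_atLeast0 add.commute)
  show "act (four_block_mat A (0\<^sub>m n m) (0\<^sub>m m n) B) x i = glue n (act A x) (act B (\<lambda>i. x (n + i))) i"
  proof (cases "i < n + m")
    case True
    then show ?thesis using assms by (auto simp: act_def glue_def s)
  qed (use assms in \<open>auto simp: act_def glue_def\<close>)
qed

lemma dsum_ops:
  assumes "well_formed X" "well_formed Y"
  shows "well_formed (dsum X Y)" "rdim (dsum X Y) = rdim X + rdim Y"
    "opA (dsum X Y) x = glue (rdim X) (opA X x) (opA Y (\<lambda>i. x (rdim X + i)))"
    "opB (dsum X Y) x = glue (rdim X) (opB X x) (opB Y (\<lambda>i. x (rdim X + i)))"
    "opC (dsum X Y) x = glue (rdim X) (opC X x) (opC Y (\<lambda>i. x (rdim X + i)))"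
proof -
  obtain A B C A' B' C' where X: "X = (A, B, C)" "Y = (A', B', C')" by (cases X, cases Y)
  note c = well_formed_carrier[OF assms(1), unfolded X, simplified] well_formed_carrier[OF assms(2), unfolded X, simplified]
  define n m where "n = rdim X" and "m = rdim Y"
  note c' = c[folded X, folded n_def m_def]
  have "rdim (dsum X Y) = dim_row A + dim_row A'" by (simp add: dsum_def X Let_def rdim_def)
  then show rd: "rdim (dsum X Y) = rdim X + rdim Y" using c' by (simp add: n_def m_def)
  show "well_formed (dsum X Y)"
    using c' unfolding well_formed_def rd by (simp add: dsum_def X Let_def n_def m_def)
  show "opA (dsum X Y) x = glue (rdim X) (opA X x) (opA Y (\<lambda>i. x (rdim X + i)))"
    "opB (dsum X Y) x = glue (rdim X) (opB X x) (opB Y (\<lambda>i. x (rdim X + i)))"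
    "opC (dsum X Y) x = glue (rdim X) (opC X x) (opC Y (\<lambda>i. x (rdim X + i)))"
    using act_four_block c' by (simp_all add: dsum_def X Let_def n_def m_def)
qed

text \<open>\<open>Y\<close> is the image of \<open>e\<close> in coordinates: each operator
  \<open>f\<close> of \<open>X\<close> is compressed to \<open>h f k\<close>. Both \<open>k\<close>
  and \<open>h\<close> become homomorphisms because \<open>k h = e\<close> commutes with the
  operators.\<close>

lemma idempotent_compression:
  assumes X: "is_umod X" and e: "hm X X e" "\<And>x. e (e x) = e x"
  obtains Y k h where "is_umod Y" "hm Y X k" "hm X Y h" "\<And>x. k (h x) = e x" "\<And>x. h (k x) = restr (rdim Y) x"
proof -
  define n where "n = rdim X"
  have w: "well_formed X" and le: "lin n n e" using e unfolding hm_def n_def by auto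
  obtain r k h where k: "lin r n k" and h: "lin n r h" and kh: "\<And>x. k (h x) = e x" and hk: "\<And>x. h (k x) = restr r x"
    using idempotent_factorization[OF le e(2)] by blast
  note ops = lin_ops[OF w, folded n_def]
  let ?t = "\<lambda>f. mat_of r r (\<lambda>x. h (f (k x)))"
  define Y where "Y = (?t (opA X), ?t (opB X), ?t (opC X))"
  have act_t: "act (?t f) x = h (f (k x))" if "lin n n f" for f x
    by (subst act_mat_of) (auto intro!: lin_comp[OF h] lin_comp[OF that] k)
  have rY: "rdim Y = r" by (simp add: Y_def rdim_def carrier_matD[OF mat_of_carrier])
  then have wY: "well_formed Y" by (simp add: Y_def well_formed_def)
  have opY: "opA Y x = h (opA X (k x))" "opB Y x = h (opB X (k x))" "opC Y x = h (opC X (k x))" for x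
    using act_t ops by (auto simp: Y_def)
  have ee: "e (opA X x) = opA X (e x)" "e (opB X x) = opB X (e x)" "e (opC X x) = opC X (e x)" for x
    using e(1) unfolding hm_def by auto
  have ek: "e (k x) = k x" for x using kh[of "k x"] hk lin_restr[OF k] by simp
  have he: "h (e x) = h x" for x using hk[of "h x"] kh restr_lin[OF h] by simp
  have "hm Y X k" using k w wY rY unfolding hm_def opY by (simp add: kh ee ek n_def)
  moreover have "hm X Y h" using h w wY rY unfolding hm_def opY
    by (simp add: kh n_def) (simp flip: ee add: he)
  ultimately show thesis using that[of Y k h] umod_retract[OF X] kh hk rY by auto
qed

text \<open>\<open>X\<close> is isomorphic to the direct sum of the images of \<open>e\<close> and
  \<open>1 - e\<close>, so one of these has dimension 0.\<close>

theorem indecomposable_idempotent: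
  assumes X: "indecomposable X" and e: "hm X X e" "\<And>x. e (e x) = e x"
  shows "(\<forall>x. e x = 0) \<or> (\<forall>x. e x = restr (rdim X) x)"
proof -
  define n where "n = rdim X"
  have uX: "is_umod X" and w: "well_formed X" and le: "lin n n e"
    using X e is_umod_iff unfolding indecomposable_def hm_def n_def by auto
  define e' where "e' x = restr n x - e x" for x
  have rd: "restr n (x - y) = restr n x - restr n y" for x y :: "nat \<Rightarrow> 'a"
    by (auto simp: restr_def fun_eq_iff)
  have "hm X X e'" using e(1) hm_id[OF w] lin_ops[OF w] unfolding hm_def e'_def n_def
    by (auto simp: lin_minus lin_simps[OF lin_ops(1)[OF w]] lin_simps[OF lin_ops(2)[OF w]] lin_simps[OF lin_ops(3)[OF w]])
  moreover have "e' (e' x) = e' x" for x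
    unfolding e'_def using e(2) lin_simps[OF le] by (simp add: rd)
  ultimately obtain Z k2 h2 where Z: "is_umod Z" "hm Z X k2" "hm X Z h2" "\<And>x. k2 (h2 x) = e' x" "\<And>x. h2 (k2 x) = restr (rdim Z) x"
    using idempotent_compression[OF uX] by metis
  obtain Y k h where Y: "is_umod Y" "hm Y X k" "hm X Y h" "\<And>x. k (h x) = e x" "\<And>x. h (k x) = restr (rdim Y) x"
    using idempotent_compression[OF uX e] by metis
  have l: "lin (rdim Y) n k" "lin n (rdim Y) h" "lin (rdim Z) n k2" "lin n (rdim Z) h2"
    using Y Z unfolding hm_def n_def by auto
  note ls = lin_simps[OF l(1)] lin_simps[OF l(2)] lin_simps[OF l(3)] lin_simps[OF l(4)]
  have wYZ: "well_formed Y" "well_formed Z" using Y Z is_umod_iff by blast+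
  note ds = dsum_ops[OF wYZ]
  let ?m = "rdim Y"
  \<comment> \<open>The two images are orthogonal since \<open>e (1 - e) = 0\<close>; this makes the
    map \<open>g\<close> defined below a right inverse of \<open>f\<close>.\<close>
  have hk2: "h (k2 x) = 0" for x
  proof -
    have "h (e' y) = 0" for y using Y(4,5)[of "h y"] Y(4)[of y] by (simp add: e'_def ls)
    then have "h (k2 (h2 (k2 x))) = 0" using Z(4) by simp
    then show ?thesis using Z(5) ls by simp
  qed
  have h2k: "h2 (k x) = 0" for x
  proof -
    have "e' (e y) = 0" for y by (simp add: e'_def e(2) lin_simps[OF le])
    then have "k2 (h2 (k x)) = 0" using Z(4) Y(4,5) ls(3) by (metis)
    then have "h2 (k2 (h2 (k x))) = 0" by (simp add: ls)
    then show ?thesis using Z(5) ls by simp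
  qed
  define f where "f x = glue ?m (h x) (h2 x)" for x
  define g where "g x = k x + k2 (\<lambda>i. x (?m + i))" for x
  have sum: "k (h x) + k2 (h2 x) = restr n x" for x using Y(4) Z(4) by (simp add: e'_def)
  have gl1: "restr ?m (glue ?m x y) = restr ?m x" for x y :: "nat \<Rightarrow> 'a" by (auto simp: glue_def restr_def fun_eq_iff)
  have gl2: "(\<lambda>i. glue ?m x y (?m + i)) = y" for x y :: "nat \<Rightarrow> 'a" by (auto simp: glue_def fun_eq_iff)
  have opg: "lin ?m ?m p \<Longrightarrow> p (glue ?m x y) = p x" for p and x y :: "nat \<Rightarrow> 'a" using gl1 lin_restr by metis
  have hh: "h (opA X x) = opA Y (h x)" "h (opB X x) = opB Y (h x)" "h (opC X x) = opC Y (h x)"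
    "h2 (opA X x) = opA Z (h2 x)" "h2 (opB X x) = opB Z (h2 x)" "h2 (opC X x) = opC Z (h2 x)"
    "k (opA Y x) = opA X (k x)" "k (opB Y x) = opB X (k x)" "k (opC Y x) = opC X (k x)"
    "k2 (opA Z x) = opA X (k2 x)" "k2 (opB Z x) = opB X (k2 x)" "k2 (opC Z x) = opC X (k2 x)" for x
    using Y Z unfolding hm_def by auto
  have kg: "k (glue ?m x y) = k x" for x y using opg gl1 ls(3) by metis
  have lf: "lin n (?m + rdim Z) f"
  proof (rule linI)
    show "restr (?m + rdim Z) (f x) = f x" for x
    proof -
      have z: "h2 x j = 0" if "j \<ge> rdim Z" for j
        using fun_cong[OF restr_lin[OF l(4), of x], of j] that by (simp add: restr_def)
      show ?thesis unfolding f_def by (auto simp: glue_def restr_def fun_eq_iff intro!: z)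
    qed
  qed (simp_all add: f_def ls glue_def fun_eq_iff)
  have lg: "lin (?m + rdim Z) n g"
  proof (rule linI)
    fix x y and s :: 'a
    show "g (x + y) = g x + g y"
      using ls(1)[of x y] lin_add[OF l(3), of "\<lambda>i. x (?m + i)" "\<lambda>i. y (?m + i)"]
      by (simp add: g_def plus_fun_def algebra_simps)
    show "g (\<lambda>i. s * x i) = (\<lambda>i. s * g x i)"
      using lin_scale[OF l(1), of s x] lin_scale[OF l(3), of s "\<lambda>i. x (?m + i)"]
      by (simp add: g_def fun_eq_iff algebra_simps)
    have "restr ?m (restr (?m + rdim Z) x) = restr ?m x" "(\<lambda>i. restr (?m + rdim Z) x (?m + i)) = restr (rdim Z) (\<lambda>i. x (?m + i))"
      by (auto simp: restr_def fun_eq_iff)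
    then show "g (restr (?m + rdim Z) x) = g x"
      unfolding g_def using lin_restr[OF l(1)] lin_restr[OF l(3)] by metis
    show "restr n (g x) = g x" using restr_lin[OF l(1)] restr_lin[OF l(3)] by (simp add: g_def)
  qed
  have hf: "hm X (dsum Y Z) f"
    using w ds lf lin_ops[OF wYZ(1)] unfolding hm_def n_def f_def by (simp add: hh opg gl2)
  have hg: "hm (dsum Y Z) X g"
    using w ds lg lin_ops[OF w] unfolding hm_def n_def g_def
    by (simp add: hh kg gl2 lin_add[OF lin_ops(1)[OF w]] lin_add[OF lin_ops(2)[OF w]] lin_add[OF lin_ops(3)[OF w]])
  have gf: "g (f x) = restr n x" for x unfolding g_def f_def kg gl2 by (rule sum)
  have fg: "f (g y) = restr (?m + rdim Z) y" for y
    unfolding f_def g_def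
    by (simp add: ls Y(5) Z(5) hk2 h2k) (auto simp: glue_def restr_def fun_eq_iff)
  have "mod_iso X (dsum Y Z)" unfolding mod_iso_iff using hf hg gf fg ds(2) n_def by auto
  moreover have "\<not> (rdim Y > 0 \<and> rdim Z > 0 \<and> mod_iso X (dsum Y Z))"
    using X Y(1) Z(1) unfolding indecomposable_def by metis
  ultimately have "rdim Y = 0 \<or> rdim Z = 0" by auto
  then show ?thesis
  proof
    assume "rdim Y = 0"
    then have "h x = 0" for x using restr_lin[OF l(2), of x] by simp
    then show ?thesis using Y(4) ls(5) by (metis lin_zero[OF l(1)])
  next
    assume "rdim Z = 0"
    then have "h2 x = 0" for x using restr_lin[OF l(4), of x] by simp
    then have "e' x = 0" for x using Z(4) lin_zero[OF l(3)] by metis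
    then show ?thesis by (simp add: e'_def n_def)
  qed
qed

text \<open>\<open>f g\<close> is an idempotent endomorphism of \<open>X\<close>, nonzero because
  \<open>L\<close> is nonzero, hence the identity. The isomorphisms with the listed modules all
  arise in this way.\<close>

theorem indecomposable_retract:
  assumes X: "indecomposable X" and f: "hm L X f" and g: "hm X L g"
    and gf: "\<And>x. g (f x) = restr (rdim L) x" and L: "rdim L > 0"
  shows "mod_iso X L"
proof -
  have l: "lin (rdim L) (rdim X) f" "lin (rdim X) (rdim L) g" using f g unfolding hm_def by auto
  have "hm X X (\<lambda>x. f (g x))" using hm_comp[OF g f] .
  moreover have "f (g (f (g x))) = f (g x)" for x using gf lin_restr[OF l(1)] by simp
  ultimately have "(\<forall>x. f (g x) = 0) \<or> (\<forall>x. f (g x) = restr (rdim X) x)"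
    using indecomposable_idempotent[OF X, of "\<lambda>x. f (g x)"] by blast
  then show ?thesis
  proof
    assume *: "\<forall>x. f (g x) = 0"
    have "restr (rdim L) x = 0" for x :: "nat \<Rightarrow> 'a"
    proof -
      have "g (f (g (f x))) = 0" using * lin_zero[OF l(2)] by simp
      then show ?thesis using gf by simp
    qed
    from this[of "\<lambda>_. 1"] L show ?thesis by (auto simp: restr_def fun_eq_iff dest: spec[of _ 0])
  next
    assume "\<forall>x. f (g x) = restr (rdim X) x"
    then show ?thesis unfolding mod_iso_iff using f g gf by blast
  qed
qed

text \<open>A decomposition would provide the projection onto its first summand, an idempotent
  different from 0 and 1 since both summands are nonzero.\<close>

theorem indecomposableI:
  assumes X: "is_umod X" "rdim X > 0"
    and idem: "\<And>e. hm X X e \<Longrightarrow> (\<And>x. e (e x) = e x) \<Longrightarrow> (\<forall>x. e x = 0) \<or> (\<forall>x. e x = restr (rdim X) x)"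
  shows "indecomposable X"
  unfolding indecomposable_def
proof (intro conjI notI X)
  assume "\<exists>Y Z. is_umod Y \<and> is_umod Z \<and> rdim Y > 0 \<and> rdim Z > 0 \<and> mod_iso X (dsum Y Z)"
  then obtain Y Z where YZ: "is_umod Y" "is_umod Z" "rdim Y > 0" "rdim Z > 0" "mod_iso X (dsum Y Z)" by blast
  obtain f g where fg: "hm X (dsum Y Z) f" "hm (dsum Y Z) X g" "\<And>x. g (f x) = restr (rdim X) x"
     "\<And>y. f (g y) = restr (rdim (dsum Y Z)) y"
    using YZ(5) unfolding mod_iso_iff by blast
  have w: "well_formed Y" "well_formed Z" using YZ is_umod_iff by blast+
  note ds = dsum_ops[OF w]
  let ?m = "rdim Y" let ?p = "restr (rdim Y) :: (nat \<Rightarrow> 'a) \<Rightarrow> _"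
  have pl: "lin (rdim (dsum Y Z)) (rdim (dsum Y Z)) ?p"
    by (rule linI) (auto simp: ds restr_def fun_eq_iff)
  have g0: "restr ?m (glue ?m x y) = glue ?m x 0" if "restr ?m x = x" for x y :: "nat \<Rightarrow> 'a"
    using that by (auto simp: glue_def restr_def fun_eq_iff)
  have sh: "(\<lambda>i. restr ?m x (?m + i)) = 0" for x :: "nat \<Rightarrow> 'a" by (auto simp: restr_def fun_eq_iff)
  have hp: "hm (dsum Y Z) (dsum Y Z) ?p"
    unfolding hm_def using ds pl
    by (simp add: sh g0 restr_lin[OF lin_ops(1)[OF w(1)]] restr_lin[OF lin_ops(2)[OF w(1)]] restr_lin[OF lin_ops(3)[OF w(1)]]
      lin_restr[OF lin_ops(1)[OF w(1)]] lin_restr[OF lin_ops(2)[OF w(1)]] lin_restr[OF lin_ops(3)[OF w(1)]]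
      lin_zero[OF lin_ops(1)[OF w(2)]] lin_zero[OF lin_ops(2)[OF w(2)]] lin_zero[OF lin_ops(3)[OF w(2)]])
  let ?e = "\<lambda>x. g (?p (f x))"
  have l: "lin (rdim X) (rdim (dsum Y Z)) f" "lin (rdim (dsum Y Z)) (rdim X) g" using fg unfolding hm_def by auto
  have rr: "restr ?m (restr (?m + rdim Z) x) = restr ?m x" "restr (?m + rdim Z) (restr ?m x) = restr ?m x" for x :: "nat \<Rightarrow> 'a"
    by (auto simp: restr_def fun_eq_iff)
  have fe: "f (?e (g y)) = ?p y" for y by (simp add: fg ds rr)
  have "hm X X ?e" using hm_comp[OF hm_comp[OF fg(1) hp] fg(2)] by simp
  moreover have "?e (?e x) = ?e x" for x by (simp add: fg ds rr)
  ultimately have "(\<forall>x. ?e x = 0) \<or> (\<forall>x. ?e x = restr (rdim X) x)" by (rule idem)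
  then show False
  proof
    assume "\<forall>x. ?e x = 0"
    then have "?p (\<lambda>_. 1) = 0" using fe lin_zero[OF l(1)] by metis
    then show False using YZ(3) by (auto simp: restr_def fun_eq_iff dest: spec[of _ 0])
  next
    assume *: "\<forall>x. ?e x = restr (rdim X) x"
    have "?p y = restr (rdim (dsum Y Z)) y" for y
      using fe[of y] * restr_lin[OF l(2)] lin_restr[OF l(1)] fg(4) by metis
    from fun_cong[OF this[of "\<lambda>_. 1"], of ?m] YZ(4) show False by (auto simp: restr_def ds)
  qed
qed

section \<open>Modules as quadruples of linear maps\<close>

locale char_two =
  fixes T :: "'k::field itself"
  assumes char_two: "CHAR('k) = 2"
begin

lemma one_plus_one: "1 + 1 = (0::'k)"
  using of_nat_CHAR[where ?'a = 'k] char_two by simp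

lemma double: "x + x = (0::'k)"
  using one_plus_one by (metis distrib_left mult_1_right mult_zero_right)

lemma double_fun [simp]: "x + x = (0 :: nat \<Rightarrow> 'k)" "x + (x + y) = (y :: nat \<Rightarrow> 'k)"
proof -
  show *: "x + x = 0" for x :: "nat \<Rightarrow> 'k"
    by (rule ext) (simp only: plus_fun_apply zero_fun_apply double)
  show "x + (x + y) = y" by (simp only: * add_0_left flip: add.assoc)
qed

lemma eq_if_sum_zero: "x + y = 0 \<Longrightarrow> x = (y :: nat \<Rightarrow> 'k)"
  by (metis add.assoc add.right_neutral double_fun(1) add.left_neutral)

end

text \<open>The spaces \<open>U = X\<^sub>0\<close> and \<open>Y = X\<^sub>1\<close> of the header have dimensions \<open>u\<close> and \<open>y\<close>; the copies
  \<open>X\<^sub>2 = a Y\<close> and \<open>X\<^sub>3 = a\<^sup>2 Y\<close> are embedded by \<open>k2\<close> and \<open>k3\<close>, and \<open>h\<close> are the coordinate projections.\<close>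

locale frame = char_two "TYPE('k::field)" +
  fixes X :: "'k::field rep" and u y :: nat and p q s t k0 k1 k2 k3 h0 h1 h2 h3 :: "(nat \<Rightarrow> 'k) \<Rightarrow> nat \<Rightarrow> 'k"
  assumes wf: "well_formed X"
    and lin_data: "lin u y p" "lin u y q" "lin y u s" "lin y u t"
    and lin_k: "lin u (rdim X) k0" "lin y (rdim X) k1" "lin y (rdim X) k2" "lin y (rdim X) k3"
    and lin_h: "lin (rdim X) u h0" "lin (rdim X) y h1" "lin (rdim X) y h2" "lin (rdim X) y h3"
    and hk: "h0 (k0 x) = restr u x" "h1 (k1 x) = restr y x" "h2 (k2 x) = restr y x" "h3 (k3 x) = restr y x"
    and hk0: "h0 (k1 x) = 0" "h0 (k2 x) = 0" "h0 (k3 x) = 0" "h1 (k0 x) = 0" "h1 (k2 x) = 0" "h1 (k3 x) = 0"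
      "h2 (k0 x) = 0" "h2 (k1 x) = 0" "h2 (k3 x) = 0" "h3 (k0 x) = 0" "h3 (k1 x) = 0" "h3 (k2 x) = 0"
    and complete: "k0 (h0 x) + k1 (h1 x) + k2 (h2 x) + k3 (h3 x) = restr (rdim X) x"
    and ak: "opA X (k0 x) = k1 (p x)" "opA X (k1 x) = k2 x" "opA X (k2 x) = k3 x" "opA X (k3 x) = k0 (t x)"
    and bk: "opB X (k0 x) = k3 (q x)" "opB X (k1 x) = k0 (s x)" "opB X (k2 x) = k1 (x + p (s x))" "opB X (k3 x) = k2 (x + p (s x))"
    and ck: "opC X (k0 x) = 0" "opC X (k1 x) = k1 x" "opC X (k2 x) = 0" "opC X (k3 x) = k3 x"
    and rel: "p (s x) = q (t x)" "s (p x) = t (q x)" "t (p x) = 0" "p (t x) = 0" "s (q x) = 0" "q (s x) = 0"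
begin

lemma lin_op: "lin (rdim X) (rdim X) (opA X)" "lin (rdim X) (rdim X) (opB X)" "lin (rdim X) (rdim X) (opC X)"
  using lin_ops[OF wf] by auto

lemmas ladd = lin_simps(1,5)[OF lin_data(1)] lin_simps(1,5)[OF lin_data(2)] lin_simps(1,5)[OF lin_data(3)]
  lin_simps(1,5)[OF lin_data(4)] lin_simps(1,5)[OF lin_k(1)] lin_simps(1,5)[OF lin_k(2)]
  lin_simps(1,5)[OF lin_k(3)] lin_simps(1,5)[OF lin_k(4)] lin_simps(1,5)[OF lin_h(1)] lin_simps(1,5)[OF lin_h(2)]
  lin_simps(1,5)[OF lin_h(3)] lin_simps(1,5)[OF lin_h(4)] lin_simps(1,5)[OF lin_op(1)] lin_simps(1,5)[OF lin_op(2)]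
  lin_simps(1,5)[OF lin_op(3)]

lemmas lrestr = lin_simps(3,4)[OF lin_data(1)] lin_simps(3,4)[OF lin_data(2)] lin_simps(3,4)[OF lin_data(3)]
  lin_simps(3,4)[OF lin_data(4)] lin_simps(3,4)[OF lin_k(1)] lin_simps(3,4)[OF lin_k(2)]
  lin_simps(3,4)[OF lin_k(3)] lin_simps(3,4)[OF lin_k(4)] lin_simps(3,4)[OF lin_h(1)] lin_simps(3,4)[OF lin_h(2)]
  lin_simps(3,4)[OF lin_h(3)] lin_simps(3,4)[OF lin_h(4)] lin_simps(3,4)[OF lin_op(1)] lin_simps(3,4)[OF lin_op(2)]
  lin_simps(3,4)[OF lin_op(3)]

lemmas cols = ak bk ck

lemma tqt [simp]: "t (q (t x)) = 0" "q (t (q x)) = 0"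
  using rel ladd by (simp_all flip: rel)

lemma op_expand:
  "opA X x = opA X (k0 (h0 x) + k1 (h1 x) + k2 (h2 x) + k3 (h3 x))"
  "opB X x = opB X (k0 (h0 x) + k1 (h1 x) + k2 (h2 x) + k3 (h3 x))"
  "opC X x = opC X (k0 (h0 x) + k1 (h1 x) + k2 (h2 x) + k3 (h3 x))"
  unfolding complete by (simp_all add: lrestr)

text \<open>The operators in terms of coordinate projections. Together with \<open>cols\<close> for
  the target this turns the conditions on a homomorphism into identities between \<open>p\<close>,
  \<open>q\<close>, \<open>s\<close>, \<open>t\<close>.\<close>

lemma rows:
  "h0 (opA X x) = t (h3 x)" "h1 (opA X x) = p (h0 x)" "h2 (opA X x) = h1 x" "h3 (opA X x) = h2 x"
  "h0 (opB X x) = s (h1 x)" "h1 (opB X x) = h2 x + p (s (h2 x))" "h2 (opB X x) = h3 x + p (s (h3 x))" "h3 (opB X x) = q (h0 x)"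
  "h0 (opC X x) = 0" "h1 (opC X x) = h1 x" "h2 (opC X x) = 0" "h3 (opC X x) = h3 x"
  unfolding op_expand[of x] by (simp_all add: ladd cols hk hk0 lrestr)

text \<open>The relations of the algebra correspond to those in \<open>rel\<close>:
  \<open>ab + ba = c\<close> gives \<open>s p = t q\<close> on X0 and \<open>p s = q t\<close> on
  X3, \<open>a^4 = 0\<close> gives \<open>t p = p t = 0\<close>, and \<open>b^4 = 0\<close> gives
  \<open>s q = q s = 0\<close>. On X1 the map \<open>ab\<close> is \<open>p s\<close>, and the term
  \<open>p s\<close> in \<open>bk\<close> compensates for it.\<close>

lemma umod: "is_umod X"
proof -
  have "umod_rel (opA X) (opB X) (opC X)"
    unfolding umod_rel_def
  proof (rule allI)
    fix x
    let ?z = "k0 (h0 x) + k1 (h1 x) + k2 (h2 x) + k3 (h3 x)"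
    have "opA X (opB X ?z) + opB X (opA X ?z) = opC X ?z" "opA X (opC X ?z) + opC X (opA X ?z) = opA X ?z"
      "opB X (opC X ?z) + opC X (opB X ?z) = opB X ?z" "opA X (opA X (opA X (opA X ?z))) = 0"
      "opB X (opB X (opB X (opB X ?z))) = 0" "opC X (opC X ?z) + opC X ?z = 0"
      by (simp_all add: ladd cols rel add_ac)
    then show "opA X (opB X x) + opB X (opA X x) = opC X x \<and> opA X (opC X x) + opC X (opA X x) = opA X x \<and>
       opB X (opC X x) + opC X (opB X x) = opB X x \<and> opA X (opA X (opA X (opA X x))) = 0 \<and>
       opB X (opB X (opB X (opB X x))) = 0 \<and> opC X (opC X x) + opC X x = 0"
      unfolding op_expand[of x, symmetric] by blast
  qed
  then show ?thesis using wf is_umod_iff by blast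
qed

end

section \<open>Homomorphisms in terms of quadruples\<close>

definition data_hom where
  "data_hom u y p q s t u' y' p' q' s' t' fU fY \<longleftrightarrow> lin u u' fU \<and> lin y y' fY \<and>
     (\<forall>x. fY (p x) = p' (fU x)) \<and> (\<forall>x. fY (q x) = q' (fU x)) \<and>
     (\<forall>x. fU (s x) = s' (fY x)) \<and> (\<forall>x. fU (t x) = t' (fY x))"

locale two_frames = F: frame X u y p q s t k0 k1 k2 k3 h0 h1 h2 h3 +
  G: frame X' u' y' p' q' s' t' k0' k1' k2' k3' h0' h1' h2' h3'
  for X :: "'k::field rep" and u y p q s t k0 k1 k2 k3 h0 h1 h2 h3
  and X' :: "'k rep" and u' y' p' q' s' t' k0' k1' k2' k3' h0' h1' h2' h3'
begin

abbreviation "dhom \<equiv> data_hom u y p q s t u' y' p' q' s' t'"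

definition "lift fU fY = (\<lambda>x. k0' (fU (h0 x)) + k1' (fY (h1 x)) + k2' (fY (h2 x)) + k3' (fY (h3 x)))"

lemma lift_hm:
  assumes "dhom fU fY"
  shows "hm X X' (lift fU fY)"
proof -
  have l: "lin u u' fU" "lin y y' fY" and c: "\<And>x. fY (p x) = p' (fU x)" "\<And>x. fY (q x) = q' (fU x)"
    "\<And>x. fU (s x) = s' (fY x)" "\<And>x. fU (t x) = t' (fY x)"
    using assms unfolding data_hom_def by auto
  have "lin (rdim X) (rdim X') (lift fU fY)"
    unfolding lift_def
    by (intro lin_plus lin_comp[OF G.lin_k(1)] lin_comp[OF G.lin_k(2)] lin_comp[OF G.lin_k(3)]
      lin_comp[OF G.lin_k(4)] lin_comp[OF l(1)] lin_comp[OF l(2)] F.lin_h)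
  then show ?thesis using F.wf G.wf unfolding hm_def lift_def
    by (simp add: F.rows G.cols G.ladd lin_simps(1,5)[OF l(1)] lin_simps(1,5)[OF l(2)] c add_ac)
qed

lemma lift_k:
  assumes "dhom fU fY"
  shows "lift fU fY (k0 x) = k0' (fU x)" "lift fU fY (k1 x) = k1' (fY x)"
proof -
  have l: "lin u u' fU" "lin y y' fY" using assms unfolding data_hom_def by auto
  show "lift fU fY (k0 x) = k0' (fU x)" "lift fU fY (k1 x) = k1' (fY x)"
    unfolding lift_def by (simp_all add: F.hk F.hk0 G.ladd lin_simps[OF l(1)] lin_simps[OF l(2)])
qed

text \<open>A homomorphism respects the grading: \<open>c\<close> separates X0 and X2 from X1 and
  X3, and \<open>abab\<close> separates within these pairs, since it kills X0 and X1 and is the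
  identity on X2 and X3.\<close>

lemma hm_k:
  assumes f: "hm X X' f"
  shows "f (k0 x) = k0' (h0' (f (k0 x)))" "f (k1 x) = k1' (h1' (f (k1 x)))"
proof -
  have l: "lin (rdim X) (rdim X') f" and c: "\<And>x. f (opA X x) = opA X' (f x)" "\<And>x. f (opB X x) = opB X' (f x)"
     "\<And>x. f (opC X x) = opC X' (f x)" using f unfolding hm_def by auto
  note fl = lin_simps[OF l]
  let ?z = "f (k0 x)"
  have "h1' (opC X' ?z) = 0" "h3' (opC X' ?z) = 0" by (simp_all flip: c add: F.ck fl G.ladd)
  then have 1: "h1' ?z = 0" "h3' ?z = 0" by (simp_all add: G.rows)
  have "h2' (opA X' (opB X' (opA X' (opB X' ?z)))) = 0"
    by (simp flip: c add: F.cols F.rel F.ladd fl G.ladd)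
  then have 2: "h2' ?z = 0" by (simp add: G.rows G.ladd G.rel 1 add_ac)
  show "f (k0 x) = k0' (h0' (f (k0 x)))"
    using G.complete[of ?z] by (simp add: 1 2 G.ladd fl)
  let ?z = "f (k1 x)"
  have "h0' (opC X' ?z) = h0' ?z" "h2' (opC X' ?z) = h2' ?z" by (simp_all flip: c add: F.ck fl G.ladd)
  then have 1: "h0' ?z = 0" "h2' ?z = 0" by (simp_all add: G.rows)
  have "h3' (opA X' (opB X' (opA X' (opB X' ?z)))) = 0"
    by (simp flip: c add: F.cols F.rel F.ladd fl G.ladd)
  then have 2: "h3' ?z = 0" by (simp add: G.rows G.ladd G.rel 1 add_ac)
  show "f (k1 x) = k1' (h1' (f (k1 x)))"
    using G.complete[of ?z] by (simp add: 1 2 G.ladd fl)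
qed

text \<open>For \<open>q\<close> and \<open>t\<close> the piece X3 enters: by \<open>f3\<close> the
  map on it is the one on X1, because X3 is the image of X1 under \<open>a^2\<close>.\<close>

lemma hm_data_hom:
  assumes f: "hm X X' f"
  shows "dhom (\<lambda>x. h0' (f (k0 x))) (\<lambda>x. h1' (f (k1 x)))"
proof -
  have l: "lin (rdim X) (rdim X') f" and c: "\<And>x. f (opA X x) = opA X' (f x)" "\<And>x. f (opB X x) = opB X' (f x)"
     "\<And>x. f (opC X x) = opC X' (f x)" using f unfolding hm_def by auto
  note fk = hm_k[OF f]
  have l1: "lin u u' (\<lambda>x. h0' (f (k0 x)))" "lin y y' (\<lambda>x. h1' (f (k1 x)))"
    using lin_comp[OF G.lin_h(1) lin_comp[OF l F.lin_k(1)]] lin_comp[OF G.lin_h(2) lin_comp[OF l F.lin_k(2)]] by auto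
  have f3: "f (k3 x) = k3' (h1' (f (k1 x)))" for x
    by (metis F.ak(2,3) G.ak(2,3) c(1) fk(2))
  have "h1' (f (k1 (p x))) = p' (h0' (f (k0 x)))" for x
    by (metis F.ak(1) G.rows(2) c(1))
  moreover have "h0' (f (k0 (s x))) = s' (h1' (f (k1 x)))" for x
    by (metis F.bk(2) G.rows(5) c(2))
  moreover have "h0' (f (k0 (t x))) = t' (h1' (f (k1 x)))" for x
    by (metis F.ak(4) G.hk(4) G.lrestr(7) G.rows(1) c(1) f3)
  moreover have "h1' (f (k1 (q x))) = q' (h0' (f (k0 x)))" for x
  proof -
    have "h3' (f (k3 (q x))) = q' (h0' (f (k0 x)))" by (metis F.bk(1) G.rows(8) c(2))
    then show ?thesis unfolding f3 by (simp add: G.hk G.lrestr)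
  qed
  ultimately show ?thesis using l1 unfolding data_hom_def by blast
qed

text \<open>X2 and X3 are the images of X1 under \<open>a\<close> and \<open>a^2\<close>, so the
  values on X0 and X1 determine everything.\<close>

lemma hm_eqI:
  assumes f: "hm X X' f" and g: "hm X X' g"
    and "\<And>x. f (k0 x) = g (k0 x)" "\<And>x. f (k1 x) = g (k1 x)"
  shows "f x = g x"
proof -
  have l: "lin (rdim X) (rdim X') f" and c: "\<And>x. f (opA X x) = opA X' (f x)" using f unfolding hm_def by auto
  have l': "lin (rdim X) (rdim X') g" and c': "\<And>x. g (opA X x) = opA X' (g x)" using g unfolding hm_def by auto
  have 2: "f (k2 x) = g (k2 x)" for x using assms(4) c c' by (metis F.ak(2))
  have 3: "f (k3 x) = g (k3 x)" for x using 2 c c' by (metis F.ak(3))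
  have "f (restr (rdim X) x) = g (restr (rdim X) x)"
    unfolding F.complete[symmetric] by (simp only: lin_simps(1)[OF l] lin_simps(1)[OF l'] assms 2 3)
  then show ?thesis by (simp add: lin_simps(3)[OF l] lin_simps(3)[OF l'])
qed

end

section \<open>The frame of an arbitrary module\<close>

theorem umod_has_frame:
  fixes X :: "'k::field rep"
  assumes "CHAR('k) = 2" and X: "is_umod X"
  obtains u y p q s t k0 k1 k2 k3 h0 h1 h2 h3 where "frame X u y p q s t k0 k1 k2 k3 h0 h1 h2 h3"
proof -
  interpret char_two "TYPE('k)" by unfold_locales fact
  define n where "n = rdim X"
  define a b c where "a = opA X" and "b = opB X" and "c = opC X"
  have wf: "well_formed X" and ur: "umod_rel a b c" using X is_umod_iff unfolding a_def b_def c_def by blast+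
  have l: "lin n n a" "lin n n b" "lin n n c" using lin_ops[OF wf] unfolding a_def b_def c_def n_def .
  note la = lin_simps(1,3,4,5)[OF l(1)] and lb = lin_simps(1,3,4,5)[OF l(2)] and lc = lin_simps(1,3,4,5)[OF l(3)]
  have r0: "a (b x) + b (a x) = c x" "a (c x) + c (a x) = a x" "b (c x) + c (b x) = b x" "c (c x) + c x = 0"
    "a (a (a (a x))) = 0" "b (b (b (b x))) = 0" for x
    using ur unfolding umod_rel_def by blast+
  \<comment> \<open>In characteristic 2 any summand can change sides; this orients the relations as
    rewriting rules that move \<open>a\<close> to the front and \<open>c\<close> to the end.\<close>
  have mv: "z = x + w" if "x + z = w" for x z w :: "nat \<Rightarrow> 'k" using that double_fun by metis
  have r: "b (a x) = a (b x) + c x" "c (a x) = a (c x) + a x" "c (b x) = b (c x) + b x" "c (c x) = c x"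
    "a (a (a (a x))) = 0" "b (b (b (b x))) = 0" for x
    by (rule mv[OF r0(1)] mv[OF r0(2)] mv[OF r0(3)] eq_if_sum_zero[OF r0(4)] r0(5) r0(6))+
  note nf = la lb lc r restr_simps add.assoc add.commute add.left_commute
  \<comment> \<open>On the pieces with eigenvalue 0 the map \<open>ab\<close> is \<open>tq\<close>
    or \<open>ps\<close>, on those with eigenvalue 1 it is \<open>1 + ps\<close>; the squares of
    these are 0 and 1. So \<open>w\<close> is the projection onto X2 + X3, and
    \<open>e0 = (1 + c)(1 + w)\<close>, \<open>e1 = c (1 + w)\<close>.\<close>
  define w where "w x = a (b (a (b x)))" for x
  define e0 where "e0 x = restr n x + c x + w x + c (w x)" for x
  define e1 where "e1 x = c x + c (w x)" for x
  have lw: "lin n n w" unfolding w_def by (intro lin_comp[OF l(1)] lin_comp[OF l(2)] l)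
  have le: "lin n n e0" "lin n n e1" unfolding e0_def e1_def
    by (intro lin_plus lin_id lw lin_comp[OF l(3)] l)+
  have idem: "e0 (e0 x) = e0 x" "e1 (e1 x) = e1 x" for x
    unfolding e0_def e1_def w_def by (simp_all add: nf)
  obtain u k0 h0 where k0: "lin u n k0" "lin n u h0" "\<And>x. k0 (h0 x) = e0 x" "\<And>x. h0 (k0 x) = restr u x"
    by (rule idempotent_factorization[OF le(1) idem(1)]) (rule that)
  obtain y k1 h1 where k1: "lin y n k1" "lin n y h1" "\<And>x. k1 (h1 x) = e1 x" "\<And>x. h1 (k1 x) = restr y x"
    by (rule idempotent_factorization[OF le(2) idem(2)]) (rule that)
  have ek: "e0 (k0 x) = k0 x" "e1 (k1 x) = k1 x" "h0 (e0 x) = h0 x" "h1 (e1 x) = h1 x" for x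
    using k0(3)[of "k0 x"] k0(4) k1(3)[of "k1 x"] k1(4) k0(3)[of x] k1(3)[of x] lin_simps(3,4)[OF k0(1)] lin_simps(3,4)[OF k1(1)]
      k0(4)[of "h0 x"] k1(4)[of "h1 x"] lin_simps(3,4)[OF k0(2)] lin_simps(3,4)[OF k1(2)] by simp_all
  note k0l = lin_simps(1,5)[OF k0(1)] lin_simps(1,5)[OF k0(2)] lin_simps(1,5)[OF k1(1)] lin_simps(1,5)[OF k1(2)]
  define k2 where "k2 x = a (k1 x)" for x
  define k3 where "k3 x = a (a (k1 x))" for x
  \<comment> \<open>\<open>b\<close> maps X2 to X1 by \<open>1 + ps\<close>, and the factor
    \<open>1 + ab\<close>, which is \<open>1 + ps\<close> on X1, undoes this. From X3 the factor
    occurs twice in \<open>b b\<close> and cancels, so \<open>h3\<close> contains no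
    correction.\<close>
  define h2 where "h2 x = h1 (b x + a (b (b x)))" for x
  define h3 where "h3 x = h1 (b (b x))" for x
  define p where "p x = h1 (a (k0 x))" for x
  \<comment> \<open>\<open>b\<close> leads from X0 to X3; two more applications of \<open>b\<close>
    identify X3 with X1.\<close>
  define q where "q x = h1 (b (b (b (k0 x))))" for x
  define s where "s x = h0 (b (k1 x))" for x
  define t where "t x = h0 (a (a (a (k1 x))))" for x
  \<comment> \<open>\<open>e0\<close> and \<open>e1\<close> are the projections onto \<open>X\<^sub>0\<close> and \<open>X\<^sub>1\<close>; every identity below becomes, after inserting
    \<open>e0\<close> and \<open>e1\<close>, an identity between words in \<open>a, b, c\<close>, decided by rewriting to the PBW basis \<open>a\<^sup>i b\<^sup>j c\<^sup>k\<close>.\<close>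
  have word0: "P (k0 x) = Q (k0 x)" if "\<And>z. P (e0 z) = Q (e0 z)" for P Q :: "_ \<Rightarrow> nat \<Rightarrow> 'k" and x
    using that[of "k0 x"] by (simp add: ek)
  have word1: "P (k1 x) = Q (k1 x)" if "\<And>z. P (e1 z) = Q (e1 z)" for P Q :: "_ \<Rightarrow> nat \<Rightarrow> 'k" and x
    using that[of "k1 x"] by (simp add: ek)
  have kp: "k1 (p x) = a (k0 x)" for x
    unfolding p_def k1(3) by (rule word0[of "\<lambda>z. e1 (a z)" a]) (simp add: e0_def e1_def w_def nf)
  have kq: "k1 (q x) = b (b (b (k0 x)))" for x
    unfolding q_def k1(3) by (rule word0[of "\<lambda>z. e1 (b (b (b z)))" "\<lambda>z. b (b (b z))"]) (simp add: e0_def e1_def w_def nf)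
  have ks: "k0 (s x) = b (k1 x)" for x
    unfolding s_def k0(3) by (rule word1[of "\<lambda>z. e0 (b z)" b]) (simp add: e0_def e1_def w_def nf)
  have kt: "k0 (t x) = a (a (a (k1 x)))" for x
    unfolding t_def k0(3) by (rule word1[of "\<lambda>z. e0 (a (a (a z)))" "\<lambda>z. a (a (a z))"]) (simp add: e0_def e1_def w_def nf)
  have kps: "k1 (p (s x)) = a (b (k1 x))" for x by (simp add: kp ks)
  have inj0: "z = z'" if "k0 z = k0 z'" "restr u z = z" "restr u z' = z'" for z z' using that k0(4) by metis
  have inj1: "z = z'" if "k1 z = k1 z'" "restr y z = z" "restr y z' = z'" for z z' using that k1(4) by metis
  have ld: "lin u y p" "lin u y q" "lin y u s" "lin y u t"
    unfolding p_def q_def s_def t_def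
    by (intro lin_comp[OF k1(2)] lin_comp[OF k0(2)] lin_comp[OF l(1)] lin_comp[OF l(2)] k0(1) k1(1))+
  note rd = lin_simps(4)[OF ld(1)] lin_simps(4)[OF ld(2)] lin_simps(4)[OF ld(3)] lin_simps(4)[OF ld(4)]
  have h1z: "h1 z = 0" if "e1 z = 0" for z using ek(4)[of z] that by (simp add: k0l)
  have h0z: "h0 z = 0" if "e0 z = 0" for z using ek(3)[of z] that by (simp add: k0l)
  have h1e: "h1 z = restr y x" if "e1 z = k1 x" for z x using ek(4)[of z] that k1(4) by simp
  have "frame X u y p q s t k0 k1 k2 k3 h0 h1 h2 h3"
  proof (unfold_locales, fold n_def a_def b_def c_def)
    show "well_formed X" by (rule wf)
    show "lin u y p" "lin u y q" "lin y u s" "lin y u t" by fact+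
    show "lin u n k0" "lin y n k1" "lin n u h0" "lin n y h1" by fact+
    show "lin y n k2" "lin y n k3" unfolding k2_def k3_def by (intro lin_comp[OF l(1)] k1(1))+
    show "lin n y h2" "lin n y h3" unfolding h2_def h3_def
      by (intro lin_comp[OF k1(2)] lin_plus lin_comp[OF l(1)] lin_comp[OF l(2)] l)+
    fix x
    show "h0 (k0 x) = restr u x" "h1 (k1 x) = restr y x" by fact+
    show "h2 (k2 x) = restr y x" unfolding h2_def k2_def
      by (rule h1e, rule word1[of "\<lambda>z. e1 (b (a z) + a (b (b (a z))))" "\<lambda>z. z"]) (simp add: e0_def e1_def w_def nf)
    show "h3 (k3 x) = restr y x" unfolding h3_def k3_def
      by (rule h1e, rule word1[of "\<lambda>z. e1 (b (b (a (a z))))" "\<lambda>z. z"]) (simp add: e0_def e1_def w_def nf)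
    show "h0 (k1 x) = 0"
      by (rule h0z, rule word1[of e0 "\<lambda>_. 0"]) (simp add: e0_def e1_def w_def nf)
    show "h0 (k2 x) = 0" unfolding k2_def
      by (rule h0z, rule word1[of "\<lambda>z. e0 (a z)" "\<lambda>_. 0"]) (simp add: e0_def e1_def w_def nf)
    show "h0 (k3 x) = 0" unfolding k3_def
      by (rule h0z, rule word1[of "\<lambda>z. e0 (a (a z))" "\<lambda>_. 0"]) (simp add: e0_def e1_def w_def nf)
    show "h1 (k0 x) = 0"
      by (rule h1z, rule word0[of e1 "\<lambda>_. 0"]) (simp add: e0_def e1_def w_def nf)
    show "h1 (k2 x) = 0" unfolding k2_def
      by (rule h1z, rule word1[of "\<lambda>z. e1 (a z)" "\<lambda>_. 0"]) (simp add: e0_def e1_def w_def nf)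
    show "h1 (k3 x) = 0" unfolding k3_def
      by (rule h1z, rule word1[of "\<lambda>z. e1 (a (a z))" "\<lambda>_. 0"]) (simp add: e0_def e1_def w_def nf)
    show "h2 (k0 x) = 0" unfolding h2_def
      by (rule h1z, rule word0[of "\<lambda>z. e1 (b z + a (b (b z)))" "\<lambda>_. 0"]) (simp add: e0_def e1_def w_def nf)
    show "h2 (k1 x) = 0" unfolding h2_def
      by (rule h1z, rule word1[of "\<lambda>z. e1 (b z + a (b (b z)))" "\<lambda>_. 0"]) (simp add: e0_def e1_def w_def nf)
    show "h2 (k3 x) = 0" unfolding h2_def k3_def
      by (rule h1z, rule word1[of "\<lambda>z. e1 (b (a (a z)) + a (b (b (a (a z)))))" "\<lambda>_. 0"]) (simp add: e0_def e1_def w_def nf)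
    show "h3 (k0 x) = 0" unfolding h3_def
      by (rule h1z, rule word0[of "\<lambda>z. e1 (b (b z))" "\<lambda>_. 0"]) (simp add: e0_def e1_def w_def nf)
    show "h3 (k1 x) = 0" unfolding h3_def
      by (rule h1z, rule word1[of "\<lambda>z. e1 (b (b z))" "\<lambda>_. 0"]) (simp add: e0_def e1_def w_def nf)
    show "h3 (k2 x) = 0" unfolding h3_def k2_def
      by (rule h1z, rule word1[of "\<lambda>z. e1 (b (b (a z)))" "\<lambda>_. 0"]) (simp add: e0_def e1_def w_def nf)
    show "k0 (h0 x) + k1 (h1 x) + k2 (h2 x) + k3 (h3 x) = restr n x"
      unfolding k2_def k3_def h2_def h3_def k0(3) k1(3) by (simp add: e0_def e1_def w_def nf)
    show "a (k0 x) = k1 (p x)" "a (k1 x) = k2 x" "a (k2 x) = k3 x" "a (k3 x) = k0 (t x)"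
      by (simp_all add: kp kt k2_def k3_def)
    show "b (k1 x) = k0 (s x)" by (simp add: ks)
    show "b (k0 x) = k3 (q x)" unfolding k3_def kq
      by (rule word0[of b "\<lambda>z. a (a (b (b (b z))))"]) (simp add: e0_def e1_def w_def nf)
    show "b (k2 x) = k1 (x + p (s x))" unfolding k2_def k0l kps
      by (rule word1[of "\<lambda>z. b (a z)" "\<lambda>z. z + a (b z)"]) (simp add: e0_def e1_def w_def nf)
    show "b (k3 x) = k2 (x + p (s x))" unfolding k2_def k3_def k0l kps
      by (rule word1[of "\<lambda>z. b (a (a z))" "\<lambda>z. a (z + a (b z))"]) (simp add: e0_def e1_def w_def nf)
    show "c (k0 x) = 0" by (rule word0[of c "\<lambda>_. 0"]) (simp add: e0_def e1_def w_def nf)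
    show "c (k1 x) = k1 x" by (rule word1[of c "\<lambda>z. z"]) (simp add: e0_def e1_def w_def nf)
    show "c (k2 x) = 0" unfolding k2_def by (rule word1[of "\<lambda>z. c (a z)" "\<lambda>_. 0"]) (simp add: e0_def e1_def w_def nf)
    show "c (k3 x) = k3 x" unfolding k3_def by (rule word1[of "\<lambda>z. c (a (a z))" "\<lambda>z. a (a z)"]) (simp add: e0_def e1_def w_def nf)
    show "p (s x) = q (t x)"
    proof (rule inj1)
      show "k1 (p (s x)) = k1 (q (t x))" unfolding kp ks kq kt
        by (rule word1[of "\<lambda>z. a (b z)" "\<lambda>z. b (b (b (a (a (a z)))))"]) (simp add: e0_def e1_def w_def nf)
    qed (simp_all add: rd)
    show "s (p x) = t (q x)"
    proof (rule inj0)
      show "k0 (s (p x)) = k0 (t (q x))" unfolding kp ks kq kt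
        by (rule word0[of "\<lambda>z. b (a z)" "\<lambda>z. a (a (a (b (b (b z)))))"]) (simp add: e0_def e1_def w_def nf)
    qed (simp_all add: rd)
    have z0: "z = 0" if "k0 z = 0" "restr u z = z" for z using inj0[of z 0] that by (simp add: k0l)
    have z1: "z = 0" if "k1 z = 0" "restr y z = z" for z using inj1[of z 0] that by (simp add: k0l)
    show "t (p x) = 0" by (rule z0) (simp_all add: rd kp kt r)
    show "p (t x) = 0" by (rule z1) (simp_all add: rd kp kt r)
    show "s (q x) = 0" by (rule z0) (simp_all add: rd ks kq r)
    show "q (s x) = 0" by (rule z1) (simp_all add: rd ks kq r)
  qed
  then show thesis by (rule that)
qed

section \<open>Kronecker modules\<close>

text \<open>Fredholm's alternative for the rows of \<open>M\<close> with \<open>b\<close> adjoined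
  as the row \<open>None\<close> and right-hand side 1 there. A certificate of unsolvability has
  nonzero weight at \<open>None\<close>, and dividing by that weight expresses \<open>b\<close>
  through the rows.\<close>

lemma row_span_or_separating:
  fixes M :: "'i \<Rightarrow> 'j \<Rightarrow> 'k::field"
  assumes "finite A" "finite J"
  shows "(\<exists>c. (\<forall>i\<in>A. (\<Sum>j\<in>J. M i j * c j) = 0) \<and> (\<Sum>j\<in>J. b j * c j) = 1) \<or>
    (\<exists>w. \<forall>j\<in>J. b j = (\<Sum>i\<in>A. w i * M i j))"
proof -
  let ?I = "insert None (Some ` A)"
  let ?M = "\<lambda>i j. case i of None \<Rightarrow> b j | Some i \<Rightarrow> M i j"
  let ?b = "\<lambda>i. case i of None \<Rightarrow> 1 | Some i \<Rightarrow> 0"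
  have s: "(\<Sum>i\<in>?I. h i) = h None + (\<Sum>i\<in>A. h (Some i))" for h :: "'i option \<Rightarrow> 'k"
    using assms by (simp add: sum.reindex)
  have "finite ?I" using assms by simp
  from fredholm_alternative[OF assms(2) this, of ?M ?b] show ?thesis
  proof
    assume "\<exists>c. \<forall>i\<in>?I. (\<Sum>j\<in>J. ?M i j * c j) = ?b i"
    then show ?thesis by (intro disjI1) auto
  next
    assume "\<exists>w. (\<forall>j\<in>J. (\<Sum>i\<in>?I. w i * ?M i j) = 0) \<and> (\<Sum>i\<in>?I. w i * ?b i) \<noteq> 0"
    then obtain w where w: "\<And>j. j \<in> J \<Longrightarrow> w None * b j + (\<Sum>i\<in>A. w (Some i) * M i j) = 0" "w None \<noteq> 0"
      unfolding s by auto
    have "b j = (\<Sum>i\<in>A. - w (Some i) / w None * M i j)" if "j \<in> J" for j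
    proof -
      have "b j = - (\<Sum>i\<in>A. w (Some i) * M i j) / w None"
        using w(1)[OF that] w(2) by (simp add: field_simps eq_neg_iff_add_eq_0)
      also have "\<dots> = (\<Sum>i\<in>A. - w (Some i) / w None * M i j)"
        by (simp add: sum_negf sum_divide_distrib)
      finally show ?thesis .
    qed
    then show ?thesis by (intro disjI2 exI[of _ "\<lambda>i. - w (Some i) / w None"]) blast
  qed
qed

abbreviation unit :: "nat \<Rightarrow> nat \<Rightarrow> 'k::field" where "unit j \<equiv> \<lambda>l. of_bool (l = j)"

lemma lin_expand:
  assumes "lin m n f" shows "f x i = (\<Sum>j<m. f (unit j) i * x j)"
proof -
  have "f x = act (mat_of m n f) x" using act_mat_of[OF assms] by metis
  then have "f x i = (if i < n then \<Sum>j<m. f (unit j) i * x j else 0)"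
    unfolding act_def mat_of_def by auto
  moreover have "f v i = 0" if "i \<ge> n" for v
    using fun_cong[OF restr_lin[OF assms, of v], of i] that by (simp add: restr_def)
  ultimately show ?thesis by auto
qed

lemma pairing_expand:
  assumes "lin m n f" shows "pairing n \<phi> (f x) = (\<Sum>j<m. pairing n \<phi> (f (unit j)) * x j)"
  unfolding pairing_def lin_expand[OF assms, of x] sum_distrib_left sum_distrib_right
  by (subst sum.swap) (simp add: mult.assoc)

lemma left_inverse_is_right_inverse:
  assumes f: "lin n n f" and g: "lin n n g" and gf: "\<And>x. g (f x) = restr n (x :: nat \<Rightarrow> 'k::field)"
  shows "f (g x) = restr n x"
proof -
  let ?F = "mat_of n n f" let ?G = "mat_of n n g"
  note a = act_mat_of[OF f] act_mat_of[OF g]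
  have "?G * ?F = 1\<^sub>m n"
    by (rule act_eqD[of _ n n]) (auto simp: act_mult a gf carrier_matD[OF mat_of_carrier] mult_carrier_mat[OF mat_of_carrier mat_of_carrier])
  then have "?F * ?G = 1\<^sub>m n" by (rule mat_mult_left_right_inverse[rotated 2]) auto
  then have "act (?F * ?G) x = restr n x" by simp
  then show ?thesis by (simp add: act_mult a carrier_matD[OF mat_of_carrier])
qed

text \<open>For a generalized inverse \<open>g\<close>, the values of \<open>g f - 1\<close> lie in
  the kernel of \<open>f\<close>.\<close>

lemma injective_inverse:
  assumes f: "lin n n f" and inj: "\<And>x. restr n x = x \<Longrightarrow> f x = 0 \<Longrightarrow> x = (0 :: nat \<Rightarrow> 'k::field)"
  obtains g where "lin n n g" "\<And>x. g (f x) = restr n x" "\<And>x. f (g x) = restr n x"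
proof -
  obtain g where g: "lin n n g" "\<And>x. f (g (f x)) = f x" using generalized_inverse[OF f] by metis
  have rd: "restr n (x - y) = restr n x - restr n y" for x y :: "nat \<Rightarrow> 'k"
    by (auto simp: restr_def fun_eq_iff)
  have gf: "g (f x) = restr n x" for x
  proof -
    have "g (f x) - restr n x = 0"
      by (rule inj) (simp_all add: rd lin_simps[OF g(1)] lin_simps[OF f] g(2))
    then show ?thesis by simp
  qed
  show thesis using that[OF g(1) gf left_inverse_is_right_inverse[OF f g(1) gf]] .
qed

section \<open>Representations of the Kronecker quiver and their retracts\<close>

definition pencil_hom ::
  "nat \<Rightarrow> nat \<Rightarrow> ((nat \<Rightarrow> 'k::field) \<Rightarrow> nat \<Rightarrow> 'k) \<Rightarrow> ((nat \<Rightarrow> 'k) \<Rightarrow> nat \<Rightarrow> 'k) \<Rightarrow>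
   nat \<Rightarrow> nat \<Rightarrow> ((nat \<Rightarrow> 'k) \<Rightarrow> nat \<Rightarrow> 'k) \<Rightarrow> ((nat \<Rightarrow> 'k) \<Rightarrow> nat \<Rightarrow> 'k) \<Rightarrow>
   ((nat \<Rightarrow> 'k) \<Rightarrow> nat \<Rightarrow> 'k) \<Rightarrow> ((nat \<Rightarrow> 'k) \<Rightarrow> nat \<Rightarrow> 'k) \<Rightarrow> bool" where
  "pencil_hom u y p q u' y' p' q' fU fY \<longleftrightarrow> lin u u' fU \<and> lin y y' fY \<and>
     (\<forall>x. fY (p x) = p' (fU x)) \<and> (\<forall>x. fY (q x) = q' (fU x))"

definition pencil_retract where
  "pencil_retract u y p q u' y' p' q' \<longleftrightarrow> (\<exists>fU fY gU gY. pencil_hom u' y' p' q' u y p q fU fY \<and>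
     pencil_hom u y p q u' y' p' q' gU gY \<and> (\<forall>x. gU (fU x) = restr u' x) \<and> (\<forall>x. gY (fY x) = restr y' x))"

lemma pencil_retract_trans:
  assumes "pencil_retract u y p q u' y' p' q'" "pencil_retract u' y' p' q' u'' y'' p'' q''"
  shows "pencil_retract u y p q u'' y'' p'' q''"
proof -
  obtain fU fY gU gY where 1: "pencil_hom u' y' p' q' u y p q fU fY" "pencil_hom u y p q u' y' p' q' gU gY"
    "\<And>x. gU (fU x) = restr u' x" "\<And>x. gY (fY x) = restr y' x"
    using assms(1) unfolding pencil_retract_def by blast
  obtain fU' fY' gU' gY' where 2: "pencil_hom u'' y'' p'' q'' u' y' p' q' fU' fY'" "pencil_hom u' y' p' q' u'' y'' p'' q'' gU' gY'"
    "\<And>x. gU' (fU' x) = restr u'' x" "\<And>x. gY' (fY' x) = restr y'' x"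
    using assms(2) unfolding pencil_retract_def by blast
  have l: "lin u' u'' gU'" "lin y' y'' gY'" using 2 unfolding pencil_hom_def by auto
  have "pencil_hom u'' y'' p'' q'' u y p q (\<lambda>x. fU (fU' x)) (\<lambda>x. fY (fY' x))"
    "pencil_hom u y p q u'' y'' p'' q'' (\<lambda>x. gU' (gU x)) (\<lambda>x. gY' (gY x))"
    using 1(1,2) 2(1,2) unfolding pencil_hom_def by (auto intro: lin_comp)
  moreover have "gU' (gU (fU (fU' x))) = restr u'' x" "gY' (gY (fY (fY' x))) = restr y'' x" for x
    using 1(3,4) 2(3,4) lin_restr[OF l(1)] lin_restr[OF l(2)] by simp_all
  ultimately show ?thesis unfolding pencil_retract_def by blast
qed

lemma pencil_retract_swap: "pencil_retract u y p q u' y' p' q' \<Longrightarrow> pencil_retract u y q p u' y' q' p'"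
  unfolding pencil_retract_def pencil_hom_def by blast

section \<open>Duality\<close>

definition transp where "transp m n f = act (transpose_mat (mat_of m n f))"

lemma transp:
  assumes "lin m n f"
  shows lin_transp: "lin n m (transp m n f)"
    and transp_comp: "lin n l g \<Longrightarrow> transp m l (\<lambda>x. g (f x)) x = transp m n f (transp n l g x)"
    and transp_apply: "transp m n f x j = (if j < m then \<Sum>i<n. f (unit j) i * x i else 0)"
proof -
  show "lin n m (transp m n f)" unfolding transp_def by (rule lin_act) (simp add: mat_of_def)
  show "transp m n f x j = (if j < m then \<Sum>i<n. f (unit j) i * x i else 0)"
    by (simp add: transp_def act_def mat_of_def)
  assume g: "lin n l g"
  have "mat_of m l (\<lambda>x. g (f x)) = mat_of n l g * mat_of m n f"
    using lin_comp[OF g assms] by (intro act_eqD[of _ l m])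
      (simp_all add: act_mult act_mat_of assms g carrier_matD[OF mat_of_carrier] mult_carrier_mat[OF mat_of_carrier mat_of_carrier])
  then show "transp m l (\<lambda>x. g (f x)) x = transp m n f (transp n l g x)"
    unfolding transp_def
    by (simp add: transpose_mult[OF mat_of_carrier mat_of_carrier] act_mult carrier_matD[OF mat_of_carrier])
qed

lemma transp_restr: "transp m m (restr m) = restr m"
  by (auto simp: transp_def mat_of_def act_def fun_eq_iff restr_def if_distrib[of "\<lambda>x. x * _"] cong: if_cong)

lemma pencil_hom_transp:
  assumes "pencil_hom u y p q u' y' p' q' fU fY" "lin u y p" "lin u y q" "lin u' y' p'" "lin u' y' q'"
  shows "pencil_hom y' u' (transp u' y' p') (transp u' y' q') y u (transp u y p) (transp u y q) (transp y y' fY) (transp u u' fU)"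
proof -
  have l: "lin u u' fU" "lin y y' fY" and c: "(\<lambda>x. fY (p x)) = (\<lambda>x. p' (fU x))" "(\<lambda>x. fY (q x)) = (\<lambda>x. q' (fU x))"
    using assms(1) unfolding pencil_hom_def by auto
  have "transp u u' fU (transp u' y' p' x) = transp u y p (transp y y' fY x)"
    "transp u u' fU (transp u' y' q' x) = transp u y q (transp y y' fY x)" for x
    using transp_comp[OF assms(2) l(2), of x] transp_comp[OF l(1) assms(4), of x] transp_comp[OF assms(3) l(2), of x]
      transp_comp[OF l(1) assms(5), of x] c by auto
  then show ?thesis unfolding pencil_hom_def using lin_transp[OF l(1)] lin_transp[OF l(2)] by auto
qed

lemma transp_transp:
  assumes "lin m n f" shows "transp n m (transp m n f) = f"
proof -
  have "mat_of n m (transp m n f) = transpose_mat (mat_of m n f)"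
    unfolding transp_def by (rule mat_of_act) simp
  then have "transp n m (transp m n f) = act (transpose_mat (transpose_mat (mat_of m n f)))"
    unfolding transp_def[of n m] by simp
  then show ?thesis using act_mat_of[OF assms] by simp
qed

text \<open>Transposition reverses homomorphisms, so inclusion and retraction exchange their roles.
  It also exchanges dim U and dim Y, which reduces \<open>u < y\<close> to
  \<open>y < u\<close>.\<close>

lemma pencil_retract_transp:
  assumes r: "pencil_retract u y p q u' y' p' q'" and l: "lin u y p" "lin u y q" "lin u' y' p'" "lin u' y' q'"
  shows "pencil_retract y u (transp u y p) (transp u y q) y' u' (transp u' y' p') (transp u' y' q')"
proof -
  obtain fU fY gU gY where 1: "pencil_hom u' y' p' q' u y p q fU fY" "pencil_hom u y p q u' y' p' q' gU gY"
    "(\<lambda>x. gU (fU x)) = restr u'" "(\<lambda>x. gY (fY x)) = restr y'"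
    using r unfolding pencil_retract_def by blast
  have lf: "lin u' u fU" "lin y' y fY" "lin u u' gU" "lin y y' gY" using 1 unfolding pencil_hom_def by auto
  have "transp u' u fU (transp u u' gU x) = restr u' x" "transp y' y fY (transp y y' gY x) = restr y' x" for x
    using transp_comp[OF lf(1) lf(3), of x] transp_comp[OF lf(2) lf(4), of x] 1(3,4) by (simp_all add: transp_restr)
  then show ?thesis unfolding pencil_retract_def
    using pencil_hom_transp[OF 1(1) l(3,4,1,2)] pencil_hom_transp[OF 1(2) l] by blast
qed

section \<open>Standard pencils\<close>

definition shiftl :: "nat \<Rightarrow> (nat \<Rightarrow> 'k::field) \<Rightarrow> nat \<Rightarrow> 'k" where
  "shiftl n x = (\<lambda>i. if i < n then x (Suc i) else 0)"

definition shiftr :: "nat \<Rightarrow> (nat \<Rightarrow> 'k::field) \<Rightarrow> nat \<Rightarrow> 'k" where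
  "shiftr n x = (\<lambda>i. if 0 < i \<and> i < n then x (i - 1) else 0)"

definition jord :: "nat \<Rightarrow> 'k::field \<Rightarrow> (nat \<Rightarrow> 'k) \<Rightarrow> nat \<Rightarrow> 'k" where
  "jord n lam x = (\<lambda>i. if i < n then lam * x i + (if Suc i < n then x (Suc i) else 0) else 0)"

lemma lin_std: "lin (Suc n) n (restr n)" "lin n (Suc n) (restr n)" "lin (Suc n) n (shiftl n)" "lin n (Suc n) (shiftr (Suc n))"
  "lin n n (shiftr n)" "lin n n (jord n lam)"
  by (rule linI; auto simp: restr_def shiftl_def shiftr_def jord_def fun_eq_iff algebra_simps)+

text \<open>Kronecker's normal forms of a pencil T p - q: the one with kernel vector
  \<open>(1, T, ..., T^r)\<close>, its dual, a Jordan block at \<open>lam\<close>, and a Jordan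
  block at infinity. The last is written with \<open>shiftr\<close> because \<open>V_mod 2\<close>
  and \<open>W_mod 2\<close> number their bases in this way.\<close>

inductive std_pencil :: "nat \<Rightarrow> nat \<Rightarrow> ((nat \<Rightarrow> 'k::field) \<Rightarrow> nat \<Rightarrow> 'k) \<Rightarrow> ((nat \<Rightarrow> 'k) \<Rightarrow> nat \<Rightarrow> 'k) \<Rightarrow> bool" where
  "std_pencil (Suc r) r (restr r) (shiftl r)"
| "std_pencil r (Suc r) (shiftr (Suc r)) (restr r)"
| "n \<ge> 1 \<Longrightarrow> std_pencil n n (restr n) (jord n lam)"
| "n \<ge> 1 \<Longrightarrow> std_pencil n n (shiftr n) (restr n)"

text \<open>The transpose of the first standard pencil is the second with its two maps exchanged;
  \<open>kronecker\<close> therefore transposes \<open>q\<close> and \<open>p\<close> in this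
  order.\<close>

lemma transp_std:
  "transp (Suc r) r (restr r) = (restr r :: (nat \<Rightarrow> 'a::field) \<Rightarrow> _)"
  "transp (Suc r) r (shiftl r) = (shiftr (Suc r) :: (nat \<Rightarrow> 'a) \<Rightarrow> _)"
proof -
  have "transp (Suc r) r (restr r) x i = restr r x i" for x :: "nat \<Rightarrow> 'a" and i
    by (simp add: transp_apply[OF lin_std(1)] restr_def if_distrib[of "\<lambda>x. x * _"] cong: if_cong)
  moreover have "transp (Suc r) r (shiftl r) x i = shiftr (Suc r) x i" for x :: "nat \<Rightarrow> 'a" and i
    by (cases i) (simp_all add: transp_apply[OF lin_std(3)] shiftl_def shiftr_def)
  ultimately show "transp (Suc r) r (restr r) = (restr r :: (nat \<Rightarrow> 'a) \<Rightarrow> _)"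
    "transp (Suc r) r (shiftl r) = (shiftr (Suc r) :: (nat \<Rightarrow> 'a) \<Rightarrow> _)"
    by (auto simp: fun_eq_iff)
qed

section \<open>Splitting off a polynomial kernel vector\<close>

text \<open>The coefficients of a nonzero kernel vector \<open>v 0 + v 1 T + ... + v k T^k\<close>
  of the pencil T p - q over k[T].\<close>

definition chain where
  "chain u p q k v \<longleftrightarrow> (\<forall>i. restr u (v i) = v i) \<and> q (v 0) = 0 \<and> (\<forall>i<k. p (v i) = q (v (Suc i))) \<and>
     p (v k) = (0 :: nat \<Rightarrow> 'k::field) \<and> (\<exists>i\<le>k. v i \<noteq> 0)"

lemma lin_combination:
  assumes v: "\<And>j. restr n (v j) = (v j :: nat \<Rightarrow> 'k::field)"
  shows "lin r n (\<lambda>x i. \<Sum>j<r. x j * v j i)"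
proof (rule linI)
  show "restr n (\<lambda>i. \<Sum>j<r. x j * v j i) = (\<lambda>i. \<Sum>j<r. x j * v j i)" for x
  proof (rule ext)
    fix i show "restr n (\<lambda>i. \<Sum>j<r. x j * v j i) i = (\<Sum>j<r. x j * v j i)"
      using fun_cong[OF v, of _ i] by (auto simp: restr_def)
  qed
qed (simp_all add: fun_eq_iff sum.distrib sum_distrib_left algebra_simps restr_def[of r])

text \<open>The inclusion sends the basis to the \<open>v j\<close> and the \<open>p (v j)\<close>.
  The retraction is given by functionals on Y with \<open>\<beta> i q = \<beta> (i+1) p\<close> and
  \<open>\<beta> 0 (p (v 0)) = 1\<close>: they read off the coordinates of Y, and the
  \<open>\<beta> i p\<close>, completed by \<open>\<beta> (r-1) q\<close>, those of U.\<close>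

lemma chain_retract:
  fixes p q :: "(nat \<Rightarrow> 'k::field) \<Rightarrow> nat \<Rightarrow> 'k"
  assumes l: "lin u y p" "lin u y q" and ex: "\<exists>k v. chain u p q k v"
  shows "\<exists>r. pencil_retract u y p q (Suc r) r (restr r) (shiftl r)"
proof -
  define r where "r = (LEAST k. \<exists>v. chain u p q k v)"
  have "\<exists>v. chain u p q r v" unfolding r_def using ex by (rule LeastI_ex)
  then obtain v where v: "chain u p q r v" by blast
  have least: "\<not> chain u p q k v" if "k < r" for k v using that not_less_Least unfolding r_def by blast
  have vr: "restr u (v i) = v i" and q0: "q (v 0) = 0" and pq: "\<And>i. i < r \<Longrightarrow> p (v i) = q (v (Suc i))" and pr: "p (v r) = 0" for i
    using v unfolding chain_def by auto
  \<comment> \<open>Otherwise division of the kernel vector by T would lower its degree.\<close>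
  have v0: "v 0 \<noteq> 0"
  proof
    assume 0: "v 0 = 0"
    obtain i where i: "i \<le> r" "v i \<noteq> 0" using v unfolding chain_def by auto
    then have "0 < r" using 0 by (cases i) auto
    then obtain r' where r': "r = Suc r'" by (cases r) auto
    have "chain u p q r' (\<lambda>i. v (Suc i))" unfolding chain_def
    proof (intro conjI allI impI)
      show "restr u (v (Suc i)) = v (Suc i)" for i by (rule vr)
      show "q (v (Suc 0)) = 0" using pq[of 0] r' 0 lin_zero[OF l(1)] by simp
      show "p (v (Suc i)) = q (v (Suc (Suc i)))" if "i < r'" for i using pq that r' by simp
      show "p (v (Suc r')) = 0" using pr r' by simp
      show "\<exists>i\<le>r'. v (Suc i) \<noteq> 0" using i 0 r' by (cases i) auto
    qed
    then show False using least r' by blast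
  qed
  have "\<exists>\<beta>. (\<forall>i x. Suc i < r \<longrightarrow> pairing y (\<beta> i) (q x) = pairing y (\<beta> (Suc i)) (p x)) \<and> (r > 0 \<longrightarrow> pairing y (\<beta> 0) (p (v 0)) = 1)"
  proof (cases r)
    case (Suc r')
    \<comment> \<open>The unknowns are the values of \<open>\<beta> i'\<close> at the unit vectors
      \<open>e_l\<close>. Row \<open>(i, m)\<close> is the equation
      \<open>\<beta> i (q e_m) = \<beta> (i+1) (p e_m)\<close>, and \<open>b\<close> stands for the
      normalization at \<open>v 0\<close>.\<close>
    define M where "M = (\<lambda>(i, m) (i', l). of_bool (i' = i) * q (unit m) l - of_bool (i' = Suc i) * p (unit m) l)"
    define b where "b = (\<lambda>(i'::nat, l). of_bool (i' = 0) * p (v 0) l)"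
    let ?A = "{..<r'} \<times> {..<u}" let ?J = "{..<r} \<times> {..<y}"
    have "finite ?A" "finite ?J" by simp_all
    from row_span_or_separating[OF this, of M b] show ?thesis
    proof
      assume "\<exists>c. (\<forall>i\<in>?A. (\<Sum>j\<in>?J. M i j * c j) = 0) \<and> (\<Sum>j\<in>?J. b j * c j) = 1"
      then obtain c where c: "\<And>i m. i < r' \<Longrightarrow> m < u \<Longrightarrow> (\<Sum>j\<in>?J. M (i, m) j * c j) = 0" "(\<Sum>j\<in>?J. b j * c j) = 1"
        by auto
      define \<beta> where "\<beta> i l = c (i, l)" for i l
      have "(\<Sum>j\<in>?J. b j * c j) = (\<Sum>i'<r. of_bool (i' = 0) * pairing y (\<beta> i') (p (v 0)))"
        unfolding b_def pairing_def \<beta>_def sum.cartesian_product' by (simp add: sum_distrib_left mult_ac)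
      also have "\<dots> = pairing y (\<beta> 0) (p (v 0))" using Suc by (simp only: sum_of_bool_mult finite_lessThan) simp
      finally have 1: "pairing y (\<beta> 0) (p (v 0)) = 1" using c(2) by simp
      have "pairing y (\<beta> i) (q (unit m)) = pairing y (\<beta> (Suc i)) (p (unit m))" if "i < r'" "m < u" for i m
      proof -
        have "(\<Sum>j\<in>?J. M (i, m) j * c j) = (\<Sum>i'<r. of_bool (i' = i) * pairing y (\<beta> i') (q (unit m)) - of_bool (i' = Suc i) * pairing y (\<beta> i') (p (unit m)))"
          unfolding M_def pairing_def \<beta>_def sum.cartesian_product'
          by (simp add: sum_distrib_left sum_subtractf algebra_simps)
        also have "\<dots> = pairing y (\<beta> i) (q (unit m)) - pairing y (\<beta> (Suc i)) (p (unit m))"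
          unfolding sum_subtractf sum_of_bool_mult[OF finite_lessThan] using that Suc by simp
        finally show ?thesis using c(1)[OF that] by simp
      qed
      then have "pairing y (\<beta> i) (q x) = pairing y (\<beta> (Suc i)) (p x)" if "i < r'" for i x
        unfolding pairing_expand[OF l(1), of _ x] pairing_expand[OF l(2), of _ x] using that by simp
      then show ?thesis using 1 Suc by blast
    next
      assume "\<exists>w. \<forall>j\<in>?J. b j = (\<Sum>i\<in>?A. w i * M i j)"
      then obtain w where w: "\<And>i l. i < r \<Longrightarrow> l < y \<Longrightarrow> b (i, l) = (\<Sum>e\<in>?A. w e * M e (i, l))" by auto
      \<comment> \<open>The weights form vectors with \<open>p (v 0) = q (x 0)\<close>,
        \<open>p (x (i-1)) = q (x i)\<close> and \<open>p (x (r'-1)) = 0\<close>; for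
        \<open>r' = 0\<close> they just say \<open>p (v 0) = 0\<close>. Preceded by
        \<open>v 0\<close> they are a chain of length \<open>r' = r - 1\<close>, against
        minimality.\<close>
      define x where "x i = restr u (\<lambda>m. w (i, m))" for i
      have ex: "f (x i) l = (\<Sum>m<u. w (i, m) * f (unit m) l)" if "lin u y f" for f i l
        by (subst lin_expand[OF that]) (auto simp: x_def restr_def mult.commute intro!: sum.cong)
      have eq: "of_bool (i = 0) * p (v 0) l = (if i < r' then q (x i) l else 0) - (if 0 < i \<and> i - 1 < r' then p (x (i - 1)) l else 0)"
        if "i < r" "l < y" for i l
      proof -
        have "b (i, l) = (\<Sum>i'<r'. of_bool (i = i') * q (x i') l - of_bool (i = Suc i') * p (x i') l)"
          unfolding w[OF that] M_def sum.cartesian_product' ex[OF l(1)] ex[OF l(2)]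
          by (simp add: sum_distrib_left sum_subtractf algebra_simps)
        also have "\<dots> = (if i < r' then q (x i) l else 0) - (\<Sum>i'<r'. of_bool (i = Suc i') * p (x i') l)"
          by (simp add: sum_subtractf)
        also have "(\<Sum>i'<r'. of_bool (i = Suc i') * p (x i') l) = (if 0 < i \<and> i - 1 < r' then p (x (i - 1)) l else 0)"
          by (cases i) simp_all
        finally show ?thesis by (simp add: b_def)
      qed
      have ext: "f x' = g x''" if "lin u y f" "lin u y g" "\<And>l. l < y \<Longrightarrow> f x' l = g x'' l" for f g x' x''
      proof (rule ext)
        fix l show "f x' l = g x'' l"
          using that(3)[of l] fun_cong[OF restr_lin[OF that(1), of x'], of l] fun_cong[OF restr_lin[OF that(2), of x''], of l]
          by (cases "l < y") (auto simp: restr_def)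
      qed
      have zq: "q 0 = 0" "p 0 = 0" using lin_zero l by auto
      define v' where "v' i = (case i of 0 \<Rightarrow> v 0 | Suc i \<Rightarrow> if i < r' then x i else 0)" for i
      have "chain u p q r' v'"
        unfolding chain_def
      proof (intro conjI allI impI)
        show "restr u (v' i) = v' i" for i by (cases i) (auto simp: v'_def vr x_def)
        show "q (v' 0) = 0" by (simp add: v'_def q0)
        show "\<exists>i\<le>r'. v' i \<noteq> 0" using v0 by (auto simp: v'_def intro: exI[of _ 0])
        show "p (v' i) = q (v' (Suc i))" if "i < r'" for i
        proof (cases i)
          case 0
          show ?thesis by (rule ext[OF l]) (use eq[of 0] that Suc 0 in \<open>auto simp: v'_def\<close>)
        next
          case (Suc j)
          show ?thesis by (rule ext[OF l]) (use eq[of i] that \<open>r = Suc r'\<close> Suc in \<open>auto simp: v'_def\<close>)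
        qed
        show "p (v' r') = 0"
        proof -
          have "p (v' r') = q 0"
            by (rule ext[OF l]) (use eq[of r'] Suc zq in \<open>cases r'; auto simp: v'_def\<close>)
          then show ?thesis by (simp add: zq)
        qed
      qed
      then show ?thesis using least Suc by blast
    qed
  qed auto
  then obtain \<beta> where \<beta>: "\<And>i x. Suc i < r \<Longrightarrow> pairing y (\<beta> i) (q x) = pairing y (\<beta> (Suc i)) (p x)"
    "r > 0 \<Longrightarrow> pairing y (\<beta> 0) (p (v 0)) = 1" by blast
  \<comment> \<open>For \<open>r = 0\<close> the standard pencil has Y = 0, and its single
    coordinate must be read off by a functional on U.\<close>
  obtain \<phi> where \<phi>: "pairing u \<phi> (v 0) = 1" using exists_functional[OF vr v0] by blast
  \<comment> \<open>\<open>\<beta> i (p (v j))\<close> depends only on \<open>j - i\<close>: for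
    \<open>j > i\<close> both indices are raised until \<open>p (v r) = 0\<close> is reached, for
    \<open>j < i\<close> they are lowered until \<open>q (v 0) = 0\<close> is reached.\<close>
  have \<beta>f: "pairing y (\<beta> i) (p (v j)) = of_bool (i = j)" if "i < r" "j < r" for i j
    using that
  proof (induction i arbitrary: j)
    case 0
    show ?case
    proof (cases j)
      case (Suc j')
      have "pairing y (\<beta> i) (p (v (i + j))) = 0" if "i + j < r" for i
        using that
      proof (induction "r - 1 - (i + j)" arbitrary: i)
        case 0
        then have ij: "Suc (i + j) = r" "Suc i < r" using Suc by auto
        have "pairing y (\<beta> i) (p (v (i + j))) = pairing y (\<beta> i) (q (v r))" using pq[of "i + j"] ij by simp
        also have "\<dots> = pairing y (\<beta> (Suc i)) (p (v r))" using \<beta>(1) ij by blast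
        finally show ?case by (simp add: pr pairing_simps)
      next
        case (Suc d)
        then have ij: "Suc i + j < r" "Suc i < r" by auto
        have "pairing y (\<beta> i) (p (v (i + j))) = pairing y (\<beta> i) (q (v (Suc i + j)))" using pq[of "i + j"] ij by simp
        also have "\<dots> = pairing y (\<beta> (Suc i)) (p (v (Suc i + j)))" using \<beta>(1) ij by blast
        also have "\<dots> = 0" by (rule Suc(1)) (use Suc(2) ij in auto)
        finally show ?case .
      qed
      from this[of 0] show ?thesis using 0 Suc by simp
    qed (use \<beta>(2) 0 in simp)
  next
    case (Suc i)
    have "pairing y (\<beta> (Suc i)) (p (v j)) = pairing y (\<beta> i) (q (v j))" using \<beta>(1) Suc by simp
    also have "\<dots> = of_bool (Suc i = j)"
    proof (cases j)
      case 0 then show ?thesis by (simp add: q0 pairing_simps)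
    next
      case (Suc j')
      then show ?thesis using Suc.IH[of j'] Suc.prems pq[of j'] by simp
    qed
    finally show ?case .
  qed
  define fU where "fU x = (\<lambda>i. \<Sum>j<Suc r. x j * v j i)" for x :: "nat \<Rightarrow> 'k"
  define fY where "fY x = (\<lambda>i. \<Sum>j<r. x j * p (v j) i)" for x :: "nat \<Rightarrow> 'k"
  define gU where "gU x = (\<lambda>i. if i < r then pairing y (\<beta> i) (p x) else if i = r then
     (if r = 0 then pairing u \<phi> x else pairing y (\<beta> (r - 1)) (q x)) else 0)" for x
  define gY where "gY x = (\<lambda>i. if i < r then pairing y (\<beta> i) x else 0)" for x
  have lfU: "lin (Suc r) u fU" and lfY: "lin r y fY"
    unfolding fU_def fY_def by (intro lin_combination vr restr_lin[OF l(1)])+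
  note ls = lin_simps[OF l(1)] lin_simps[OF l(2)]
  have lgU: "lin u (Suc r) gU"
    by (rule linI) (auto simp: gU_def ls pairing_simps fun_eq_iff restr_def[of "Suc r"])
  have lgY: "lin y r gY"
    by (rule linI) (auto simp: gY_def pairing_simps fun_eq_iff restr_def[of r])
  have h1: "pencil_hom (Suc r) r (restr r) (shiftl r) u y p q fU fY"
    unfolding pencil_hom_def
  proof (intro conjI allI lfU lfY)
    fix x :: "nat \<Rightarrow> 'k"
    show "fY (restr r x) = p (fU x)"
      unfolding fU_def lin_sum[OF l(1)] fY_def by (simp add: pr restr_def)
    show "fY (shiftl r x) = q (fU x)"
    proof -
      have e: "q (fU x) = (\<lambda>i. \<Sum>j<Suc r. x j * q (v j) i)" unfolding fU_def by (rule lin_sum[OF l(2)])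
      show ?thesis unfolding e fY_def sum.lessThan_Suc_shift by (simp add: q0 shiftl_def pq)
    qed
  qed
  have h2: "pencil_hom u y p q (Suc r) r (restr r) (shiftl r) gU gY"
    unfolding pencil_hom_def
  proof (intro conjI allI lgU lgY)
    fix x
    show "gY (p x) = restr r (gU x)" by (auto simp: gY_def gU_def restr_def)
    show "gY (q x) = shiftl r (gU x)"
    proof (rule ext)
      fix i
      show "gY (q x) i = shiftl r (gU x) i"
      proof (cases "Suc i < r")
        case True
        then show ?thesis using \<beta>(1)[of i x] by (simp add: gY_def gU_def shiftl_def)
      next
        case False
        then have "i < r \<Longrightarrow> r = Suc i" by simp
        then show ?thesis by (cases "i < r") (simp_all add: gY_def gU_def shiftl_def)
      qed
    qed
  qed
  have fUv: "fU x = (\<lambda>i. \<Sum>j<Suc r. x j * v j i)" for x by (rule fU_def)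
  have "gU (fU x) = restr (Suc r) x" for x
  proof (rule ext)
    fix i
    consider "i < r" | "i = r" "r = 0" | "i = r" "r > 0" | "i > r" by linarith
    then show "gU (fU x) i = restr (Suc r) x i"
    proof cases
      case 1
      then have "gU (fU x) i = (\<Sum>j<Suc r. x j * pairing y (\<beta> i) (p (v j)))"
        by (simp only: gU_def fUv lin_sum[OF l(1)] pairing_simps(5) if_True)
      then show ?thesis using 1 by (simp add: \<beta>f pr pairing_simps restr_def)
    next
      case 2
      then show ?thesis by (simp add: gU_def fUv restr_def pairing_simps(2) \<phi>)
    next
      case 3
      have "gU (fU x) i = (\<Sum>j<Suc r. x j * pairing y (\<beta> (r - 1)) (q (v j)))"
        using 3 by (simp only: gU_def fUv lin_sum[OF l(2)] pairing_simps(5)) simp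
      also have "\<dots> = (\<Sum>j<r. x (Suc j) * of_bool (r - 1 = j))"
        unfolding sum.lessThan_Suc_shift using 3 by (simp add: q0 pairing_simps pq[symmetric] \<beta>f)
      also have "\<dots> = x r" using 3 by simp
      finally show ?thesis using 3 by (simp add: restr_def)
    qed (auto simp: gU_def restr_def)
  qed
  moreover have "gY (fY x) = restr r x" for x
  proof (rule ext)
    fix i
    show "gY (fY x) i = restr r x i"
    proof (cases "i < r")
      case True
      then have "gY (fY x) i = (\<Sum>j<r. x j * pairing y (\<beta> i) (p (v j)))"
        by (simp only: gY_def fY_def pairing_simps(5) if_True)
      then show ?thesis using True by (simp add: \<beta>f restr_def)
    qed (simp add: gY_def restr_def)
  qed
  ultimately show ?thesis unfolding pencil_retract_def using h1 h2 by blast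
qed

section \<open>Splitting off a Jordan block\<close>

lemma lin_funpow: "lin n n N \<Longrightarrow> lin n n (\<lambda>x. (N ^^ k) (restr n x))"
proof (induction k)
  case (Suc k)
  show ?case using lin_comp[OF Suc.prems Suc.IH[OF Suc.prems]] by simp
qed simp

text \<open>For the largest \<open>j0\<close> with \<open>c j0 \<noteq> 0\<close>, applying
  \<open>N^j0\<close> kills all terms except \<open>c j0 N^d x\<close>. With \<open>z = 0\<close>
  this is the independence of \<open>x, ..., N^d x\<close> when \<open>N^d x\<close> is nonzero;
  with general \<open>z\<close> it excludes the obstruction to a dual functional.\<close>

lemma nilpotent_chain_combination:
  fixes N :: "(nat \<Rightarrow> 'k::field) \<Rightarrow> nat \<Rightarrow> 'k"
  assumes N: "lin n n N" and x: "(N ^^ Suc d) x = 0"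
    and c: "\<exists>j\<le>d. c j \<noteq> 0" and eq: "(\<lambda>i. \<Sum>j<Suc d. c j * (N ^^ (d - j)) x i) = (N ^^ Suc d) z"
  shows "\<exists>k s. (N ^^ d) x = (\<lambda>i. s * (N ^^ (Suc d + k)) z i)"
proof -
  have zero: "(N ^^ k) 0 = 0" for k
    by (induction k) (simp_all only: funpow.simps comp_apply id_apply lin_zero[OF N])
  have lsum: "(N ^^ k) (\<lambda>i. \<Sum>j\<in>S. c j * v j i) = (\<lambda>i. \<Sum>j\<in>S. c j * (N ^^ k) (v j) i)" for k S v
  proof (induction k)
    case (Suc k)
    show ?case unfolding funpow.simps comp_apply Suc by (rule lin_sum[OF N])
  qed simp
  define j0 where "j0 = Max {j. j \<le> d \<and> c j \<noteq> 0}"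
  have fin: "finite {j. j \<le> d \<and> c j \<noteq> 0}" by simp
  have "j0 \<in> {j. j \<le> d \<and> c j \<noteq> 0}" unfolding j0_def using c by (intro Max_in fin) auto
  then have j0: "j0 \<le> d" "c j0 \<noteq> 0" by auto
  have above: "c j = 0" if "j \<le> d" "j > j0" for j
  proof (rule ccontr)
    assume "c j \<noteq> 0"
    then have "j \<le> j0" unfolding j0_def using that by (intro Max_ge fin) auto
    with that show False by simp
  qed
  have t: "c j * (N ^^ j0) ((N ^^ (d - j)) x) i = of_bool (j = j0) * (c j0 * (N ^^ d) x i)" if "j < Suc d" for j i
  proof -
    consider "j < j0" | "j = j0" | "j > j0" by linarith
    then show ?thesis
    proof cases
      case 1
      then have "j0 + (d - j) = (j0 - Suc j) + Suc d" using that by simp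
      then have "(N ^^ j0) ((N ^^ (d - j)) x) = (N ^^ (j0 - Suc j)) ((N ^^ Suc d) x)"
        by (metis comp_apply funpow_add)
      then show ?thesis using 1 x zero by simp
    next
      case 2
      then have "(N ^^ j0) ((N ^^ (d - j)) x) = (N ^^ d) x"
        using j0 by (metis comp_apply funpow_add le_add_diff_inverse)
      then show ?thesis using 2 by simp
    next
      case 3 then show ?thesis using above that by simp
    qed
  qed
  have "(N ^^ j0) (\<lambda>i. \<Sum>j<Suc d. c j * (N ^^ (d - j)) x i) = (\<lambda>i. \<Sum>j<Suc d. c j * (N ^^ j0) ((N ^^ (d - j)) x) i)"
    by (rule lsum)
  also have "\<dots> = (\<lambda>i. \<Sum>j<Suc d. of_bool (j = j0) * (c j0 * (N ^^ d) x i))"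
    by (intro ext sum.cong refl t) simp
  also have "\<dots> = (\<lambda>i. c j0 * (N ^^ d) x i)"
    using j0(1) by (simp only: sum_of_bool_mult(2)[OF finite_lessThan]) simp
  finally have "(\<lambda>i. c j0 * (N ^^ d) x i) = (N ^^ j0) ((N ^^ Suc d) z)" unfolding eq ..
  then have e: "c j0 * (N ^^ d) x i = (N ^^ (Suc d + j0)) z i" for i
    by (metis add.commute comp_apply funpow_add)
  have "(N ^^ d) x = (\<lambda>i. 1 / c j0 * (N ^^ (Suc d + j0)) z i)"
    unfolding e[symmetric] using j0(2) by (simp add: fun_eq_iff)
  then show ?thesis by blast
qed

text \<open>Take \<open>d\<close> maximal with \<open>N\<^sup>d x \<noteq> 0 = N\<^sup>d\<^sup>+\<^sup>1 x\<close> for some \<open>x\<close>. Maximality provides a functional that kills the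
  image of \<open>N\<^sup>d\<^sup>+\<^sup>1\<close> and is dual to \<open>x, N x, \<dots>, N\<^sup>d x\<close>; it splits off the Jordan block of \<open>x\<close>.\<close>

lemma jordan_block_retract:
  fixes T :: "(nat \<Rightarrow> 'k::field) \<Rightarrow> nat \<Rightarrow> 'k"
  assumes T: "lin n n T" and ev: "restr n v = v" "v \<noteq> 0" "T v = (\<lambda>i. \<alpha> * v i)"
  obtains m f g where "m \<ge> 1" "lin m n f" "lin n m g" "\<And>x. g (f x) = restr m x"
    "\<And>x. T (f x) = f (jord m \<alpha> x)" "\<And>x. g (T x) = jord m \<alpha> (g x)"
proof -
  define N where "N x = T x - (\<lambda>i. \<alpha> * restr n x i)" for x
  have N: "lin n n N"
  proof -
    have "lin n n (\<lambda>x i. \<alpha> * restr n x i)"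
      by (rule linI) (auto simp: restr_def fun_eq_iff algebra_simps)
    from lin_minus[OF T this] show ?thesis unfolding N_def .
  qed
  have zero: "(N ^^ k) 0 = 0" for k
    by (induction k) (simp_all only: funpow.simps comp_apply id_apply lin_zero[OF N])
  have add: "(N ^^ k) (x + y) = (N ^^ k) x + (N ^^ k) y" for k x y 
    by (induction k) (simp_all only: funpow.simps comp_apply id_apply lin_add[OF N])
  have scale: "(N ^^ k) (\<lambda>i. s * x i) = (\<lambda>i. s * (N ^^ k) x i)" for k s x 
    by (induction k) (simp_all only: funpow.simps comp_apply id_apply lin_scale[OF N])
  have Nr: "restr n ((N ^^ k) x) = (N ^^ k) x" if "restr n x = x" for k x
    by (cases k) (simp_all add: that restr_lin[OF N])
  define P where "P d \<longleftrightarrow> (\<exists>x. restr n x = x \<and> (N ^^ Suc d) x = 0 \<and> (N ^^ d) x \<noteq> 0)" for d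
  have "N v = 0" using ev by (simp add: N_def fun_eq_iff)
  then have "P 0" unfolding P_def using ev by (intro exI[of _ v]) auto
  \<comment> \<open>For \<open>d \<ge> n\<close> there are more than \<open>n\<close> vectors
    \<open>x, ..., N^d x\<close>, hence a dependency among them; so a greatest \<open>d\<close>
    exists.\<close>
  moreover have bound: "d < n" if Pd: "P d" for d
  proof (rule ccontr)
    assume "\<not> d < n"
    obtain x where x: "restr n x = x" "(N ^^ Suc d) x = 0" "(N ^^ d) x \<noteq> 0" using Pd unfolding P_def by blast
    have "lin (Suc d) n (\<lambda>c i. \<Sum>j<Suc d. c j * (N ^^ (d - j)) x i)" by (rule lin_combination) (rule Nr[OF x(1)])
    moreover have "n < Suc d" using \<open>\<not> d < n\<close> by simp
    ultimately obtain c where c: "restr (Suc d) c = c" "c \<noteq> 0" "(\<lambda>i. \<Sum>j<Suc d. c j * (N ^^ (d - j)) x i) = 0"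
      by (rule lin_kernel_nontrivial)
    obtain j where "c j \<noteq> 0" using c(2) by (auto simp: fun_eq_iff)
    then have "\<exists>j\<le>d. c j \<noteq> 0"
      using fun_cong[OF c(1), of j] by (intro exI[of _ j]) (simp add: restr_def split: if_splits)
    moreover have "(\<lambda>i. \<Sum>j<Suc d. c j * (N ^^ (d - j)) x i) = (N ^^ Suc d) 0" unfolding c(3) zero ..
    ultimately obtain k s where "(N ^^ d) x = (\<lambda>i. s * (N ^^ (Suc d + k)) 0 i)"
      using nilpotent_chain_combination[OF N x(2)] by blast
    then have "(N ^^ d) x = 0" unfolding zero by (simp add: fun_eq_iff)
    then show False using x(3) by simp
  qed
  ultimately have "P (GREATEST d. P d)" using GreatestI_nat[of P 0 n] by (simp add: less_imp_le)
  moreover define d where "d = (GREATEST d. P d)"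
  ultimately obtain x where x: "restr n x = x" "(N ^^ Suc d) x = 0" "(N ^^ d) x \<noteq> 0" unfolding P_def by blast
  have stable: "(N ^^ Suc d) z = 0" if "restr n z = z" "(N ^^ Suc (Suc d)) z = 0" for z
  proof (rule ccontr)
    assume "(N ^^ Suc d) z \<noteq> 0"
    then have "P (Suc d)" unfolding P_def using that by blast
    then have "Suc d \<le> d" unfolding d_def using bound by (intro Greatest_le_nat[of P _ n]) (auto intro: less_imp_le)
    then show False by simp
  qed
  \<comment> \<open>Then \<open>s N^k z\<close> would start a Jordan chain longer than that of
    \<open>x\<close>.\<close>
  have no: False if "(N ^^ d) x = (\<lambda>i. s * (N ^^ (Suc d + k)) z i)" "restr n z = z" for s k z
  proof -
    let ?z = "\<lambda>i. s * (N ^^ k) z i"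
    have zr: "restr n ?z = ?z" using Nr[OF that(2)] by (simp add: restr_scale)
    have e: "(N ^^ Suc d) ?z = (N ^^ d) x" unfolding scale that(1) by (simp only: funpow_add comp_apply)
    then have "(N ^^ Suc (Suc d)) ?z = (N ^^ Suc d) x" by simp
    then have "(N ^^ Suc d) ?z = 0" using stable[OF zr] x(2) by simp
    then show False using e x(3) by simp
  qed
  define M where "M = (\<lambda>i l. case i of Inl j \<Rightarrow> (N ^^ Suc d) (unit j) l | Inr k \<Rightarrow> (N ^^ k) x l)"
  have "\<exists>\<phi>. (\<forall>z. pairing n \<phi> ((N ^^ Suc d) z) = 0) \<and> (\<forall>k<d. pairing n \<phi> ((N ^^ k) x) = 0) \<and> pairing n \<phi> ((N ^^ d) x) = 1"
  proof -
    let ?A = "({..<n} <+> {..<d}) :: (nat + nat) set"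
    have sA: "(\<Sum>i\<in>?A. h i) = (\<Sum>j<n. h (Inl j)) + (\<Sum>k<d. h (Inr k))" for h :: "nat + nat \<Rightarrow> 'k"
      by (simp add: sum.Plus)
    have lN: "lin n n (\<lambda>z. (N ^^ Suc d) z)"
    proof -
      have "(\<lambda>z. (N ^^ Suc d) z) = (\<lambda>z. (N ^^ d) (restr n (N z)))" by (simp add: funpow_swap1 restr_lin[OF N])
      then show ?thesis using lin_comp[OF lin_funpow[OF N] N, of d] by simp
    qed
    have "finite ?A" "finite {..<n}" by simp_all
    from row_span_or_separating[OF this, of M "(N ^^ d) x"] show ?thesis
    proof
      assume "\<exists>c. (\<forall>i\<in>?A. (\<Sum>l<n. M i l * c l) = 0) \<and> (\<Sum>l<n. (N ^^ d) x l * c l) = 1"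
      then obtain c where c: "\<And>j. j < n \<Longrightarrow> (\<Sum>l<n. M (Inl j) l * c l) = 0" "\<And>k. k < d \<Longrightarrow> (\<Sum>l<n. M (Inr k) l * c l) = 0"
         "(\<Sum>l<n. (N ^^ d) x l * c l) = 1" by (auto simp: Plus_def)
      have "pairing n c ((N ^^ Suc d) (unit j)) = 0" if "j < n" for j
        using c(1)[OF that] unfolding M_def pairing_def by (simp add: mult.commute)
      then have "pairing n c ((N ^^ Suc d) z) = 0" for z
        unfolding pairing_expand[OF lN, of c z] by simp
      moreover have "pairing n c ((N ^^ k) x) = 0" if "k < d" for k
        using c(2)[OF that] unfolding M_def pairing_def by (simp add: mult.commute)
      moreover have "pairing n c ((N ^^ d) x) = 1" using c(3) unfolding pairing_def by (simp add: mult.commute)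
      ultimately show ?thesis by blast
    next
      assume "\<exists>w. \<forall>l\<in>{..<n}. (N ^^ d) x l = (\<Sum>i\<in>?A. w i * M i l)"
      then obtain w where w: "\<And>l. l < n \<Longrightarrow> (N ^^ d) x l = (\<Sum>j<n. w (Inl j) * (N ^^ Suc d) (unit j) l) + (\<Sum>k<d. w (Inr k) * (N ^^ k) x l)"
        unfolding sA M_def by auto
      define z where "z = restr n (\<lambda>j. w (Inl j))"
      have Nz: "(N ^^ Suc d) z l = (\<Sum>j<n. w (Inl j) * (N ^^ Suc d) (unit j) l)" for l
        unfolding lin_expand[OF lN, of z l] by (auto simp: z_def restr_def mult.commute intro!: sum.cong)
      \<comment> \<open>Index \<open>j\<close> stands for the power \<open>N^(d-j)\<close>, so the
        coefficient 1 of \<open>N^d x\<close> sits at \<open>j = 0\<close>.\<close>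
      define c where "c j = (if j = 0 then 1 else - w (Inr (d - j)))" for j :: nat
      have "(\<lambda>i. \<Sum>j<Suc d. c j * (N ^^ (d - j)) x i) = (N ^^ Suc d) z"
      proof (rule ext)
        fix i
        have rv: "(\<Sum>j<d. w (Inr (d - Suc j)) * (N ^^ (d - Suc j)) x i) = (\<Sum>k<d. w (Inr k) * (N ^^ k) x i)"
          using sum.nat_diff_reindex[of "\<lambda>k. w (Inr k) * (N ^^ k) x i" d] .
        have "(\<Sum>j<Suc d. c j * (N ^^ (d - j)) x i) = (N ^^ d) x i - (\<Sum>k<d. w (Inr k) * (N ^^ k) x i)"
          unfolding sum.lessThan_Suc_shift rv[symmetric] by (simp add: c_def sum_negf)
        also have "\<dots> = (N ^^ Suc d) z i"
        proof (cases "i < n")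
          case True then show ?thesis using w[OF True] by (simp add: Nz del: funpow.simps)
        next
          case False
          have "(N ^^ k) x i = 0" for k using fun_cong[OF Nr[OF x(1)], of k i] False by (simp add: restr_def)
          moreover have "(N ^^ Suc d) z i = 0" using fun_cong[OF restr_lin[OF lN], of z i] False by (simp add: restr_def)
          ultimately show ?thesis by simp
        qed
        finally show "(\<Sum>j<Suc d. c j * (N ^^ (d - j)) x i) = (N ^^ Suc d) z i" .
      qed
      moreover have "\<exists>j\<le>d. c j \<noteq> 0" by (intro exI[of _ 0]) (simp add: c_def)
      ultimately obtain k s where "(N ^^ d) x = (\<lambda>i. s * (N ^^ (Suc d + k)) z i)"
        using nilpotent_chain_combination[OF N x(2)] by blast
      then show ?thesis using no[of s k z] by (simp add: z_def)
    qed
  qed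
  then obtain \<phi> where \<phi>: "\<And>z. pairing n \<phi> ((N ^^ Suc d) z) = 0" "\<And>k. k < d \<Longrightarrow> pairing n \<phi> ((N ^^ k) x) = 0"
    "pairing n \<phi> ((N ^^ d) x) = 1" by blast
  let ?m = "Suc d"
  \<comment> \<open>Unit vector \<open>j\<close> goes to \<open>N^(d-j) x\<close>, so that
    \<open>N\<close> lowers the index as the off-diagonal part of \<open>jord\<close> does. Dually,
    coordinate \<open>i\<close> in \<open>g\<close> is \<phi> after \<open>N^i\<close>.\<close>
  define f where "f c = (\<lambda>i. \<Sum>j<?m. c j * (N ^^ (d - j)) x i)" for c
  define g where "g z = (\<lambda>i. if i < ?m then pairing n \<phi> ((N ^^ i) (restr n z)) else 0)" for z
  have lf: "lin ?m n f" unfolding f_def by (rule lin_combination) (rule Nr[OF x(1)])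
  have lg: "lin n ?m g"
    by (rule linI) (auto simp: g_def add scale pairing_simps restr_scale fun_eq_iff restr_def[of ?m])
  have TN: "T z = N z + (\<lambda>i. \<alpha> * restr n z i)" for z by (simp add: N_def)
  have \<phi>': "pairing n \<phi> ((N ^^ k) x) = of_bool (k = d)" for k
  proof -
    consider "k < d" | "k = d" | "k > d" by linarith
    then show ?thesis
    proof cases
      case 3
      then have "(N ^^ k) x = (N ^^ (k - Suc d)) ((N ^^ Suc d) x)"
        by (metis Suc_leI add.commute comp_apply funpow_add le_add_diff_inverse)
      then show ?thesis using x(2) zero 3 by (simp add: pairing_simps)
    qed (use \<phi> in auto)
  qed
  have rf: "restr n (f c) = f c" for c by (rule restr_lin[OF lf])
  have Nf: "(N ^^ i) (f c) = (\<lambda>l. \<Sum>j<?m. c j * (N ^^ i) ((N ^^ (d - j)) x) l)" for i c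
  proof (induction i)
    case 0 show ?case by (simp add: f_def)
  next
    case (Suc i)
    show ?case unfolding funpow.simps comp_apply Suc by (rule lin_sum[OF N])
  qed
  have gf: "g (f c) = restr ?m c" for c
  proof (rule ext)
    fix i
    show "g (f c) i = restr ?m c i"
    proof (cases "i < ?m")
      case True
      have "g (f c) i = (\<Sum>j<?m. c j * pairing n \<phi> ((N ^^ i) ((N ^^ (d - j)) x)))"
        using True unfolding g_def rf Nf pairing_simps(5) by simp
      also have "\<dots> = (\<Sum>j<?m. c j * of_bool (j = i))"
      proof (intro sum.cong refl)
        fix j assume "j \<in> {..<?m}"
        then have "(i + (d - j) = d) = (j = i)" using True by auto
        moreover have "(N ^^ i) ((N ^^ (d - j)) x) = (N ^^ (i + (d - j))) x" by (simp only: funpow_add comp_apply)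
        ultimately show "c j * pairing n \<phi> ((N ^^ i) ((N ^^ (d - j)) x)) = c j * of_bool (j = i)" by (simp only: \<phi>')
      qed
      finally show ?thesis using True by (simp add: restr_def sum_of_bool_mult del: sum.lessThan_Suc)
    qed (simp add: g_def restr_def)
  qed
  have Tf: "T (f c) = f (jord ?m \<alpha> c)" for c
  proof (rule ext)
    fix l
    have "N (f c) l = (\<Sum>j<?m. c j * N ((N ^^ (d - j)) x) l)" using fun_cong[OF Nf[of 1 c], of l] by simp
    also have "\<dots> = (\<Sum>j<d. c (Suc j) * (N ^^ (d - j)) x l)"
    proof -
      have "N ((N ^^ (d - Suc j)) x) = (N ^^ (d - j)) x" if "j < d" for j
        using Suc_diff_Suc[OF that] by (metis comp_apply funpow.simps(2))
      then show ?thesis unfolding sum.lessThan_Suc_shift using x(2) by simp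
    qed
    finally have 1: "N (f c) l = (\<Sum>j<d. c (Suc j) * (N ^^ (d - j)) x l)" .
    have "f (jord ?m \<alpha> c) l = (\<Sum>j<?m. \<alpha> * (c j * (N ^^ (d - j)) x l)) + (\<Sum>j<?m. (if Suc j < ?m then c (Suc j) else 0) * (N ^^ (d - j)) x l)"
      unfolding f_def sum.distrib[symmetric] by (intro sum.cong) (auto simp: jord_def algebra_simps)
    also have "\<dots> = \<alpha> * f c l + (\<Sum>j<d. c (Suc j) * (N ^^ (d - j)) x l)"
      unfolding f_def by (simp add: sum_distrib_left distrib_left)
    finally show "T (f c) l = f (jord ?m \<alpha> c) l" unfolding TN rf using 1 by simp
  qed
  have gT: "g (T z) = jord ?m \<alpha> (g z)" for z
  proof (rule ext)
    fix i
    have e: "(N ^^ i) (restr n (T z)) = (N ^^ Suc i) (restr n z) + (\<lambda>l. \<alpha> * (N ^^ i) (restr n z) l)"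
    proof -
      have "restr n (T z) = N (restr n z) + (\<lambda>l. \<alpha> * restr n z l)"
        unfolding restr_lin[OF T] lin_restr[OF N] by (rule TN)
      then show ?thesis by (simp only: add scale funpow.simps comp_apply funpow_swap1)
    qed
    show "g (T z) i = jord ?m \<alpha> (g z) i"
    proof (cases "i < ?m")
      case True
      then have "g (T z) i = pairing n \<phi> ((N ^^ Suc i) (restr n z)) + \<alpha> * pairing n \<phi> ((N ^^ i) (restr n z))"
        unfolding g_def e pairing_simps(1,2) by simp
      moreover have "Suc i < ?m \<or> Suc i = ?m" using True by auto
      ultimately show ?thesis using True \<phi>(1)[of "restr n z"] by (auto simp: jord_def g_def simp del: funpow.simps)
    qed (simp add: g_def jord_def)
  qed
  show thesis by (rule that[OF _ lf lg gf Tf gT]) simp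
qed

lemma exists_eigenvector:
  fixes T :: "(nat \<Rightarrow> 'k::alg_closed_field) \<Rightarrow> nat \<Rightarrow> 'k"
  assumes T: "lin n n T" and "n \<ge> 1"
  obtains v \<alpha> where "restr n v = v" "v \<noteq> 0" "T v = (\<lambda>i. \<alpha> * v i)"
proof -
  define A where "A = mat_of n n T"
  have A: "A \<in> carrier_mat n n" by (simp add: A_def)
  have "degree (char_poly A) > 0" using degree_monic_char_poly[OF A] \<open>n \<ge> 1\<close> by simp
  then obtain \<alpha> where "poly (char_poly A) \<alpha> = 0" using alg_closed_imp_poly_has_root by blast
  then obtain w where w: "w \<in> carrier_vec n" "w \<noteq> 0\<^sub>v n" "A *\<^sub>v w = \<alpha> \<cdot>\<^sub>v w"
    using eigenvalue_root_char_poly[OF A] A unfolding eigenvalue_def eigenvector_def by auto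
  define v where "v i = (if i < n then w $ i else 0)" for i
  show thesis
  proof (rule that[of v \<alpha>])
    show "restr n v = v" by (auto simp: restr_def v_def)
    show "v \<noteq> 0"
    proof
      assume "v = 0"
      then have "v i = 0" for i by simp
      then have "w $ i = 0" if "i < n" for i using that unfolding v_def by metis
      then have "w = 0\<^sub>v n" using w(1) by (intro eq_vecI) auto
      then show False using w(2) by simp
    qed
    have "act A v = (\<lambda>i. \<alpha> * v i)"
    proof (rule ext)
      fix i
      show "act A v i = \<alpha> * v i"
      proof (cases "i < n")
        case True
        have "act A v i = (A *\<^sub>v w) $ i"
          using A w(1) True by (auto simp: act_def v_def scalar_prod_def lessThan_atLeast0 intro!: sum.cong)
        then show ?thesis using w True by (simp add: v_def)
      qed (use A in \<open>simp add: act_def v_def\<close>)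
    qed
    then show "T v = (\<lambda>i. \<alpha> * v i)" using act_mat_of[OF T] by (simp add: A_def)
  qed
qed

text \<open>If the field were finite, the product of all \<open>X - a\<close>, increased by 1, would
  have no root.\<close>

lemma infinite_UNIV_alg_closed: "infinite (UNIV :: 'k::alg_closed_field set)"
proof
  assume fin: "finite (UNIV :: 'k set)"
  define P :: "'k poly" where "P = (\<Prod>a\<in>UNIV. [:- a, 1:])"
  have "degree P = card (UNIV :: 'k set)" unfolding P_def
    by (subst degree_prod_eq_sum_degree) auto
  moreover have "card (UNIV :: 'k set) > 0" using fin by (simp add: card_gt_0_iff)
  ultimately have "degree (P + 1) > 0" by (simp add: degree_add_eq_left)
  then obtain x where "poly (P + 1) x = 0" using alg_closed_imp_poly_has_root by blast
  moreover have "poly P x = 0" unfolding P_def poly_prod using fin by (auto intro: bexI[of _ x])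
  ultimately show False by simp
qed

section \<open>Kernel vectors over the polynomial ring\<close>

text \<open>Comparison of coefficients in \<open>(T p - q) w = 0\<close>. As \<open>d\<close> bounds
  all degrees, the chain ends with \<open>p (v d) = q (v (d+1)) = 0\<close>.\<close>

lemma chain_of_polynomial_kernel:
  fixes p q :: "(nat \<Rightarrow> 'k::field) \<Rightarrow> nat \<Rightarrow> 'k"
  assumes l: "lin u y p" "lin u y q" and w: "\<exists>j<u. w j \<noteq> 0"
    and k: "\<And>i. i < y \<Longrightarrow> (\<Sum>j<u. [:- q (unit j) i, p (unit j) i:] * w j) = 0"
  shows "\<exists>k v. chain u p q k v"
proof -
  define v where "v k = restr u (\<lambda>j. coeff (w j) k)" for k
  define d where "d = Max ((\<lambda>j. degree (w j)) ` {..<u})"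
  have deg: "degree (w j) \<le> d" if "j < u" for j unfolding d_def using that by (intro Max_ge) auto
  have pv: "f (v k) i = (\<Sum>j<u. f (unit j) i * coeff (w j) k)" if "lin u y f" for f k i
    by (subst lin_expand[OF that]) (auto simp: v_def restr_def intro!: sum.cong)
  have out: "f x i = 0" if "lin u y f" "\<not> i < y" for f x i
    using fun_cong[OF restr_lin[OF that(1), of x], of i] that(2) by (simp add: restr_def)
  have rec: "p (v k) i = q (v (Suc k)) i" for k i
  proof (cases "i < y")
    case True
    have "coeff (\<Sum>j<u. [:- q (unit j) i, p (unit j) i:] * w j) (Suc k) = p (v k) i - q (v (Suc k)) i"
      unfolding pv[OF l(1)] pv[OF l(2)] by (simp add: coeff_sum sum_subtractf)
    then show ?thesis using k[OF True] by simp
  qed (simp add: out l)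
  have q0: "q (v 0) i = 0" for i
  proof (cases "i < y")
    case True
    have "coeff (\<Sum>j<u. [:- q (unit j) i, p (unit j) i:] * w j) 0 = - q (v 0) i"
      unfolding pv[OF l(2)] by (simp add: coeff_sum sum_negf)
    then show ?thesis using k[OF True] by simp
  qed (simp add: out l)
  have vd: "v (Suc d) = 0"
  proof -
    have "coeff (w j) (Suc d) = 0" if "j < u" for j using deg[OF that] by (intro coeff_eq_0) simp
    then show ?thesis by (auto simp: v_def restr_def fun_eq_iff)
  qed
  have "chain u p q d v" unfolding chain_def
  proof (intro conjI allI impI)
    show "restr u (v i) = v i" for i by (simp add: v_def)
    show "q (v 0) = 0" using q0 by (simp add: fun_eq_iff)
    show "p (v i) = q (v (Suc i))" for i using rec by (simp add: fun_eq_iff)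
    show "p (v d) = 0" using rec[of d] vd lin_zero[OF l(2)] by (simp add: fun_eq_iff)
    obtain j where j: "j < u" "w j \<noteq> 0" using w by blast
    then have "v (degree (w j)) j \<noteq> 0" by (simp add: v_def restr_def)
    then have "v (degree (w j)) \<noteq> 0" by (auto simp: fun_eq_iff)
    then show "\<exists>i\<le>d. v i \<noteq> 0" using deg[OF j(1)] by blast
  qed
  then show ?thesis by blast
qed

text \<open>The matrix T p - q has more columns than rows over the domain k[T].\<close>

lemma chain_if_wide:
  assumes l: "lin u y p" "lin u y q" and "y < u"
  shows "\<exists>k v. chain u p q k v"
proof -
  have "card {..<y} < card {..<u}" using \<open>y < u\<close> by simp
  from homogeneous_system_nontrivial[OF _ _ this, of "\<lambda>i j. [:- q (unit j) i, p (unit j) i:]"]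
  obtain w where "\<exists>j\<in>{..<u}. w j \<noteq> 0"
    "\<forall>i\<in>{..<y}. (\<Sum>j<u. [:- q (unit j) i, p (unit j) i:] * w j) = 0"
    by (auto simp only: finite_lessThan)
  then show ?thesis by (intro chain_of_polynomial_kernel[OF l, of w]) blast+
qed

text \<open>The determinant of T p - q in k[T] decides. If it vanishes, the matrix has a kernel
  vector over k[T]; otherwise some \<mu> of the infinite field is not a root of it, and \<mu> p - q
  is injective.\<close>

lemma chain_or_regular:
  fixes p q :: "(nat \<Rightarrow> 'k::alg_closed_field) \<Rightarrow> nat \<Rightarrow> 'k"
  assumes l: "lin n n p" "lin n n q"
  shows "(\<exists>k v. chain n p q k v) \<or>
    (\<exists>\<mu>. \<forall>x. restr n x = x \<longrightarrow> (\<lambda>i. \<mu> * p x i) - q x = 0 \<longrightarrow> x = 0)"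
proof -
  define M where "M = mat n n (\<lambda>(i, j). [:- q (unit j) i, p (unit j) i:])"
  have M: "M \<in> carrier_mat n n" by (simp add: M_def)
  show ?thesis
  proof (cases "det M = 0")
    case True
    then obtain v where v: "v \<in> carrier_vec n" "v \<noteq> 0\<^sub>v n" "M *\<^sub>v v = 0\<^sub>v n"
      using det_0_iff_vec_prod_zero[OF M] by blast
    have "\<exists>j<n. v $ j \<noteq> 0" using v(1,2) by (metis carrier_vecD eq_vecI index_zero_vec)
    moreover have "(\<Sum>j<n. [:- q (unit j) i, p (unit j) i:] * v $ j) = 0" if "i < n" for i
      using arg_cong[OF v(3), of "\<lambda>w. w $ i"] that v(1) unfolding M_def
      by (simp add: scalar_prod_def lessThan_atLeast0)
    ultimately show ?thesis using chain_of_polynomial_kernel[OF l, of "\<lambda>j. v $ j"] by blast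
  next
    case False
    have "{x. poly (det M) x = 0} \<noteq> UNIV"
      using poly_roots_finite[OF False] infinite_UNIV_alg_closed by metis
    then obtain \<mu> where \<mu>: "poly (det M) \<mu> \<noteq> 0" by auto
    have ev: "comm_ring_hom (\<lambda>f :: 'k poly. poly f \<mu>)" by unfold_locales auto
    let ?M = "map_mat (\<lambda>f. poly f \<mu>) M"
    have M': "?M \<in> carrier_mat n n" using M by simp
    have "det ?M \<noteq> 0" using \<mu> comm_ring_hom.hom_det[OF ev, of M] by simp
    then have no: "\<not> (\<exists>v. v \<in> carrier_vec n \<and> v \<noteq> 0\<^sub>v n \<and> ?M *\<^sub>v v = 0\<^sub>v n)"
      using det_0_iff_vec_prod_zero[OF M'] by blast
    have "x = 0" if x: "restr n x = x" "(\<lambda>i. \<mu> * p x i) - q x = 0" for x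
    proof (rule ccontr)
      assume "x \<noteq> 0"
      then obtain i where i: "x i \<noteq> 0" by (auto simp: fun_eq_iff)
      then have "i < n" using fun_cong[OF x(1), of i] by (simp add: restr_def split: if_splits)
      then have "vec n x \<noteq> 0\<^sub>v n" using i by (metis index_vec index_zero_vec(1))
      moreover have "?M *\<^sub>v vec n x = 0\<^sub>v n"
      proof (rule eq_vecI)
        fix i assume "i < dim_vec (0\<^sub>v n :: 'k vec)"
        then have i: "i < n" by simp
        have "(?M *\<^sub>v vec n x) $ i = (\<Sum>j<n. (- q (unit j) i + \<mu> * p (unit j) i) * x j)"
          using i M by (simp add: M_def scalar_prod_def lessThan_atLeast0)
        also have "\<dots> = \<mu> * p x i - q x i"
          unfolding lin_expand[OF l(1), of x i] lin_expand[OF l(2), of x i]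
          by (simp add: algebra_simps sum_subtractf sum_distrib_left)
        also have "\<dots> = 0" using fun_cong[OF x(2), of i] by simp
        finally show "(?M *\<^sub>v vec n x) $ i = 0\<^sub>v n $ i" using i by simp
      qed (simp add: M_def)
      ultimately show False using no vec_carrier[of n x] by blast
    qed
    then show ?thesis by blast
  qed
qed

section \<open>Regular pencils and Kronecker's theorem\<close>

text \<open>An invertible \<open>p\<close> identifies Y with U and reduces the pencil to the single
  operator \<open>p^-1 q\<close>, one of whose Jordan blocks splits off.\<close>

lemma jordan_pencil_retract:
  assumes l: "lin n n p" "lin n n q" and r: "lin n n r" "\<And>x. r (p x) = restr n x"
    and ev: "restr n v = v" "v \<noteq> (0 :: nat \<Rightarrow> 'k::field)" "q v = (\<lambda>i. \<alpha> * p v i)"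
  shows "\<exists>m\<ge>1. pencil_retract n n p q m m (restr m) (jord m \<alpha>)"
proof -
  have pr: "p (r x) = restr n x" for x using left_inverse_is_right_inverse[OF l(1) r] .
  have T: "lin n n (\<lambda>x. r (q x))" using lin_comp[OF r(1) l(2)] .
  have "r (q v) = (\<lambda>i. \<alpha> * v i)" unfolding ev(3) lin_scale[OF r(1)] r(2) ev(1) ..
  from jordan_block_retract[OF T ev(1,2) this]
  obtain m f g where m: "m \<ge> 1" and f: "lin m n f" and g: "lin n m g" and gf: "\<And>x. g (f x) = restr m x"
    and Tf: "\<And>x. r (q (f x)) = f (jord m \<alpha> x)" and gT: "\<And>x. g (r (q x)) = jord m \<alpha> (g x)"
    by blast
  have "pencil_hom m m (restr m) (jord m \<alpha>) n n p q f (\<lambda>x. p (f x))"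
    unfolding pencil_hom_def using f lin_comp[OF l(1) f]
    by (simp add: Tf[symmetric] pr restr_lin[OF l(2)] lin_restr[OF f])
  moreover have "pencil_hom n n p q m m (restr m) (jord m \<alpha>) g (\<lambda>x. g (r x))"
    unfolding pencil_hom_def using g lin_comp[OF g r(1)]
    by (simp add: gT r(2) lin_restr[OF g] restr_lin[OF g])
  moreover have "g (r (p (f x))) = restr m x" for x by (simp add: r(2) lin_restr[OF g] gf)
  ultimately show ?thesis unfolding pencil_retract_def using m gf by blast
qed

text \<open>The two nilpotent blocks differ by reversing the order of the basis.\<close>

lemma shiftr_jord: "pencil_retract n n (jord n 0) (restr n) n n (shiftr n) (restr n)"
proof -
  define \<rho> where "\<rho> x = (\<lambda>i. if i < n then x (n - 1 - i) else 0)" for x :: "nat \<Rightarrow> 'a"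
  have l: "lin n n \<rho>" by (rule linI) (auto simp: \<rho>_def restr_def fun_eq_iff)
  have e1: "\<rho> (shiftr n x) = jord n 0 (\<rho> x)" "\<rho> (jord n 0 x) = shiftr n (\<rho> x)" "\<rho> (\<rho> x) = restr n x" for x
    by (auto simp: \<rho>_def shiftr_def jord_def fun_eq_iff restr_def Suc_diff_Suc)
  have e2: "\<rho> (restr n x) = restr n (\<rho> x)" for x using lin_restr[OF l] restr_lin[OF l] by simp
  show ?thesis unfolding pencil_retract_def pencil_hom_def using l e1 e2 by blast
qed

theorem kronecker:
  fixes p q :: "(nat \<Rightarrow> 'k::alg_closed_field) \<Rightarrow> nat \<Rightarrow> 'k"
  assumes l: "lin u y p" "lin u y q" and pos: "u + y > 0"
  shows "\<exists>u' y' p' q'. std_pencil u' y' p' q' \<and> pencil_retract u y p q u' y' p' q'"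
proof -
  have chain: ?thesis if "\<exists>k v. chain u p q k v"
    using chain_retract[OF l that] std_pencil.intros(1) by blast
  consider "y < u" | "u < y" | "u = y" by linarith
  then show ?thesis
  proof cases
    case 1
    then show ?thesis using chain_if_wide[OF l] chain by blast
  next
    case 2
    let ?p = "transp u y p" and ?q = "transp u y q"
    have lt: "lin y u ?q" "lin y u ?p" using lin_transp l by auto
    obtain r where r: "pencil_retract y u ?q ?p (Suc r) r (restr r) (shiftl r)"
      using chain_retract[OF lt chain_if_wide[OF lt 2]] by blast
    from pencil_retract_transp[OF r lt lin_std(1,3)]
    have "pencil_retract u y q p r (Suc r) (restr r) (shiftr (Suc r))"
      unfolding transp_transp[OF l(1)] transp_transp[OF l(2)] transp_std .
    then show ?thesis using pencil_retract_swap std_pencil.intros(2) by blast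
  next
    case 3
    define n where "n = u"
    have ln: "lin n n p" "lin n n q" and n: "n \<ge> 1" "u = n" "y = n" using l 3 pos by (auto simp: n_def)
    show ?thesis
    proof (cases "\<exists>k v. chain u p q k v")
      case True then show ?thesis by (rule chain)
    next
      case False
      then obtain \<mu> where \<mu>: "\<And>x. restr n x = x \<Longrightarrow> (\<lambda>i. \<mu> * p x i) - q x = 0 \<Longrightarrow> x = 0"
        using chain_or_regular[OF ln] n by auto
      have "pencil_retract n n p q m m (restr m) (jord m \<alpha>) \<Longrightarrow> m \<ge> 1 \<Longrightarrow> ?thesis" for m \<alpha>
        using std_pencil.intros(3) n by blast
      moreover have "pencil_retract n n p q m m (jord m 0) (restr m) \<Longrightarrow> m \<ge> 1 \<Longrightarrow> ?thesis" for m
        using std_pencil.intros(4) n pencil_retract_trans[OF _ shiftr_jord] by blast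
      moreover have "\<exists>m\<ge>1. (\<exists>\<alpha>. pencil_retract n n p q m m (restr m) (jord m \<alpha>)) \<or> pencil_retract n n p q m m (jord m 0) (restr m)"
      proof (cases "\<forall>x. restr n x = x \<longrightarrow> p x = 0 \<longrightarrow> x = 0")
        case True
        then obtain r where r: "lin n n r" "\<And>x. r (p x) = restr n x" "\<And>x. p (r x) = restr n x"
          using injective_inverse[OF ln(1)] by metis
        obtain v \<alpha> where v: "restr n v = v" "v \<noteq> 0" "r (q v) = (\<lambda>i. \<alpha> * v i)"
          using exists_eigenvector[OF lin_comp[OF r(1) ln(2)] n(1)] by blast
        have "q v = p (r (q v))" by (simp add: r restr_lin[OF ln(2)])
        then have "q v = (\<lambda>i. \<alpha> * p v i)" unfolding v(3) by (simp only: lin_scale[OF ln(1)])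
        from jordan_pencil_retract[OF ln r(1,2) v(1,2) this] show ?thesis by blast
      next
        case False
        then obtain v where v: "restr n v = v" "p v = 0" "v \<noteq> 0" by blast
        \<comment> \<open>A kernel vector of \<open>p\<close> is an eigenvector at infinity. With
          \<open>s = \<mu> p - q\<close> invertible, it is an eigenvector of \<open>s^-1 p\<close>
          for 0. A nilpotent block J of this operator gives a retract with the maps J and
          \<open>V = \<mu> J - 1\<close>, because \<open>q = \<mu> p - s\<close>.\<close>
        define s where "s x = (\<lambda>i. \<mu> * p x i) - q x" for x
        have "lin n n (\<lambda>x i. \<mu> * p x i)"
          by (rule linI) (auto simp: lin_simps(1,2,3)[OF ln(1)] fun_eq_iff algebra_simps restr_scale restr_lin[OF ln(1)])
        from lin_minus[OF this ln(2)] have s: "lin n n s" unfolding s_def .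
        obtain r where r: "lin n n r" "\<And>x. r (s x) = restr n x" "\<And>x. s (r x) = restr n x"
          using injective_inverse[OF s] \<mu> unfolding s_def by metis
        have T: "lin n n (\<lambda>x. r (p x))" using lin_comp[OF r(1) ln(1)] .
        have "r (p v) = (\<lambda>i. 0 * v i)" by (simp add: v lin_zero[OF r(1)] fun_eq_iff)
        from jordan_block_retract[OF T v(1,3) this]
        obtain m f g where m: "m \<ge> 1" and f: "lin m n f" and g: "lin n m g" and gf: "\<And>x. g (f x) = restr m x"
          and Tf: "\<And>x. r (p (f x)) = f (jord m 0 x)" and gT: "\<And>x. g (r (p x)) = jord m 0 (g x)"
          by blast
        define V where "V x = (\<lambda>i. \<mu> * jord m 0 x i) - restr m x" for x :: "nat \<Rightarrow> 'k"
        have V: "lin m m V" unfolding V_def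
        proof (rule lin_minus)
          show "lin m m (\<lambda>x i. \<mu> * jord m 0 x i)"
            by (rule linI) (auto simp: jord_def restr_def fun_eq_iff algebra_simps)
        qed simp
        have q: "q x = (\<lambda>i. \<mu> * p x i) - s x" for x by (simp add: s_def)
        have rq: "r (q x) = (\<lambda>i. \<mu> * r (p x) i) - restr n x" for x
          unfolding q lin_diff[OF r(1)] lin_scale[OF r(1)] r(2) ..
        have h1: "pencil_hom m m (jord m 0) V n n p q f (\<lambda>x. s (f x))"
        proof -
          have "s (f (jord m 0 x)) = p (f x)" for x
            by (simp flip: Tf add: r restr_lin[OF ln(1)])
          moreover have "s (f (V x)) = q (f x)" for x
          proof -
            have "f (V x) = r (q (f x))"
              unfolding V_def rq Tf lin_diff[OF f] lin_scale[OF f] lin_restr[OF f] restr_lin[OF f] ..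
            then show ?thesis by (simp add: r restr_lin[OF ln(2)])
          qed
          ultimately show ?thesis unfolding pencil_hom_def using f lin_comp[OF s f] by simp
        qed
        have h2: "pencil_hom n n p q m m (jord m 0) V g (\<lambda>x. g (r x))"
        proof -
          have "g (r (q x)) = V (g x)" for x
            unfolding rq V_def lin_diff[OF g] lin_scale[OF g] gT lin_restr[OF g] restr_lin[OF g] ..
          then show ?thesis unfolding pencil_hom_def using g lin_comp[OF g r(1)] gT by simp
        qed
        have "g (r (s (f x))) = restr m x" for x by (simp add: r lin_restr[OF g] gf)
        then have R: "pencil_retract n n p q m m (jord m 0) V" unfolding pencil_retract_def using h1 h2 gf by blast
        \<comment> \<open>\<open>V\<close> is triangular with diagonal -1; the coordinates of a
          kernel vector vanish from the last one backwards.\<close>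
        have "x = 0" if x: "restr m x = x" "V x = 0" for x
        proof -
          have "x (m - Suc k) = 0" if "k < m" for k
            using that
          proof (induction k)
            case 0
            then show ?case using fun_cong[OF x(2), of "m - 1"] by (simp add: V_def jord_def restr_def)
          next
            case (Suc k)
            then show ?case using fun_cong[OF x(2), of "m - Suc (Suc k)"]
              by (simp add: V_def jord_def restr_def Suc_diff_Suc)
          qed
          from this[of "m - Suc i" for i] have "x i = 0" if "i < m" for i
            using that by (metis Suc_diff_Suc diff_Suc_less diff_diff_cancel gr_implies_not0 less_imp_le_nat neq0_conv)
          then have "restr m x = 0" by (auto simp: restr_def fun_eq_iff)
          then show ?thesis using x(1) by simp
        qed
        then obtain W where W: "lin m m W" "\<And>x. W (V x) = restr m x" using injective_inverse[OF V] by metis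
        \<comment> \<open>It remains to normalize the pencil \<open>(J, V)\<close>. With the two
          maps exchanged \<open>V\<close> is the invertible one, and \<open>?e\<close> has
          eigenvalue 0; so a block at 0 splits off, and exchanging back puts it at infinity.\<close>
        let ?e = "unit 0 :: nat \<Rightarrow> 'k"
        have "restr m ?e = ?e" "?e \<noteq> 0" "jord m 0 ?e = (\<lambda>i. 0 * V ?e i)"
          using m by (auto simp: restr_def fun_eq_iff jord_def)
        from jordan_pencil_retract[OF V lin_std(6) W this] obtain k where k: "k \<ge> 1"
          "pencil_retract m m V (jord m 0) k k (restr k) (jord k 0)" by blast
        from pencil_retract_trans[OF R pencil_retract_swap[OF this(2)]] k(1) show ?thesis by blast
      qed
      ultimately show ?thesis by blast
    qed
  qed
qed

section \<open>Idempotents of the standard pencils\<close>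

lemma std_pencil_lin: "std_pencil u y p q \<Longrightarrow> lin u y p \<and> lin u y q \<and> u + y > 0"
  by (induction rule: std_pencil.induct) (auto simp: lin_std)

theorem std_pencil_idempotent:
  fixes p q :: "(nat \<Rightarrow> 'k::field) \<Rightarrow> nat \<Rightarrow> 'k"
  assumes "std_pencil u y p q" and "pencil_hom u y p q u y p q eU eY"
    and "\<And>x. eU (eU x) = eU x" "\<And>x. eY (eY x) = eY x"
  shows "(\<forall>x. eU x = 0) \<and> (\<forall>x. eY x = 0) \<or> (\<forall>x. eU x = restr u x) \<and> (\<forall>x. eY x = restr y x)"
proof -
  \<comment> \<open>An idempotent of the field of scalars acting on one coordinate is \<open>0\<close> or \<open>1\<close>; replacing \<open>e\<close> by \<open>1 - e\<close>,
    it is enough to show that an idempotent with scalar \<open>0\<close> vanishes.\<close>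
  have dichotomy: ?thesis
    if key: "\<And>fU fY. pencil_hom u y p q u y p q fU fY \<Longrightarrow> (\<And>x. fU (fU x) = fU x) \<Longrightarrow> (\<And>x. fY (fY x) = fY x) \<Longrightarrow>
        (\<exists>c. c * c = c \<and> S c fU fY) \<and> (S 0 fU fY \<longrightarrow> (\<forall>x. fU x = 0) \<and> (\<forall>x. fY x = 0))"
      and compl: "\<And>fU fY. S 1 fU fY \<Longrightarrow> S 0 (\<lambda>x. restr u x - fU x) (\<lambda>x. restr y x - fY x)"
    for S :: "'k \<Rightarrow> ((nat \<Rightarrow> 'k) \<Rightarrow> nat \<Rightarrow> 'k) \<Rightarrow> ((nat \<Rightarrow> 'k) \<Rightarrow> nat \<Rightarrow> 'k) \<Rightarrow> bool"
  proof -
    obtain c where c: "c * c = c" "S c eU eY" using key[OF assms(2-4)] by blast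
    then have "c = 0 \<or> c = 1" by auto
    then show ?thesis
    proof
      assume "c = 0" then show ?thesis using key[OF assms(2-4)] c(2) by blast
    next
      assume "c = 1"
      let ?fU = "\<lambda>x. restr u x - eU x" and ?fY = "\<lambda>x. restr y x - eY x"
      have l: "lin u u eU" "lin y y eY" and com: "\<And>x. eY (p x) = p (eU x)" "\<And>x. eY (q x) = q (eU x)"
        using assms(2) unfolding pencil_hom_def by auto
      have pq: "lin u y p" "lin u y q" using std_pencil_lin[OF assms(1)] by auto
      note ls = lin_simps[OF l(1)] lin_simps[OF l(2)] lin_simps[OF pq(1)] lin_simps[OF pq(2)]
      have rd: "restr n (x - z) = restr n x - restr n z" for n and x z :: "nat \<Rightarrow> 'k"
        by (auto simp: restr_def fun_eq_iff)
      have "pencil_hom u y p q u y p q ?fU ?fY"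
        unfolding pencil_hom_def using l by (simp add: lin_minus ls com)
      moreover have "?fU (?fU x) = ?fU x" "?fY (?fY x) = ?fY x" for x
        using assms(3,4) by (simp_all add: ls rd)
      ultimately have "(\<forall>x. ?fU x = 0) \<and> (\<forall>x. ?fY x = 0)" using key compl c(2) \<open>c = 1\<close> by blast
      then show ?thesis by simp
    qed
  qed
  have sq: "c * c = c" if "\<And>x. e (e x) = e x" "\<And>x. e x i = c * x i" "z i \<noteq> 0"
    for e :: "(nat \<Rightarrow> 'k) \<Rightarrow> nat \<Rightarrow> 'k" and c i and z :: "nat \<Rightarrow> 'k"
  proof -
    have "c * (c * z i) = c * z i" using that(1)[of z] that(2)[of "e z"] that(2)[of z] by simp
    then show ?thesis using that(3) by simp
  qed
  consider (1) r where "u = Suc r" "y = r" "p = restr r" "q = shiftl r"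
    | (2) r where "u = r" "y = Suc r" "p = shiftr (Suc r)" "q = restr r"
    | (3) n lam where "u = n" "y = n" "p = restr n" "q = jord n lam" "n \<ge> 1"
    | (4) n where "u = n" "y = n" "p = shiftr n" "q = restr n" "n \<ge> 1"
    using assms(1) by cases auto
  then show ?thesis
  proof cases
    case (1 r)
    note [simp] = 1
    \<comment> \<open>The scalar is taken on the kernel of \<open>shiftl\<close>, a line that every
      endomorphism preserves.\<close>
    have c0: "x = (\<lambda>i. x 0 * unit 0 i)" if "restr (Suc r) x = x" "shiftl r x = 0" for x :: "nat \<Rightarrow> 'k"
    proof (rule ext)
      fix i
      show "x i = x 0 * unit 0 i"
        using fun_cong[OF that(2), of "i - 1"] fun_cong[OF that(1), of i] by (cases i) (auto simp: shiftl_def restr_def split: if_splits)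
    qed
    show ?thesis
    proof (rule dichotomy[of "\<lambda>c fU fY. fU (unit 0) = (\<lambda>i. c * unit 0 i)"])
      fix fU fY :: "(nat \<Rightarrow> 'k) \<Rightarrow> nat \<Rightarrow> 'k"
      assume h: "pencil_hom u y p q u y p q fU fY" and id: "\<And>x. fU (fU x) = fU x" "\<And>x. fY (fY x) = fY x"
      have l: "lin (Suc r) (Suc r) fU" "lin r r fY" and com: "\<And>x. fY (restr r x) = restr r (fU x)" "\<And>x. fY (shiftl r x) = shiftl r (fU x)"
        using h unfolding pencil_hom_def by auto
      have s0: "shiftl r (unit 0) = (0 :: nat \<Rightarrow> 'k)" by (auto simp: shiftl_def fun_eq_iff)
      have "shiftl r (fU (unit 0)) = 0" using com(2)[of "unit 0"] s0 lin_zero[OF l(2)] by simp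
      then have e: "fU (unit 0) = (\<lambda>i. fU (unit 0) 0 * unit 0 i)" by (intro c0 restr_lin[OF l(1)])
      have "fU (fU (unit 0)) = (\<lambda>i. fU (unit 0) 0 * fU (unit 0) i)" by (subst e) (rule lin_scale[OF l(1)])
      then have "fU (unit 0) 0 * fU (unit 0) 0 = fU (unit 0) 0" using id(1) by (metis)
      moreover have "(\<forall>x. fU x = 0) \<and> (\<forall>x. fY x = 0)" if z: "fU (unit 0) = (\<lambda>i. 0 * unit 0 i)"
      proof -
        have "fU (unit j) = 0" if "j < Suc r" for j
          using that
        proof (induction j)
          case 0 show ?case using z by (simp add: fun_eq_iff)
        next
          case (Suc j)
          have "shiftl r (unit (Suc j)) = (unit j :: nat \<Rightarrow> 'k)" "restr r (unit j) = (unit j :: nat \<Rightarrow> 'k)"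
            using Suc.prems by (auto simp: shiftl_def restr_def fun_eq_iff)
          then have "shiftl r (fU (unit (Suc j))) = fY (unit j)" "fY (unit j) = restr r (fU (unit j))"
            using com by metis+
          moreover have "fU (unit j) = 0" by (rule Suc.IH) (use Suc.prems in simp)
          ultimately have "shiftl r (fU (unit (Suc j))) = 0" by (simp only: restr_simps)
          \<comment> \<open>This image lies on the line of \<open>unit 0\<close>, which
            \<open>fU\<close> annihilates; applying \<open>fU\<close> again gives 0, and idempotence
            finishes.\<close>
          then have "fU (unit (Suc j)) = (\<lambda>i. fU (unit (Suc j)) 0 * unit 0 i)" by (intro c0 restr_lin[OF l(1)])
          then have "fU (fU (unit (Suc j))) = (\<lambda>i. fU (unit (Suc j)) 0 * fU (unit 0) i)"
            by (metis lin_scale[OF l(1)])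
          then show ?case using id(1) z by (simp add: fun_eq_iff)
        qed
        then have fU: "fU x = 0" for x using lin_eqI[OF l(1) lin_0] by metis
        have "fY x = 0" for x using com(1)[of x] lin_restr[OF l(2)] fU by simp
        then show ?thesis using fU by blast
      qed
      ultimately show "(\<exists>c. c * c = c \<and> fU (unit 0) = (\<lambda>i. c * unit 0 i)) \<and>
        (fU (unit 0) = (\<lambda>i. 0 * unit 0 i) \<longrightarrow> (\<forall>x. fU x = 0) \<and> (\<forall>x. fY x = 0))" using e by blast
    qed (auto simp: restr_def fun_eq_iff)
  next
    case (2 r)
    note [simp] = 2
    show ?thesis
    proof (rule dichotomy[of "\<lambda>c fU fY. \<forall>x. fY x 0 = c * x 0"])
      fix fU fY :: "(nat \<Rightarrow> 'k) \<Rightarrow> nat \<Rightarrow> 'k"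
      assume h: "pencil_hom u y p q u y p q fU fY" and id: "\<And>x. fU (fU x) = fU x" "\<And>x. fY (fY x) = fY x"
      have l: "lin r r fU" "lin (Suc r) (Suc r) fY" and com: "\<And>x. fY (shiftr (Suc r) x) = shiftr (Suc r) (fU x)" "\<And>x. fY (restr r x) = restr r (fU x)"
        using h unfolding pencil_hom_def by auto
      \<comment> \<open>A coordinate of \<open>fY\<close> that vanishes on the image of
        \<open>p\<close> factors through the cokernel of \<open>p\<close>, and that is coordinate
        0.\<close>
      have coord: "fY x i = fY (unit 0) i * x 0" if "\<And>x. fY (shiftr (Suc r) x) i = 0" for i x
      proof -
        have "restr (Suc r) x = (\<lambda>i. x 0 * unit 0 i) + shiftr (Suc r) (\<lambda>i. x (Suc i))"
          by (auto simp: restr_def shiftr_def fun_eq_iff)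
        then have "fY x = (\<lambda>i. x 0 * fY (unit 0) i) + fY (shiftr (Suc r) (\<lambda>i. x (Suc i)))"
          by (subst lin_restr[OF l(2), symmetric]) (simp only: lin_add[OF l(2)] lin_scale[OF l(2)])
        then show ?thesis using that by (simp add: mult.commute)
      qed
      have e: "fY x 0 = fY (unit 0) 0 * x 0" for x by (rule coord, subst com) (simp add: shiftr_def)
      moreover have "fY (unit 0) 0 * fY (unit 0) 0 = fY (unit 0) 0"
        by (rule sq[OF id(2) e, of "unit 0"]) simp
      moreover have "(\<forall>x. fU x = 0) \<and> (\<forall>x. fY x = 0)" if z: "\<forall>x. fY x 0 = 0 * x 0"
      proof -
        have *: "(\<forall>x. fY x i = 0) \<and> (i < r \<longrightarrow> (\<forall>x. fU x i = 0))" if "i < Suc r" for i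
          using that
        proof (induction i)
          case 0
          have "fU x 0 = 0" if "0 < r" for x using fun_cong[OF com(2)[of x], of 0] z that by (simp add: restr_def)
          then show ?case using z by simp
        next
          case (Suc i)
          \<comment> \<open>The vanishing of coordinate \<open>i\<close> of \<open>fU\<close> puts
            coordinate \<open>i + 1\<close> of \<open>fY\<close> into the situation of
            \<open>coord\<close>. Being a multiple of \<open>x 0\<close>, it is 0 at
            \<open>fY x\<close>, and idempotence transfers this to \<open>x\<close>.\<close>
          have "fY (shiftr (Suc r) x) (Suc i) = 0" for x using Suc by (subst com) (simp add: shiftr_def)
          then have e: "fY x (Suc i) = fY (unit 0) (Suc i) * x 0" for x by (rule coord)
          have "fY x (Suc i) = fY (unit 0) (Suc i) * fY x 0" for x using e[of "fY x"] unfolding id(2) .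
          then have f: "fY x (Suc i) = 0" for x using z by simp
          have "fU x (Suc i) = 0" if "Suc i < r" for x using fun_cong[OF com(2)[of x], of "Suc i"] f that by (simp add: restr_def)
          then show ?case using f by simp
        qed
        have "restr (Suc r) (fY x) = 0" "restr r (fU x) = 0" for x using * by (auto simp: restr_def fun_eq_iff)
        then show ?thesis by (simp add: restr_lin[OF l(1)] restr_lin[OF l(2)])
      qed
      ultimately show "(\<exists>c. c * c = c \<and> (\<forall>x. fY x 0 = c * x 0)) \<and>
        ((\<forall>x. fY x 0 = 0 * x 0) \<longrightarrow> (\<forall>x. fU x = 0) \<and> (\<forall>x. fY x = 0))" by blast
    qed (auto simp: restr_def)
  next
    case (3 n lam)
    note [simp] = 3(1-4)
    define d where "d = n - 1"
    have n: "n = Suc d" using 3(5) by (simp add: d_def)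
    show ?thesis
    proof (rule dichotomy[of "\<lambda>c fU fY. \<forall>x. fU x d = c * x d"])
      fix fU fY :: "(nat \<Rightarrow> 'k) \<Rightarrow> nat \<Rightarrow> 'k"
      assume h: "pencil_hom u y p q u y p q fU fY" and id: "\<And>x. fU (fU x) = fU x" "\<And>x. fY (fY x) = fY x"
      have l: "lin n n fU" "lin n n fY" and com: "\<And>x. fY (restr n x) = restr n (fU x)" "\<And>x. fY (jord n lam x) = jord n lam (fU x)"
        using h unfolding pencil_hom_def by auto
      have YU: "fY x = fU x" for x using com(1)[of x] by (simp add: lin_restr[OF l(2)] restr_lin[OF l(1)])
      \<comment> \<open>Endomorphisms of the block commute with its nilpotent part, whose cokernel
        is the last coordinate \<open>d\<close>; from here on the argument is that of the preceding
        case, with descending indices.\<close>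
      have sh: "fU (jord n 0 x) = jord n 0 (fU x)" for x
      proof -
        have j: "jord n lam x = (\<lambda>i. lam * restr n x i) + jord n 0 x" for x
          by (auto simp: jord_def restr_def fun_eq_iff)
        have "fU (jord n lam x) = jord n lam (fU x)" using com(2) YU by simp
        then have "(\<lambda>i. lam * fU x i) + fU (jord n 0 x) = (\<lambda>i. lam * fU x i) + jord n 0 (fU x)"
          unfolding j lin_add[OF l(1)] lin_scale[OF l(1)] lin_restr[OF l(1)] restr_lin[OF l(1)] .
        then show ?thesis by simp
      qed
      have coord: "fU x i = fU (unit d) i * x d" if "\<And>x. fU (jord n 0 x) i = 0" for i x
      proof -
        have "restr n x = (\<lambda>i. x d * unit d i) + jord n 0 (\<lambda>i. x (i - 1))"
          by (auto simp: restr_def jord_def fun_eq_iff n less_Suc_eq)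
        then have "fU x = (\<lambda>i. x d * fU (unit d) i) + fU (jord n 0 (\<lambda>i. x (i - 1)))"
          by (subst lin_restr[OF l(1), symmetric]) (simp only: lin_add[OF l(1)] lin_scale[OF l(1)])
        then show ?thesis using that by (simp add: mult.commute)
      qed
      have e: "fU x d = fU (unit d) d * x d" for x by (rule coord, subst sh) (simp add: jord_def n)
      moreover have "fU (unit d) d * fU (unit d) d = fU (unit d) d"
        by (rule sq[OF id(1) e, of "unit d"]) simp
      moreover have "(\<forall>x. fU x = 0) \<and> (\<forall>x. fY x = 0)" if z: "\<forall>x. fU x d = 0 * x d"
      proof -
        have *: "fU x (d - k) = 0" if "k \<le> d" for k x
          using that
        proof (induction k arbitrary: x)
          case 0
          then show ?case using z by simp
        next
          case (Suc k)
          have "fU (jord n 0 x) (d - Suc k) = 0" for x using Suc.IH[of x] Suc.prems by (subst sh) (simp add: jord_def n Suc_diff_Suc)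
          then have e: "fU x (d - Suc k) = fU (unit d) (d - Suc k) * x d" for x by (rule coord)
          have "fU x (d - Suc k) = fU (unit d) (d - Suc k) * fU x d" using e[of "fU x"] unfolding id(1) .
          then show ?case using z by simp
        qed
        have "fU x i = 0" if "i < n" for x i using *[of "d - i" x] that n by simp
        then have "restr n (fU x) = 0" for x by (auto simp: restr_def fun_eq_iff)
        then show ?thesis by (simp add: restr_lin[OF l(1)] YU)
      qed
      ultimately show "(\<exists>c. c * c = c \<and> (\<forall>x. fU x d = c * x d)) \<and>
        ((\<forall>x. fU x d = 0 * x d) \<longrightarrow> (\<forall>x. fU x = 0) \<and> (\<forall>x. fY x = 0))" by blast
    qed (auto simp: restr_def n)
  next
    case (4 n)
    note [simp] = 4(1-4)
    show ?thesis
    proof (rule dichotomy[of "\<lambda>c fU fY. \<forall>x. fU x 0 = c * x 0"])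
      fix fU fY :: "(nat \<Rightarrow> 'k) \<Rightarrow> nat \<Rightarrow> 'k"
      assume h: "pencil_hom u y p q u y p q fU fY" and id: "\<And>x. fU (fU x) = fU x" "\<And>x. fY (fY x) = fY x"
      have l: "lin n n fU" "lin n n fY" and com: "\<And>x. fY (shiftr n x) = shiftr n (fU x)" "\<And>x. fY (restr n x) = restr n (fU x)"
        using h unfolding pencil_hom_def by auto
      have YU: "fY x = fU x" for x using com(2)[of x] by (simp add: lin_restr[OF l(2)] restr_lin[OF l(1)])
      have sh: "fU (shiftr n x) = shiftr n (fU x)" for x using com(1) YU by simp
      have coord: "fU x i = fU (unit 0) i * x 0" if "\<And>x. fU (shiftr n x) i = 0" for i x
      proof -
        have "restr n x = (\<lambda>i. x 0 * unit 0 i) + shiftr n (\<lambda>i. x (Suc i))"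
          using 4(5) by (auto simp: restr_def shiftr_def fun_eq_iff)
        then have "fU x = (\<lambda>i. x 0 * fU (unit 0) i) + fU (shiftr n (\<lambda>i. x (Suc i)))"
          by (subst lin_restr[OF l(1), symmetric]) (simp only: lin_add[OF l(1)] lin_scale[OF l(1)])
        then show ?thesis using that by (simp add: mult.commute)
      qed
      have e: "fU x 0 = fU (unit 0) 0 * x 0" for x by (rule coord, subst sh) (simp add: shiftr_def)
      moreover have "fU (unit 0) 0 * fU (unit 0) 0 = fU (unit 0) 0"
        by (rule sq[OF id(1) e, of "unit 0"]) simp
      moreover have "(\<forall>x. fU x = 0) \<and> (\<forall>x. fY x = 0)" if z: "\<forall>x. fU x 0 = 0 * x 0"
      proof -
        have *: "fU x i = 0" if "i < n" for i x
          using that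
        proof (induction i arbitrary: x)
          case 0
          then show ?case using z by simp
        next
          case (Suc i)
          have "fU (shiftr n x) (Suc i) = 0" for x using Suc by (subst sh) (simp add: shiftr_def)
          then have e: "fU x (Suc i) = fU (unit 0) (Suc i) * x 0" for x by (rule coord)
          have "fU x (Suc i) = fU (unit 0) (Suc i) * fU x 0" using e[of "fU x"] unfolding id(1) .
          then show ?case using z by simp
        qed
        have "restr n (fU x) = 0" for x using * by (auto simp: restr_def fun_eq_iff)
        then show ?thesis by (simp add: restr_lin[OF l(1)] YU)
      qed
      ultimately show "(\<exists>c. c * c = c \<and> (\<forall>x. fU x 0 = c * x 0)) \<and>
        ((\<forall>x. fU x 0 = 0 * x 0) \<longrightarrow> (\<forall>x. fU x = 0) \<and> (\<forall>x. fY x = 0))" by blast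
    qed (use 4(5) in \<open>auto simp: restr_def\<close>)
  qed
qed

section \<open>Splitting off projectives\<close>

definition data_rel :: "nat \<Rightarrow> nat \<Rightarrow> ((nat \<Rightarrow> 'k::field) \<Rightarrow> nat \<Rightarrow> 'k) \<Rightarrow> ((nat \<Rightarrow> 'k) \<Rightarrow> nat \<Rightarrow> 'k) \<Rightarrow>
    ((nat \<Rightarrow> 'k) \<Rightarrow> nat \<Rightarrow> 'k) \<Rightarrow> ((nat \<Rightarrow> 'k) \<Rightarrow> nat \<Rightarrow> 'k) \<Rightarrow> bool" where
  "data_rel u y p q s t \<longleftrightarrow> lin u y p \<and> lin u y q \<and> lin y u s \<and> lin y u t \<and>
     (\<forall>x. p (s x) = q (t x) \<and> s (p x) = t (q x) \<and> t (p x) = 0 \<and> p (t x) = 0 \<and> s (q x) = 0 \<and> q (s x) = 0)"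

definition data_retract where
  "data_retract u y p q s t u' y' p' q' s' t' \<longleftrightarrow> (\<exists>fU fY gU gY. data_hom u' y' p' q' s' t' u y p q s t fU fY \<and>
     data_hom u y p q s t u' y' p' q' s' t' gU gY \<and> (\<forall>x. gU (fU x) = restr u' x) \<and> (\<forall>x. gY (fY x) = restr y' x))"

definition data_indec where
  "data_indec u y p q s t \<longleftrightarrow> u + y > 0 \<and> (\<forall>eU eY. data_hom u y p q s t u y p q s t eU eY \<longrightarrow>
     (\<forall>x. eU (eU x) = eU x) \<longrightarrow> (\<forall>x. eY (eY x) = eY x) \<longrightarrow>
     (\<forall>x. eU x = 0) \<and> (\<forall>x. eY x = 0) \<or> (\<forall>x. eU x = restr u x) \<and> (\<forall>x. eY x = restr y x))"

text \<open>Projectivity is formulated for quadruples so that the proof for M carries over to N by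
  the symmetry.\<close>

definition data_proj where
  "data_proj u0 y0 p0 q0 s0 t0 \<longleftrightarrow> (\<forall>u y p q s t u' y' p' q' s' t' fU fY gU gY.
     data_rel u y p q s t \<longrightarrow> data_hom u y p q s t u' y' p' q' s' t' fU fY \<longrightarrow>
     (\<forall>w. \<exists>v. fU v = restr u' w) \<longrightarrow> (\<forall>w. \<exists>v. fY v = restr y' w) \<longrightarrow>
     data_hom u0 y0 p0 q0 s0 t0 u' y' p' q' s' t' gU gY \<longrightarrow>
     (\<exists>hU hY. data_hom u0 y0 p0 q0 s0 t0 u y p q s t hU hY \<and> (\<forall>x. fU (hU x) = gU x) \<and> (\<forall>x. fY (hY x) = gY x)))"

text \<open>The relations are invariant under exchanging \<open>(U, p, q)\<close> with \<open>(Y, s, t)\<close>; this exchanges the data of \<open>M\<close> and \<open>N\<close>.\<close>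

lemma data_swap:
  "data_rel u y p q s t \<longleftrightarrow> data_rel y u s t p q"
  "data_hom u y p q s t u' y' p' q' s' t' fU fY \<longleftrightarrow> data_hom y u s t p q y' u' s' t' p' q' fY fU"
  "data_retract u y p q s t u' y' p' q' s' t' \<longleftrightarrow> data_retract y u s t p q y' u' s' t' p' q'"
  "data_indec u y p q s t \<longleftrightarrow> data_indec y u s t p q"
proof -
  show 1: "data_hom u y p q s t u' y' p' q' s' t' fU fY \<longleftrightarrow> data_hom y u s t p q y' u' s' t' p' q' fY fU"
    for u y p q s t u' y' p' q' s' t' fU fY
    unfolding data_hom_def by blast
  show "data_rel u y p q s t \<longleftrightarrow> data_rel y u s t p q" unfolding data_rel_def by auto
  show "data_retract u y p q s t u' y' p' q' s' t' \<longleftrightarrow> data_retract y u s t p q y' u' s' t' p' q'"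
    unfolding data_retract_def 1[of u y p q s t] 1[of u' y' p' q' s' t'] by blast
  show "data_indec u y p q s t \<longleftrightarrow> data_indec y u s t p q"
    unfolding data_indec_def 1[of u y p q s t] add.commute[of u y] by blast
qed

lemma data_proj_swap:
  assumes P: "data_proj u0 y0 p0 q0 s0 t0" shows "data_proj y0 u0 s0 t0 p0 q0"
  unfolding data_proj_def
proof (intro allI impI)
  fix u y p q s t u' y' p' q' s' t' fU fY gU gY
  assume a: "data_rel u y p q s t" "data_hom u y p q s t u' y' p' q' s' t' fU fY"
    "\<forall>w. \<exists>v. fU v = restr u' w" "\<forall>w. \<exists>v. fY v = restr y' w"
    "data_hom y0 u0 s0 t0 p0 q0 u' y' p' q' s' t' gU gY"
  from P[unfolded data_proj_def, rule_format, OF a(1)[unfolded data_swap(1)[of u]] a(2)[unfolded data_swap(2)[of u]] _ _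
      a(5)[unfolded data_swap(2)[of y0]]] a(3,4)
  obtain hU hY where "data_hom u0 y0 p0 q0 s0 t0 y u s t p q hU hY" "\<forall>x. fY (hU x) = gY x" "\<forall>x. fU (hY x) = gU x"
    by blast
  then show "\<exists>hU hY. data_hom y0 u0 s0 t0 p0 q0 u y p q s t hU hY \<and> (\<forall>x. fU (hU x) = gU x) \<and> (\<forall>x. fY (hY x) = gY x)"
    using data_swap(2)[of u0] by blast
qed

section \<open>The free quadruple on one generator\<close>

text \<open>The matrix unit E_ij, sending unit vector \<open>j\<close> to unit vector
  \<open>i\<close>.\<close>

definition el :: "nat \<Rightarrow> nat \<Rightarrow> (nat \<Rightarrow> 'k::field) \<Rightarrow> nat \<Rightarrow> 'k" where
  "el i j x = (\<lambda>l. if l = i then x j else 0)"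

lemma restr_one_eq_0: "restr n (\<lambda>_. 1 :: 'k::field) = 0 \<Longrightarrow> n = 0"
  by (rule ccontr) (drule fun_cong[of _ _ 0], simp add: restr_def)

lemma lin_el: "i < n \<Longrightarrow> j < m \<Longrightarrow> lin m n (el i j)"
  by (rule linI) (auto simp: el_def restr_def fun_eq_iff)

text \<open>The quadruple of M: U is spanned by \<open>x\<close> and \<open>s p x = t q x\<close>, Y
  by \<open>p x\<close> and \<open>q x\<close>. The relations annihilate all other nontrivial words
  applied to \<open>x\<close>, so this is the free quadruple on a generator in U.\<close>

lemma top_data_rel: "data_rel 2 2 (el 0 0) (el 1 0) (el 1 0) (el 1 1)"
  unfolding data_rel_def by (auto simp: lin_el el_def fun_eq_iff)

lemma less_2_cases_simp: "(i::nat) < 2 \<longleftrightarrow> i = 0 \<or> i = 1" by auto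

text \<open>The universal property of the free quadruple: its generator may be sent to any
  \<open>x\<close>.\<close>

lemma top_data_hom_exists:
  assumes D: "data_rel u y p q s t" and x: "restr u x = x"
  obtains fU fY where "data_hom 2 2 (el 0 0) (el 1 0) (el 1 0) (el 1 1) u y p q s t fU fY"
    "\<And>v. fU v = (\<lambda>i. v 0 * x i + v 1 * s (p x) i)" "\<And>v. fY v = (\<lambda>i. v 0 * p x i + v 1 * q x i)"
proof -
  have l: "lin u y p" "lin u y q" "lin y u s" "lin y u t"
    and r: "\<And>x. p (s x) = q (t x)" "\<And>x. s (p x) = t (q x)" "\<And>x. t (p x) = 0" "\<And>x. p (t x) = 0" "\<And>x. s (q x) = 0" "\<And>x. q (s x) = 0"
    using D unfolding data_rel_def by auto
  define fU where "fU v = (\<lambda>i. v 0 * x i) + (\<lambda>i. v 1 * s (p x) i)" for v :: "nat \<Rightarrow> 'a"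
  define fY where "fY v = (\<lambda>i. v 0 * p x i) + (\<lambda>i. v 1 * q x i)" for v :: "nat \<Rightarrow> 'a"
  note la = lin_simps(1,2)[OF l(1)] lin_simps(1,2)[OF l(2)] lin_simps(1,2)[OF l(3)] lin_simps(1,2)[OF l(4)]
  have rz: "p (s (p x)) = 0" "q (s (p x)) = 0" for x
    by (simp only: r(1)[of "p x"] r(3) lin_zero[OF l(2)], rule r(6))
  have "lin 2 u fU" "lin 2 y fY"
    by (rule linI; auto simp: fU_def fY_def fun_eq_iff algebra_simps restr_def[of 2] restr_scale x
      restr_lin[OF l(1)] restr_lin[OF l(2)] restr_lin[OF l(3)])+
  moreover have "fY (el 0 0 v) = p (fU v)" "fY (el 1 0 v) = q (fU v)" "fU (el 1 0 v) = s (fY v)" "fU (el 1 1 v) = t (fY v)" for v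
    unfolding fU_def fY_def la rz r(3,5) by (auto simp: fun_eq_iff el_def r(2)[symmetric])
  ultimately have "data_hom 2 2 (el 0 0) (el 1 0) (el 1 0) (el 1 1) u y p q s t fU fY" unfolding data_hom_def by blast
  then show thesis by (rule that) (simp_all add: fU_def fY_def fun_eq_iff)
qed

text \<open>The free quadruple is also coinduced: a functional \<phi> on U defines a map into it by
  \<open>v\<close> to \<open>(\<phi> (s p v), \<phi> v)\<close> on U and \<open>w\<close> to
  \<open>(\<phi> (s w), \<phi> (t w))\<close> on Y. This is a retraction as soon as
  \<open>\<phi> (s p x) = 1\<close> and \<open>\<phi> x = 0\<close>.\<close>

lemma top_retract:
  assumes D: "data_rel u y p q s t" and x: "s (p x) \<noteq> 0"
  shows "data_retract u y p q s t 2 2 (el 0 0) (el 1 0) (el 1 0) (el 1 1)"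
proof -
  have l: "lin u y p" "lin u y q" "lin y u s" "lin y u t"
    and r: "\<And>x. p (s x) = q (t x)" "\<And>x. s (p x) = t (q x)" "\<And>x. t (p x) = 0" "\<And>x. p (t x) = 0" "\<And>x. s (q x) = 0" "\<And>x. q (s x) = 0"
    using D unfolding data_rel_def by auto
  define x' where "x' = restr u x"
  have x': "restr u x' = x'" "s (p x') \<noteq> 0" using x by (simp_all add: x'_def lin_restr[OF l(1)])
  obtain fU fY where h: "data_hom 2 2 (el 0 0) (el 1 0) (el 1 0) (el 1 1) u y p q s t fU fY"
    and f: "\<And>v. fU v = (\<lambda>i. v 0 * x' i + v 1 * s (p x') i)" "\<And>v. fY v = (\<lambda>i. v 0 * p x' i + v 1 * q x' i)"
    using top_data_hom_exists[OF D x'(1)] by blast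
  obtain \<phi>0 where \<phi>0: "pairing u \<phi>0 (s (p x')) = 1"
    using exists_functional[OF _ x'(2)] restr_lin[OF l(3)] by blast
  \<comment> \<open>The correction makes \<phi> vanish at \<open>x'\<close>; the value at
    \<open>s (p x')\<close> stays 1 because \<open>s p s p = 0\<close>.\<close>
  define \<phi> where "\<phi> v = pairing u \<phi>0 v - pairing u \<phi>0 x' * pairing u \<phi>0 (s (p v))" for v
  note ls = lin_simps[OF l(1)] lin_simps[OF l(2)] lin_simps[OF l(3)] lin_simps[OF l(4)]
  have rz: "s (p (s z)) = 0" "s (p (t z)) = 0" for z using r ls by metis+
  have \<phi>s: "\<phi> (v + w) = \<phi> v + \<phi> w" "\<phi> (\<lambda>i. c * v i) = c * \<phi> v" "\<phi> (restr u v) = \<phi> v" "\<phi> 0 = 0" for v w c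
    by (simp_all add: \<phi>_def pairing_simps ls algebra_simps)
  have \<phi>x: "\<phi> x' = 0" "\<phi> (s (p x')) = 1" by (simp_all add: \<phi>_def \<phi>0 rz pairing_simps)
  define gU where "gU v = (\<lambda>i::nat. if i = 0 then \<phi> (s (p v)) else if i = 1 then \<phi> v else 0)" for v
  define gY where "gY w = (\<lambda>i::nat. if i = 0 then \<phi> (s w) else if i = 1 then \<phi> (t w) else 0)" for w
  have "lin u 2 gU" "lin y 2 gY"
    by (rule linI; auto simp: gU_def gY_def ls \<phi>s fun_eq_iff restr_def[of 2])+
  moreover have "gY (p v) = el 0 0 (gU v)" "gY (q v) = el 1 0 (gU v)" "gU (s v) = el 1 0 (gY v)" "gU (t v) = el 1 1 (gY v)" for v
    by (auto simp: gU_def gY_def el_def fun_eq_iff r(3,5) rz \<phi>s simp flip: r(2))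
  ultimately have h': "data_hom u y p q s t 2 2 (el 0 0) (el 1 0) (el 1 0) (el 1 1) gU gY" unfolding data_hom_def by blast
  have fU': "fU v = (\<lambda>i. v 0 * x' i) + (\<lambda>i. v 1 * s (p x') i)" and fY': "fY v = (\<lambda>i. v 0 * p x' i) + (\<lambda>i. v 1 * q x' i)" for v
    unfolding f by (simp_all add: fun_eq_iff)
  have "gU (fU v) = restr 2 v" "gY (fY v) = restr 2 v" for v
    unfolding gU_def gY_def fU' fY' ls(1,2,8,9,15,16,22,23) \<phi>s
    by (auto simp: \<phi>x rz r(3,5) \<phi>s restr_def less_2_cases_simp fun_eq_iff simp flip: r(2))
  then show ?thesis unfolding data_retract_def using h h' by blast
qed

text \<open>An endomorphism is determined by the image \<open>c0 x + d0 s p x\<close> of the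
  generator, so the endomorphisms are the dual numbers. Idempotence reads \<open>c0^2 = c0\<close>
  and \<open>d0 = 2 c0 d0\<close>, which forces \<open>d0 = 0\<close>.\<close>

lemma top_indec: "data_indec 2 2 (el 0 0) (el 1 0) (el 1 0) (el 1 1 :: (nat \<Rightarrow> 'k::field) \<Rightarrow> _)"
  unfolding data_indec_def
proof (intro conjI allI impI)
  fix eU eY :: "(nat \<Rightarrow> 'k) \<Rightarrow> nat \<Rightarrow> 'k"
  assume h: "data_hom 2 2 (el 0 0) (el 1 0) (el 1 0) (el 1 1) 2 2 (el 0 0) (el 1 0) (el 1 0) (el 1 1) eU eY"
    and id: "\<forall>x. eU (eU x) = eU x" "\<forall>x. eY (eY x) = eY x"
  have l: "lin 2 2 eU" "lin 2 2 eY" and c: "\<And>x. eY (el 0 0 x) = el 0 0 (eU x)" "\<And>x. eY (el 1 0 x) = el 1 0 (eU x)"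
    "\<And>x. eU (el 1 0 x) = el 1 0 (eY x)"
    using h unfolding data_hom_def by auto
  define c0 d0 where "c0 = eU (unit 0) 0" and "d0 = eU (unit 0) 1"
  have e10: "el 1 0 (el 0 0 (unit 0)) = (unit 1 :: nat \<Rightarrow> 'k)" "el 0 0 (unit 0) = (unit 0 :: nat \<Rightarrow> 'k)" "el 1 0 (unit 0) = (unit 1 :: nat \<Rightarrow> 'k)"
    by (auto simp: el_def fun_eq_iff)
  have ex: "restr 2 x = (\<lambda>i. x 0 * unit 0 i) + (\<lambda>i. x 1 * unit 1 i)" for x :: "nat \<Rightarrow> 'k"
    by (auto simp: restr_def fun_eq_iff less_2_cases_simp)
  have e0: "eU (unit 0) = (\<lambda>i. c0 * unit 0 i) + (\<lambda>i. d0 * unit 1 i)"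
    using ex[of "eU (unit 0)"] by (simp add: restr_lin[OF l(1)] c0_def d0_def)
  have "eU (unit 1) = el 1 0 (el 0 0 (eU (unit 0)))" using c(1)[of "unit 0"] c(3)[of "unit 0"] e10 by simp
  then have e1: "eU (unit 1) = (\<lambda>i. c0 * unit 1 i)" unfolding c0_def by (auto simp: el_def fun_eq_iff)
  have f0: "eY (unit 0) = (\<lambda>i. c0 * unit 0 i)" "eY (unit 1) = (\<lambda>i. c0 * unit 1 i)"
    using c(1)[of "unit 0"] c(2)[of "unit 0"] e10 unfolding c0_def by (auto simp: el_def fun_eq_iff)
  have "eU (eU (unit 0)) = (\<lambda>i. c0 * eU (unit 0) i) + (\<lambda>i. d0 * eU (unit 1) i)"
    using arg_cong[OF e0, of eU] unfolding lin_add[OF l(1)] lin_scale[OF l(1)] .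
  then have "eU (unit 0) i = c0 * eU (unit 0) i + d0 * eU (unit 1) i" for i
    using id(1) by (simp add: fun_eq_iff)
  from this[of 0] this[of 1] have cd: "c0 * c0 = c0" "d0 = c0 * d0 + d0 * c0" using e1 by (auto simp: c0_def d0_def)
  then have c01: "c0 = 0 \<or> c0 = 1" by auto
  moreover have "d0 = 0" if "c0 = 1"
  proof -
    have "d0 + d0 = d0 + 0" using cd(2) that by simp
    then show ?thesis by (rule add_left_imp_eq)
  qed
  ultimately have "d0 = 0" using cd(2) by auto
  then have eU: "eU x = (\<lambda>i. c0 * restr 2 x i)" for x
    unfolding ex using arg_cong[OF ex[of x], of eU]
    by (simp add: lin_restr[OF l(1)] lin_add[OF l(1)] lin_scale[OF l(1)] e0 e1 fun_eq_iff algebra_simps del: One_nat_def)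
  have eY: "eY x = (\<lambda>i. c0 * restr 2 x i)" for x
    unfolding ex using arg_cong[OF ex[of x], of eY]
    by (simp add: lin_restr[OF l(2)] lin_add[OF l(2)] lin_scale[OF l(2)] f0 fun_eq_iff algebra_simps del: One_nat_def)
  show "(\<forall>x. eU x = 0) \<and> (\<forall>x. eY x = 0) \<or> (\<forall>x. eU x = restr 2 x) \<and> (\<forall>x. eY x = restr 2 x)"
    using c01 unfolding eU eY by (auto simp: fun_eq_iff)
qed simp

text \<open>Free objects are projective: the generator goes to a preimage of its image.\<close>

lemma top_proj: "data_proj 2 2 (el 0 0) (el 1 0) (el 1 0) (el 1 1 :: (nat \<Rightarrow> 'k::field) \<Rightarrow> _)"
  unfolding data_proj_def
proof (intro allI impI)
  fix u y u' y' :: nat and p q s t p' q' s' t' fU fY gU gY :: "(nat \<Rightarrow> 'k) \<Rightarrow> nat \<Rightarrow> 'k"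
  assume D: "data_rel u y p q s t" and f: "data_hom u y p q s t u' y' p' q' s' t' fU fY"
    and surj: "\<forall>w. \<exists>v. fU v = restr u' w" and g: "data_hom 2 2 (el 0 0) (el 1 0) (el 1 0) (el 1 1) u' y' p' q' s' t' gU gY"
  have l: "lin 2 u' gU" "lin 2 y' gY" "lin u u' fU" "lin y y' fY" using f g unfolding data_hom_def by auto
  obtain x where x: "restr u x = x" "fU x = gU (unit 0)"
  proof -
    obtain v where "fU v = gU (unit 0)" using surj restr_lin[OF l(1)] by metis
    then show thesis using that[of "restr u v"] lin_restr[OF l(3)] by simp
  qed
  obtain hU hY where h: "data_hom 2 2 (el 0 0) (el 1 0) (el 1 0) (el 1 1) u y p q s t hU hY"
    and hU: "\<And>v. hU v = (\<lambda>i. v 0 * x i + v 1 * s (p x) i)" "\<And>v. hY v = (\<lambda>i. v 0 * p x i + v 1 * q x i)"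
    using top_data_hom_exists[OF D x(1)] by blast
  have lh: "lin 2 u hU" "lin 2 y hY" using h unfolding data_hom_def by auto
  have e10: "el 0 0 (unit 0) = (unit 0 :: nat \<Rightarrow> 'k)" "el 1 0 (unit 0) = (unit 1 :: nat \<Rightarrow> 'k)"
    by (auto simp: el_def fun_eq_iff)
  have com: "fY (p z) = p' (fU z)" "fY (q z) = q' (fU z)" "fU (s z) = s' (fY z)" for z
    using f unfolding data_hom_def by auto
  have gc: "gY (el 0 0 z) = p' (gU z)" "gY (el 1 0 z) = q' (gU z)" "gU (el 1 0 z) = s' (gY z)" for z
    using g unfolding data_hom_def by auto
  have h0: "hU (unit 0) = x" "hU (unit 1) = s (p x)" "hY (unit 0) = p x" "hY (unit 1) = q x"
    unfolding hU by simp_all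
  have g1: "gY (unit 0) = p' (gU (unit 0))" "gY (unit 1) = q' (gU (unit 0))" "gU (unit 1) = s' (p' (gU (unit 0)))"
    using gc(1)[of "unit 0"] gc(2)[of "unit 0"] gc(3)[of "unit 0"] e10 by auto
  have e1: "fU (hU (unit j)) = gU (unit j)" if "j < 2" for j
    using that h0 x(2) g1 com by (auto simp: less_2_cases_simp)
  have e2: "fY (hY (unit j)) = gY (unit j)" if "j < 2" for j
    using that h0 x(2) g1 com by (auto simp: less_2_cases_simp)
  have "(\<lambda>x. fU (hU x)) = gU" "(\<lambda>x. fY (hY x)) = gY"
    by (rule lin_eqI[OF lin_comp[OF l(3) lh(1)] l(1) e1] lin_eqI[OF lin_comp[OF l(4) lh(2)] l(2) e2]; assumption)+
  then show "\<exists>hU hY. data_hom 2 2 (el 0 0) (el 1 0) (el 1 0) (el 1 1) u y p q s t hU hY \<and> (\<forall>x. fU (hU x) = gU x) \<and> (\<forall>x. fY (hY x) = gY x)"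
    using h by metis
qed

section \<open>From quadruples back to modules\<close>

definition has_frame where
  "has_frame X u y p q s t \<longleftrightarrow> (\<exists>k0 k1 k2 k3 h0 h1 h2 h3. frame X u y p q s t k0 k1 k2 k3 h0 h1 h2 h3)"

lemma has_frame_rel: "has_frame X u y p q s t \<Longrightarrow> data_rel u y p q s t"
  unfolding has_frame_def data_rel_def by (meson frame.lin_data frame.rel)

lemma has_frame_umod: "has_frame X u y p q s t \<Longrightarrow> is_umod X"
  unfolding has_frame_def using frame.umod by blast

text \<open>Both maps of quadruples are lifted, and their composite agrees with the identity because
  it does so on X0 and X1.\<close>

lemma frame_retract:
  assumes "has_frame X u y p q s t" "has_frame L u' y' p' q' s' t'"
    and R: "data_retract u y p q s t u' y' p' q' s' t'"
  shows "\<exists>f g. hm L X f \<and> hm X L g \<and> (\<forall>x. g (f x) = restr (rdim L) x)"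
proof -
  obtain k0 k1 k2 k3 h0 h1 h2 h3 where F: "frame X u y p q s t k0 k1 k2 k3 h0 h1 h2 h3"
    using assms(1) unfolding has_frame_def by blast
  obtain k0' k1' k2' k3' h0' h1' h2' h3' where G: "frame L u' y' p' q' s' t' k0' k1' k2' k3' h0' h1' h2' h3'"
    using assms(2) unfolding has_frame_def by blast
  interpret F: frame X u y p q s t k0 k1 k2 k3 h0 h1 h2 h3 by (rule F)
  interpret G: frame L u' y' p' q' s' t' k0' k1' k2' k3' h0' h1' h2' h3' by (rule G)
  interpret FG: two_frames X u y p q s t k0 k1 k2 k3 h0 h1 h2 h3 L u' y' p' q' s' t' k0' k1' k2' k3' h0' h1' h2' h3' ..
  interpret GF: two_frames L u' y' p' q' s' t' k0' k1' k2' k3' h0' h1' h2' h3' X u y p q s t k0 k1 k2 k3 h0 h1 h2 h3 ..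
  interpret GG: two_frames L u' y' p' q' s' t' k0' k1' k2' k3' h0' h1' h2' h3' L u' y' p' q' s' t' k0' k1' k2' k3' h0' h1' h2' h3' ..
  obtain fU fY gU gY where f: "GF.dhom fU fY" and g: "FG.dhom gU gY"
    and gf: "\<And>x. gU (fU x) = restr u' x" "\<And>x. gY (fY x) = restr y' x"
    using R unfolding data_retract_def by blast
  let ?f = "GF.lift fU fY" and ?g = "FG.lift gU gY"
  have hf: "hm L X ?f" and hg: "hm X L ?g" using GF.lift_hm[OF f] FG.lift_hm[OF g] by auto
  have "?g (?f x) = restr (rdim L) x" for x
    by (rule GG.hm_eqI[OF hm_comp[OF hf hg] hm_id[OF G.wf]])
      (simp_all add: GF.lift_k[OF f] FG.lift_k[OF g] gf G.lrestr)
  then show ?thesis using hf hg by blast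
qed

text \<open>An idempotent endomorphism maps X0 and X1 to themselves, so it induces a pair of
  idempotents on U and Y; if that pair is 0 or the identity, so is the endomorphism.\<close>

lemma frame_indecomposable:
  fixes L :: "'k::field rep"
  assumes "has_frame L u y p q s t" and I: "data_indec u y p q s t"
  shows "indecomposable L"
proof -
  obtain k0 k1 k2 k3 h0 h1 h2 h3 where F: "frame L u y p q s t k0 k1 k2 k3 h0 h1 h2 h3"
    using assms(1) unfolding has_frame_def by blast
  interpret F: frame L u y p q s t k0 k1 k2 k3 h0 h1 h2 h3 by (rule F)
  interpret FF: two_frames L u y p q s t k0 k1 k2 k3 h0 h1 h2 h3 L u y p q s t k0 k1 k2 k3 h0 h1 h2 h3 ..
  show ?thesis
  proof (rule indecomposableI)
    show "is_umod L" by (rule F.umod)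
    show "rdim L > 0"
    proof (rule ccontr)
      assume "\<not> rdim L > 0"
      then have 0: "rdim L = 0" by simp
      have "k0 x = 0" "k1 x = 0" for x using restr_lin[OF F.lin_k(1), of x] restr_lin[OF F.lin_k(2), of x] 0 by simp_all
      then have "restr u x = 0" "restr y x = 0" for x :: "nat \<Rightarrow> 'k" using F.hk(1,2)[of x] F.ladd by simp_all
      then have "u = 0" "y = 0" by (auto intro: restr_one_eq_0)
      then show False using I unfolding data_indec_def by simp
    qed
    fix e assume e: "hm L L e" and id: "\<And>x. e (e x) = e x"
    let ?U = "\<lambda>x. h0 (e (k0 x))" and ?Y = "\<lambda>x. h1 (e (k1 x))"
    have d: "data_hom u y p q s t u y p q s t ?U ?Y" using FF.hm_data_hom[OF e] .
    have fk: "k0 (h0 (e (k0 x))) = e (k0 x)" "k1 (h1 (e (k1 x))) = e (k1 x)" for x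
      using FF.hm_k[OF e, of x] by simp_all
    have "?U (?U x) = ?U x" "?Y (?Y x) = ?Y x" for x by (simp_all add: fk id)
    with d I have alt: "(\<forall>x. ?U x = 0) \<and> (\<forall>x. ?Y x = 0) \<or> (\<forall>x. ?U x = restr u x) \<and> (\<forall>x. ?Y x = restr y x)"
      unfolding data_indec_def by blast
    have hz: "hm L L (\<lambda>_. 0)" unfolding hm_def using F.wf by (simp add: F.ladd)
    from alt show "(\<forall>x. e x = 0) \<or> (\<forall>x. e x = restr (rdim L) x)"
    proof
      assume z: "(\<forall>x. ?U x = 0) \<and> (\<forall>x. ?Y x = 0)"
      then have "e (k0 x) = 0" "e (k1 x) = 0" for x using fk[of x] by (simp_all add: F.ladd)
      then have "e x = 0" for x using FF.hm_eqI[OF e hz] by blast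
      then show ?thesis by blast
    next
      assume z: "(\<forall>x. ?U x = restr u x) \<and> (\<forall>x. ?Y x = restr y x)"
      have "e x = restr (rdim L) x" for x
      proof (rule FF.hm_eqI[OF e hm_id[OF F.wf]])
        show "e (k0 x) = restr (rdim L) (k0 x)" for x
          using fk(1)[of x] z by (simp only: F.lrestr)
        show "e (k1 x) = restr (rdim L) (k1 x)" for x
          using fk(2)[of x] z by (simp only: F.lrestr)
      qed
      then show ?thesis by blast
    qed
  qed
qed

text \<open>A lifting problem for modules induces one for quadruples. Surjectivity passes to U and Y
  because \<open>f\<close> is the lift of its restrictions to X0 and X1.\<close>

lemma frame_projective:
  fixes P :: "'k::field rep"
  assumes char: "CHAR('k) = 2" and "has_frame P u0 y0 p0 q0 s0 t0" and proj: "data_proj u0 y0 p0 q0 s0 t0"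
  shows "projective_mod P"
  unfolding projective_mod_def
proof (intro conjI allI impI)
  show "is_umod P" using has_frame_umod assms(2) .
  fix X Y :: "'k rep" and f g
  assume a: "is_umod X \<and> is_umod Y \<and> is_hom X Y f \<and> surj_mat f \<and> is_hom P Y g"
  obtain k0 k1 k2 k3 h0 h1 h2 h3 where G: "frame P u0 y0 p0 q0 s0 t0 k0 k1 k2 k3 h0 h1 h2 h3"
    using assms(2) unfolding has_frame_def by blast
  obtain u y p q s t l0 l1 l2 l3 i0 i1 i2 i3 where FX: "frame X u y p q s t l0 l1 l2 l3 i0 i1 i2 i3"
    using umod_has_frame[OF char] a by blast
  obtain u' y' p' q' s' t' l0' l1' l2' l3' i0' i1' i2' i3' where FY: "frame Y u' y' p' q' s' t' l0' l1' l2' l3' i0' i1' i2' i3'"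
    using umod_has_frame[OF char] a by blast
  interpret G: frame P u0 y0 p0 q0 s0 t0 k0 k1 k2 k3 h0 h1 h2 h3 by (rule G)
  interpret FX: frame X u y p q s t l0 l1 l2 l3 i0 i1 i2 i3 by (rule FX)
  interpret FY: frame Y u' y' p' q' s' t' l0' l1' l2' l3' i0' i1' i2' i3' by (rule FY)
  interpret PX: two_frames P u0 y0 p0 q0 s0 t0 k0 k1 k2 k3 h0 h1 h2 h3 X u y p q s t l0 l1 l2 l3 i0 i1 i2 i3 ..
  interpret PY: two_frames P u0 y0 p0 q0 s0 t0 k0 k1 k2 k3 h0 h1 h2 h3 Y u' y' p' q' s' t' l0' l1' l2' l3' i0' i1' i2' i3' ..
  interpret XY: two_frames X u y p q s t l0 l1 l2 l3 i0 i1 i2 i3 Y u' y' p' q' s' t' l0' l1' l2' l3' i0' i1' i2' i3' ..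
  have fc: "f \<in> carrier_mat (rdim Y) (rdim X)" and gc: "g \<in> carrier_mat (rdim Y) (rdim P)"
    using a by (auto simp: is_hom_def split: prod.splits)
  have hf: "hm X Y (act f)" and hg: "hm P Y (act g)" using a is_hom_imp_hm by blast+
  have surj: "\<exists>v. act f v = restr (rdim Y) w" for w
  proof -
    have "vec (rdim Y) w \<in> carrier_vec (dim_row f)" using fc by simp
    then obtain v where v: "v \<in> carrier_vec (dim_col f)" "f *\<^sub>v v = vec (rdim Y) w"
      using a unfolding surj_mat_def by blast
    have "act f (\<lambda>j. v $ j) = restr (rdim Y) w"
    proof (rule ext)
      fix i
      show "act f (\<lambda>j. v $ j) i = restr (rdim Y) w i"
        using arg_cong[OF v(2), of "\<lambda>x. x $ i"] v(1) fc
        by (cases "i < rdim Y") (auto simp: act_def restr_def scalar_prod_def lessThan_atLeast0)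
    qed
    then show ?thesis by blast
  qed
  let ?fU = "\<lambda>x. i0' (act f (l0 x))" and ?fY = "\<lambda>x. i1' (act f (l1 x))"
  let ?gU = "\<lambda>x. i0' (act g (k0 x))" and ?gY = "\<lambda>x. i1' (act g (k1 x))"
  have df: "XY.dhom ?fU ?fY" and dg: "PY.dhom ?gU ?gY" using XY.hm_data_hom[OF hf] PY.hm_data_hom[OF hg] by auto
  have fl: "act f v = XY.lift ?fU ?fY v" for v
    by (rule XY.hm_eqI[OF hf XY.lift_hm[OF df]]) (simp_all add: XY.lift_k[OF df] flip: XY.hm_k[OF hf])
  have ldf: "lin u u' ?fU" "lin y y' ?fY" using df unfolding data_hom_def by auto
  have "\<exists>v. ?fU v = restr u' w" for w
  proof -
    obtain v where "act f v = restr (rdim Y) (l0' w)" using surj by blast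
    then have v: "act f v = l0' w" by (simp add: FY.lrestr)
    have "i0' (act f v) = ?fU (i0 v)"
      by (subst fl) (simp add: XY.lift_def FY.ladd FY.hk FY.hk0 restr_lin[OF ldf(1)])
    then show ?thesis using v by (metis FY.hk(1))
  qed
  moreover have "\<exists>v. ?fY v = restr y' w" for w
  proof -
    obtain v where "act f v = restr (rdim Y) (l1' w)" using surj by blast
    then have v: "act f v = l1' w" by (simp add: FY.lrestr)
    have "i1' (act f v) = ?fY (i1 v)"
      by (subst fl) (simp add: XY.lift_def FY.ladd FY.hk FY.hk0 restr_lin[OF ldf(2)])
    then show ?thesis using v by (metis FY.hk(2))
  qed
  moreover have "data_rel u y p q s t" using FX has_frame_rel unfolding has_frame_def by blast
  ultimately obtain hU hY where h: "PX.dhom hU hY" and fh: "\<And>x. ?fU (hU x) = ?gU x" "\<And>x. ?fY (hY x) = ?gY x"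
    using proj[unfolded data_proj_def, rule_format, OF _ df _ _ dg] by blast
  let ?h = "PX.lift hU hY"
  have hh: "hm P X ?h" using PX.lift_hm[OF h] .
  have e: "act f (?h x) = act g x" for x
    by (rule PY.hm_eqI[OF hm_comp[OF hh hf] hg])
      (simp_all add: PX.lift_k[OF h], (subst XY.hm_k[OF hf], subst PY.hm_k[OF hg], simp add: fh)+)
  let ?H = "mat_of (rdim P) (rdim X) ?h"
  have lh: "lin (rdim P) (rdim X) ?h" using hh unfolding hm_def by blast
  have "f * ?H = g"
    by (rule act_eqD[OF mult_carrier_mat[OF fc mat_of_carrier] gc])
      (use fc in \<open>simp add: act_mult act_mat_of[OF lh] e carrier_matD[OF mat_of_carrier]\<close>)
  then show "\<exists>h. is_hom P X h \<and> f * h = g" using hm_imp_is_hom[OF hh] by blast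
qed

text \<open>In the second form the pencil goes from Y to U, with \<open>t\<close> as its first and
  \<open>s\<close> as its second map. This is the order in \<open>B_band\<close>, where
  \<open>t = a^3\<close> is the identity and \<open>s = b\<close> the Jordan block.\<close>

lemma pencil_data_retract:
  assumes "pencil_retract u y p q u' y' p' q'"
  shows "data_retract u y p q (\<lambda>_. 0) (\<lambda>_. 0) u' y' p' q' (\<lambda>_. 0) (\<lambda>_. 0)"
    "data_retract y u (\<lambda>_. 0) (\<lambda>_. 0) q p y' u' (\<lambda>_. 0) (\<lambda>_. 0) q' p'"
proof -
  obtain fU fY gU gY where 1: "pencil_hom u' y' p' q' u y p q fU fY" "pencil_hom u y p q u' y' p' q' gU gY"
    "\<And>x. gU (fU x) = restr u' x" "\<And>x. gY (fY x) = restr y' x"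
    using assms unfolding pencil_retract_def by blast
  have l: "lin u' u fU" "lin y' y fY" "lin u u' gU" "lin y y' gY" using 1(1,2) unfolding pencil_hom_def by auto
  note z = lin_zero[OF l(1)] lin_zero[OF l(2)] lin_zero[OF l(3)] lin_zero[OF l(4)]
  show "data_retract u y p q (\<lambda>_. 0) (\<lambda>_. 0) u' y' p' q' (\<lambda>_. 0) (\<lambda>_. 0)"
    unfolding data_retract_def data_hom_def using 1 z unfolding pencil_hom_def by blast
  show "data_retract y u (\<lambda>_. 0) (\<lambda>_. 0) q p y' u' (\<lambda>_. 0) (\<lambda>_. 0) q' p'"
    unfolding data_retract_def data_hom_def using 1 z unfolding pencil_hom_def by blast
qed

lemma std_pencil_data_indec:
  assumes "std_pencil u y p q"
  shows "data_indec u y p q (\<lambda>_. 0) (\<lambda>_. 0)" "data_indec y u (\<lambda>_. 0) (\<lambda>_. 0) q p"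
proof -
  have "u + y > 0" using std_pencil_lin[OF assms] by blast
  then show "data_indec u y p q (\<lambda>_. 0) (\<lambda>_. 0)" "data_indec y u (\<lambda>_. 0) (\<lambda>_. 0) q p"
    unfolding data_indec_def data_hom_def using std_pencil_idempotent[OF assms] unfolding pencil_hom_def by auto
qed

text \<open>The conclusion quantifies over all \<open>L\<close> with a given quadruple; the listed
  modules are inserted later by exhibiting their frames.\<close>

theorem indecomposable_cases:
  fixes X :: "'k::alg_closed_field rep"
  assumes char: "CHAR('k) = 2" and X: "indecomposable X"
  shows "(\<forall>L. has_frame L 2 2 (el 0 0) (el 1 0) (el 1 0) (el 1 1) \<longrightarrow> mod_iso X L) \<or>
    (\<forall>L. has_frame L 2 2 (el 1 0) (el 1 1) (el 0 0) (el 1 0) \<longrightarrow> mod_iso X L) \<or>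
    (\<exists>u y p q. std_pencil u y p q \<and> ((\<forall>L. has_frame L u y p q (\<lambda>_. 0) (\<lambda>_. 0) \<longrightarrow> mod_iso X L) \<or>
       (\<forall>L. has_frame L y u (\<lambda>_. 0) (\<lambda>_. 0) q p \<longrightarrow> mod_iso X L)))"
proof -
  have uX: "is_umod X" using X unfolding indecomposable_def by blast
  obtain u y p q s t k0 k1 k2 k3 h0 h1 h2 h3 where F: "frame X u y p q s t k0 k1 k2 k3 h0 h1 h2 h3"
    using umod_has_frame[OF char uX] by blast
  interpret F: frame X u y p q s t k0 k1 k2 k3 h0 h1 h2 h3 by (rule F)
  interpret FF: two_frames X u y p q s t k0 k1 k2 k3 h0 h1 h2 h3 X u y p q s t k0 k1 k2 k3 h0 h1 h2 h3 ..
  have hF: "has_frame X u y p q s t" using F unfolding has_frame_def by blast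
  have D: "data_rel u y p q s t" using has_frame_rel[OF hF] .
  have iso: "mod_iso X L" if "has_frame L u' y' p' q' s' t'" "data_retract u y p q s t u' y' p' q' s' t'"
    "data_indec u' y' p' q' s' t'" for L u' y' p' q' s' t'
  proof -
    have "rdim L > 0" using frame_indecomposable[OF that(1,3)] unfolding indecomposable_def by blast
    then show ?thesis using frame_retract[OF hF that(1,2)] indecomposable_retract[OF X] by blast
  qed
  consider x where "s (p x) \<noteq> 0" | x where "p (s x) \<noteq> 0" | "\<And>x. s (p x) = 0" "\<And>x. p (s x) = 0" by blast
  then show ?thesis
  proof cases
    case 1
    show ?thesis using iso[OF _ top_retract[OF D 1] top_indec] by blast
  next
    case 2
    have "data_rel y u s t p q" using D data_swap(1) by blast
    from top_retract[OF this 2] have "data_retract u y p q s t 2 2 (el 1 0) (el 1 1) (el 0 0) (el 1 0)"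
      using data_swap(3) by blast
    moreover have "data_indec 2 2 (el 1 0) (el 1 1) (el 0 0) (el 1 0 :: (nat \<Rightarrow> 'k) \<Rightarrow> _)"
      using top_indec data_swap(4) by blast
    ultimately show ?thesis using iso by blast
  next
    case 3
    note l = F.lin_data
    note z = 3 F.rel(3-6)
    have z': "q (t x) = 0" "t (q x) = 0" for x using F.rel(1,2) 3 by simp_all
    define f1 where "f1 v = glue y (p v) (q v)" for v
    define f2 where "f2 w = glue u (s w) (t w)" for w
    have lglue: "lin n (m + m) (\<lambda>v. glue m (f v) (g v))" if "lin n m f" "lin n m g" for n m and f g :: "(nat \<Rightarrow> 'k) \<Rightarrow> nat \<Rightarrow> 'k"
    proof (rule linI)
      show "restr (m + m) (glue m (f x) (g x)) = glue m (f x) (g x)" for x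
      proof -
        have zz: "g x j = 0" if "\<not> j < m" for j
          using fun_cong[OF restr_lin[OF \<open>lin n m g\<close>, of x], of j] that by (simp add: restr_def)
        show ?thesis by (auto simp: glue_def restr_def fun_eq_iff intro!: zz)
      qed
    qed (auto simp: glue_def fun_eq_iff lin_simps[OF that(1)] lin_simps[OF that(2)])
    have lf: "lin u (y + y) f1" "lin y (u + u) f2" unfolding f1_def f2_def by (rule lglue[OF l(1,2)], rule lglue[OF l(3,4)])
    have glI: "x = x' \<and> w = w'" if "glue m x w = glue m x' w'" "restr m x = x" "restr m x' = x'" for m and x w x' w' :: "nat \<Rightarrow> 'k"
    proof
      show "w = w'" using fun_cong[OF that(1), of "m + i" for i] by (auto simp: glue_def fun_eq_iff)
      have "restr m x = restr m x'" using that(1) by (auto simp: glue_def restr_def fun_eq_iff split: if_splits)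
      then show "x = x'" using that(2,3) by simp
    qed
    have gl0: "glue m 0 0 = (0 :: nat \<Rightarrow> 'k)" for m by (auto simp: glue_def fun_eq_iff)
    obtain g1 where g1: "lin (y + y) u g1" "\<And>v. f1 (g1 (f1 v)) = f1 v" using generalized_inverse[OF lf(1)] by metis
    obtain g2 where g2: "lin (u + u) y g2" "\<And>v. f2 (g2 (f2 v)) = f2 v" using generalized_inverse[OF lf(2)] by metis
    \<comment> \<open>\<open>eU\<close> projects onto the common kernel of \<open>p\<close> and
      \<open>q\<close>, and \<open>eY\<close> is a projection along the common kernel of
      \<open>s\<close> and \<open>t\<close>. The images of \<open>s, t\<close> lie in the former and
      those of \<open>p, q\<close> in the latter, so \<open>eU s = s = s eY\<close> and
      \<open>eY p = 0 = p eU\<close>, likewise for \<open>t\<close> and \<open>q\<close>. If this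
      endomorphism is 0 then \<open>s = t = 0\<close>; if it is the identity then
      \<open>p = q = 0\<close>.\<close>
    define eU where "eU v = restr u v - g1 (f1 v)" for v
    define eY where "eY w = g2 (f2 w)" for w
    have pg: "p (g1 (f1 v)) = p v" "q (g1 (f1 v)) = q v" for v
      using glI[OF g1(2)[of v, unfolded f1_def], folded f1_def] restr_lin[OF l(1)] by auto
    have sg: "s (g2 (f2 v)) = s v" "t (g2 (f2 v)) = t v" for v
      using glI[OF g2(2)[of v, unfolded f2_def], folded f2_def] restr_lin[OF l(3)] by auto
    have leU: "lin u u eU" unfolding eU_def by (intro lin_minus lin_id lin_comp[OF g1(1) lf(1)])
    have leY: "lin y y eY" unfolding eY_def by (intro lin_comp[OF g2(1) lf(2)])
    have peU: "p (eU v) = 0" "q (eU v) = 0" for v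
      unfolding eU_def lin_diff[OF l(1)] lin_diff[OF l(2)] lin_restr[OF l(1)] lin_restr[OF l(2)] pg by simp_all
    have eUfix: "eU v = v" if "p v = 0" "q v = 0" "restr u v = v" for v
      unfolding eU_def f1_def that gl0 lin_zero[OF g1(1)] by simp
    have eYz: "eY (p v) = 0" "eY (q v) = 0" for v
      unfolding eY_def f2_def z z' gl0 lin_zero[OF g2(1)] by simp_all
    have "eU (eU v) = eU v" for v by (rule eUfix) (simp_all add: peU restr_lin[OF leU])
    moreover have "eY (eY w) = eY w" for w unfolding eY_def g2(2) ..
    moreover have d: "FF.dhom eU eY" unfolding data_hom_def
    proof (intro conjI allI leU leY)
      fix x
      show "eY (p x) = p (eU x)" "eY (q x) = q (eU x)" by (simp_all add: eYz peU)
      show "eU (s x) = s (eY x)" "eU (t x) = t (eY x)"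
        unfolding eY_def sg by (rule eUfix; simp add: z z' restr_lin[OF l(3)] restr_lin[OF l(4)])+
    qed
    let ?e = "FF.lift eU eY"
    have he: "hm X X ?e" using FF.lift_hm[OF d] .
    ultimately have "?e (?e x) = ?e x" for x
      by - (rule FF.hm_eqI[OF hm_comp[OF he he] he]; simp add: FF.lift_k[OF d])
    then have "(\<forall>x. ?e x = 0) \<or> (\<forall>x. ?e x = restr (rdim X) x)"
      by (rule indecomposable_idempotent[OF X he])
    then have "(\<forall>x. s x = 0 \<and> t x = 0) \<or> (\<forall>x. p x = 0 \<and> q x = 0)"
    proof
      assume "\<forall>x. ?e x = 0"
      then have "k0 (eU x) = 0" for x using FF.lift_k(1)[OF d, of x] by simp
      then have "h0 (k0 (eU x)) = 0" for x by (simp add: F.ladd)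
      then have e0: "eU x = 0" for x by (simp add: F.hk restr_lin[OF leU])
      have "s x = 0" "t x = 0" for x
        using eUfix[of "s x"] eUfix[of "t x"] z z' restr_lin[OF l(3)] restr_lin[OF l(4)] e0 by simp_all
      then show ?thesis by blast
    next
      assume "\<forall>x. ?e x = restr (rdim X) x"
      then have "k0 (eU x) = k0 x" for x using FF.lift_k(1)[OF d, of x] by (simp add: F.lrestr)
      then have "h0 (k0 (eU x)) = h0 (k0 x)" for x by simp
      then have "eU x = restr u x" for x by (simp add: F.hk restr_lin[OF leU])
      then have "p x = 0" "q x = 0" for x using peU[of x] by (simp_all add: lin_restr[OF l(1)] lin_restr[OF l(2)])
      then show ?thesis by blast
    qed
    moreover have pos: "u + y > 0"
    proof (rule ccontr)
      assume "\<not> u + y > 0"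
      then have uy: "u = 0" "y = 0" by auto
      have "h0 x = 0" "h1 x = 0" "h2 x = 0" "h3 x = 0" for x
        using restr_lin[OF F.lin_h(1), of x] restr_lin[OF F.lin_h(2), of x] restr_lin[OF F.lin_h(3), of x]
          restr_lin[OF F.lin_h(4), of x] uy by simp_all
      then have "restr (rdim X) x = 0" for x :: "nat \<Rightarrow> 'k" using F.complete[of x] by (simp add: F.ladd)
      from this[of "\<lambda>_. 1"] X show False
        unfolding indecomposable_def by (auto simp: restr_def fun_eq_iff dest: spec[of _ 0])
    qed
    ultimately show ?thesis
    proof (elim disjE)
      assume "\<forall>x. s x = 0 \<and> t x = 0"
      then have st: "s = (\<lambda>_. 0)" "t = (\<lambda>_. 0)" by auto
      obtain u' y' p' q' where k: "std_pencil u' y' p' q'" "pencil_retract u y p q u' y' p' q'"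
        using kronecker[OF l(1,2) pos] by blast
      have "data_retract u y p q s t u' y' p' q' (\<lambda>_. 0) (\<lambda>_. 0)"
        unfolding st by (rule pencil_data_retract(1)[OF k(2)])
      then show ?thesis using std_pencil_data_indec(1)[OF k(1)] iso k(1) by blast
    next
      assume "\<forall>x. p x = 0 \<and> q x = 0"
      then have pq: "p = (\<lambda>_. 0)" "q = (\<lambda>_. 0)" by auto
      have "y + u > 0" using pos by linarith
      then obtain u' y' p' q' where k: "std_pencil u' y' p' q'" "pencil_retract y u t s u' y' p' q'"
        using kronecker[OF l(4,3)] by blast
      have "data_retract u y p q s t y' u' (\<lambda>_. 0) (\<lambda>_. 0) q' p'"
        unfolding pq by (rule pencil_data_retract(2)[OF k(2)])
      then show ?thesis using std_pencil_data_indec(2)[OF k(1)] iso k(1) by blast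
    qed
  qed
qed

section \<open>The modules of the list\<close>

definition emb :: "nat \<Rightarrow> (nat \<Rightarrow> nat) \<Rightarrow> (nat \<Rightarrow> nat) \<Rightarrow> nat \<Rightarrow> (nat \<Rightarrow> 'k::field) \<Rightarrow> nat \<Rightarrow> 'k" where
  "emb n cl ix a x = (\<lambda>j. if j < n \<and> cl j = a then x (ix j) else 0)"

text \<open>The basis vector with index \<open>j\<close> is the image of the \<open>ix j\<close>-th basis vector of \<open>U\<close> or \<open>Y\<close> in \<open>X\<^sub>c\<close>, \<open>c = cl j\<close>.\<close>

lemma positional_frame:
  fixes X :: "'k::field rep" and cl ix :: "nat \<Rightarrow> nat" and pos :: "nat \<Rightarrow> nat \<Rightarrow> nat"
  assumes char: "CHAR('k) = 2" and wf: "well_formed X" and n: "rdim X = n"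
    and pos: "\<And>a i. a < 4 \<Longrightarrow> i < (if a = 0 then u else y) \<Longrightarrow> pos a i < n \<and> cl (pos a i) = a \<and> ix (pos a i) = i"
    and cl: "\<And>j. j < n \<Longrightarrow> cl j < 4 \<and> ix j < (if cl j = 0 then u else y) \<and> pos (cl j) (ix j) = j"
    and D: "data_rel u y p q s t"
    and ak: "\<And>x. opA X (emb n cl ix 0 x) = emb n cl ix 1 (p x)" "\<And>x. opA X (emb n cl ix 1 x) = emb n cl ix 2 x"
      "\<And>x. opA X (emb n cl ix 2 x) = emb n cl ix 3 x" "\<And>x. opA X (emb n cl ix 3 x) = emb n cl ix 0 (t x)"
    and bk: "\<And>x. opB X (emb n cl ix 0 x) = emb n cl ix 3 (q x)" "\<And>x. opB X (emb n cl ix 1 x) = emb n cl ix 0 (s x)"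
      "\<And>x. opB X (emb n cl ix 2 x) = emb n cl ix 1 (x + p (s x))" "\<And>x. opB X (emb n cl ix 3 x) = emb n cl ix 2 (x + p (s x))"
    and ck: "\<And>x. opC X (emb n cl ix 0 x) = 0" "\<And>x. opC X (emb n cl ix 1 x) = emb n cl ix 1 x"
      "\<And>x. opC X (emb n cl ix 2 x) = 0" "\<And>x. opC X (emb n cl ix 3 x) = emb n cl ix 3 x"
  shows "has_frame X u y p q s t"
proof -
  let ?m = "\<lambda>a::nat. if a = 0 then u else y"
  define prj where "prj a x = (\<lambda>i. if i < ?m a then x (pos a i) else 0)" for a :: nat and x :: "nat \<Rightarrow> 'k"
  have le: "lin (?m a) n (emb n cl ix a)" if "a < 4" for a
    by (rule linI) (use cl in \<open>fastforce simp: emb_def restr_def fun_eq_iff\<close>)+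
  have lp: "lin n (?m a) (prj a)" if "a < 4" for a
    by (rule linI) (use pos[OF that] in \<open>auto simp: prj_def restr_def fun_eq_iff\<close>)
  have pe: "prj a (emb n cl ix a x) = restr (?m a) x" if "a < 4" for a x
    using pos[OF that] by (auto simp: prj_def emb_def restr_def fun_eq_iff)
  have p0: "prj a (emb n cl ix b x) = 0" if "a < 4" "a \<noteq> b" for a b x
    using pos[OF that(1)] that(2) by (auto simp: prj_def emb_def fun_eq_iff)
  have lrel: "lin u y p" "lin u y q" "lin y u s" "lin y u t"
    "p (s x) = q (t x)" "s (p x) = t (q x)" "t (p x) = 0" "p (t x) = 0" "s (q x) = 0" "q (s x) = 0" for x
    using D unfolding data_rel_def by blast+
  have ep: "emb n cl ix a (prj a x) j = (if j < n \<and> cl j = a then x j else 0)" for a x j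
    using cl[of j] by (auto simp: emb_def prj_def)
  have comp: "emb n cl ix 0 (prj 0 x) + emb n cl ix 1 (prj 1 x) + emb n cl ix 2 (prj 2 x) + emb n cl ix 3 (prj 3 x) = restr n x" for x
  proof (rule ext)
    fix j
    have "j < n \<Longrightarrow> cl j = 0 \<or> cl j = 1 \<or> cl j = 2 \<or> cl j = 3" using cl[of j] by linarith
    then show "(emb n cl ix 0 (prj 0 x) + emb n cl ix 1 (prj 1 x) + emb n cl ix 2 (prj 2 x) + emb n cl ix 3 (prj 3 x)) j = restr n x j"
      by (auto simp: ep restr_def)
  qed
  have "frame X u y p q s t (emb n cl ix 0) (emb n cl ix 1) (emb n cl ix 2) (emb n cl ix 3) (prj 0) (prj 1) (prj 2) (prj 3)"
    by (unfold_locales, unfold n)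
      (use char wf lrel le[of 0] le[of 1] le[of 2] le[of 3] lp[of 0] lp[of 1] lp[of 2] lp[of 3]
        pe[of 0] pe[of 1] pe[of 2] pe[of 3] comp in \<open>simp_all add: p0 ak bk ck del: One_nat_def\<close>)
  then show ?thesis unfolding has_frame_def by blast
qed

lemma mod4_simps:
  "Suc (4 * i) mod 4 = 1" "Suc (Suc (4 * i)) mod 4 = 2" "Suc (Suc (Suc (4 * i))) mod 4 = 3"
  "Suc (4 * i) div 4 = i" "Suc (Suc (4 * i)) div 4 = i" "Suc (Suc (Suc (4 * i))) div 4 = i"
  by presburger+

lemma mod4_cases:
  obtains i :: nat where "j = 4 * i" | i where "j = Suc (4 * i)" | i where "j = Suc (Suc (4 * i))" | i where "j = Suc (Suc (Suc (4 * i)))"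
proof -
  have "j mod 4 < 4" "j = 4 * (j div 4) + j mod 4" by simp_all
  then have "j = 4 * (j div 4) \<or> j = Suc (4 * (j div 4)) \<or> j = Suc (Suc (4 * (j div 4))) \<or> j = Suc (Suc (Suc (4 * (j div 4))))"
    by linarith
  then show thesis using that by blast
qed

lemma arith4: fixes i r :: nat shows
  "Suc (4 * i) < 4 * r \<longleftrightarrow> i < r" "2 + 4 * i < 4 * r \<longleftrightarrow> i < r"
  "3 + 4 * i < 4 * r \<longleftrightarrow> i < r" "4 + 4 * i < 4 * r \<longleftrightarrow> Suc i < r"
  "5 + 4 * i < 4 * r \<longleftrightarrow> Suc i < r" "6 + 4 * i < 4 * r \<longleftrightarrow> Suc i < r"
  "7 + 4 * i < 4 * r \<longleftrightarrow> Suc i < r"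
  "Suc (4 * i) \<le> 4 * r \<longleftrightarrow> i < r" "2 + 4 * i \<le> 4 * r \<longleftrightarrow> i < r"
  "3 + 4 * i \<le> 4 * r \<longleftrightarrow> i < r"
  "4 + 4 * i \<le> 4 * r \<longleftrightarrow> Suc i \<le> r"
  "5 + 4 * i \<le> 4 * r \<longleftrightarrow> Suc i < r"
  "6 + 4 * i \<le> 4 * r \<longleftrightarrow> Suc i < r"
  "7 + 4 * i \<le> 4 * r \<longleftrightarrow> Suc i < r" "Suc (4 * i) = 4 * r \<longleftrightarrow> False"
  "2 + 4 * i = 4 * r \<longleftrightarrow> False" "3 + 4 * i = 4 * r \<longleftrightarrow> False"
  "5 + 4 * i = 4 * r \<longleftrightarrow> False" "6 + 4 * i = 4 * r \<longleftrightarrow> False"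
  "7 + 4 * i = 4 * r \<longleftrightarrow> False" "4 + 4 * i = 4 * r \<longleftrightarrow> Suc i = r"
  "Suc 0 < 4 * r \<longleftrightarrow> 0 < r"
  "2 < 4 * r \<longleftrightarrow> 0 < r" "3 < 4 * r \<longleftrightarrow> 0 < r"
  "Suc 0 \<le> 4 * r \<longleftrightarrow> 0 < r" "2 \<le> 4 * r \<longleftrightarrow> 0 < r"
  "3 \<le> 4 * r \<longleftrightarrow> 0 < r" "Suc 0 = 4 * r \<longleftrightarrow> False"
  "2 = 4 * r \<longleftrightarrow> False" "3 = 4 * r \<longleftrightarrow> False"
  "4 * r = Suc 0 \<longleftrightarrow> False" "4 * r = 2 \<longleftrightarrow> False"
  "4 * r = 3 \<longleftrightarrow> False"
  by presburger+

text \<open>The positions 0 to 3 are treated separately; from 4 on the truncated differences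
  \<open>j - 1\<close>, \<open>j - 2\<close> and \<open>j - 3\<close> in \<open>gen_mod_ops\<close>
  are true ones.\<close>

lemma ext_by_residue:
  assumes "f 0 = g 0" "f 1 = g 1" "f 2 = g 2" "f 3 = g 3" "\<And>i. f (4 * i + 4) = g (4 * i + 4)"
    "\<And>i. f (4 * i + 5) = g (4 * i + 5)" "\<And>i. f (4 * i + 6) = g (4 * i + 6)" "\<And>i. f (4 * i + 7) = g (4 * i + 7)"
  shows "f = (g :: nat \<Rightarrow> 'a)"
proof (rule ext)
  fix j :: nat
  have "j = 0 \<or> j = 1 \<or> j = 2 \<or> j = 3 \<or> (\<exists>i. j = 4 * i + 4 \<or> j = 4 * i + 5 \<or> j = 4 * i + 6 \<or> j = 4 * i + 7)"
    by presburger
  then show "f j = g j" using assms by blast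
qed

lemma act_op_mat: "act (op_mat d f) x = (\<lambda>j. if j < d then \<Sum>i<d. f (Suc j) (Suc i) * x i else 0)"
  by (simp add: act_def op_mat_def fun_eq_iff)

lemma gen_mod_basic: "well_formed (gen_mod d \<kappa> \<mu> \<xi> lam \<nu>)" "rdim (gen_mod d \<kappa> \<mu> \<xi> lam \<nu>) = d"
  by (auto simp: gen_mod_def well_formed_def rdim_def op_mat_def)

text \<open>Coordinates are counted from 0, the bases of the list from 1, so position
  \<open>j\<close> belongs to \<open>z_(j+1)\<close>. It receives \<open>z_j\<close> under
  \<open>a\<close>, hence the test \<open>\<kappa> j\<close>; under \<open>b\<close> it receives
  \<open>z_(j+2)\<close>, subject to \<mu>, and \<open>z_(j-2)\<close>, subject to \<xi>.\<close>

lemma gen_mod_ops: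
  "opA (gen_mod d \<kappa> \<mu> \<xi> lam \<nu>) x = (\<lambda>j. if j < d \<and> 0 < j \<and> \<kappa> j then x (j - 1) else 0)"
  "opB (gen_mod d \<kappa> \<mu> \<xi> lam \<nu>) x = (\<lambda>j. if j < d then (if j + 1 < d \<and> \<mu> (j + 2) then x (j + 1) else 0) +
     (if 3 \<le> j \<and> \<xi> (j - 2) then lam * x (j - 3) else 0) else 0)"
  "opC (gen_mod d \<kappa> \<mu> \<xi> lam \<nu>) x = (\<lambda>j. if j < d \<and> \<nu> (j + 1) then x j else 0)"
proof -
  have eqc: "(\<Sum>i<d. (if i = l \<and> P i then c i else 0) * x i) = (if l < d \<and> P l then c l * x l else 0)" for l P c
  proof -
    have "(\<Sum>i<d. (if i = l \<and> P i then c i else 0) * x i) = (\<Sum>i<d. if i = l then (if P l then c l * x l else 0) else 0)"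
      by (intro sum.cong) auto
    then show ?thesis by simp
  qed
  show "opA (gen_mod d \<kappa> \<mu> \<xi> lam \<nu>) x = (\<lambda>j. if j < d \<and> 0 < j \<and> \<kappa> j then x (j - 1) else 0)"
  proof (rule ext)
    fix j
    have "(\<Sum>i<d. of_bool (Suc j = Suc i + 1 \<and> \<kappa> (Suc i)) * x i) = (\<Sum>i<d. (if i = j - 1 \<and> (0 < j \<and> \<kappa> (Suc i)) then 1 else 0) * x i)"
      by (intro sum.cong) auto
    then show "opA (gen_mod d \<kappa> \<mu> \<xi> lam \<nu>) x j = (if j < d \<and> 0 < j \<and> \<kappa> j then x (j - 1) else 0)"
      unfolding eqc by (auto simp: gen_mod_def act_op_mat)
  qed
  show "opB (gen_mod d \<kappa> \<mu> \<xi> lam \<nu>) x = (\<lambda>j. if j < d then (if j + 1 < d \<and> \<mu> (j + 2) then x (j + 1) else 0) +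
     (if 3 \<le> j \<and> \<xi> (j - 2) then lam * x (j - 3) else 0) else 0)"
  proof (rule ext)
    fix j
    have 1: "(\<Sum>i<d. of_bool (Suc i = Suc j + 1 \<and> \<mu> (Suc i)) * x i) = (\<Sum>i<d. (if i = j + 1 \<and> \<mu> (Suc i) then 1 else 0) * x i)"
      by (intro sum.cong) auto
    have 2: "(\<Sum>i<d. (if Suc j = Suc i + 3 \<and> \<xi> (Suc i) then lam else 0) * x i) = (\<Sum>i<d. (if i = j - 3 \<and> (3 \<le> j \<and> \<xi> (Suc i)) then lam else 0) * x i)"
      by (intro sum.cong) auto
    have 3: "3 \<le> j \<Longrightarrow> Suc (j - 3) = j - 2" by simp
    show "opB (gen_mod d \<kappa> \<mu> \<xi> lam \<nu>) x j = (if j < d then (if j + 1 < d \<and> \<mu> (j + 2) then x (j + 1) else 0) +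
     (if 3 \<le> j \<and> \<xi> (j - 2) then lam * x (j - 3) else 0) else 0)"
      using 1 2 unfolding eqc by (auto simp: gen_mod_def act_op_mat distrib_right sum.distrib 3)
  qed
  show "opC (gen_mod d \<kappa> \<mu> \<xi> lam \<nu>) x = (\<lambda>j. if j < d \<and> \<nu> (j + 1) then x j else 0)"
  proof (rule ext)
    fix j
    have "(\<Sum>i<d. of_bool (Suc j = Suc i \<and> \<nu> (Suc i)) * x i) = (\<Sum>i<d. (if i = j \<and> \<nu> (Suc i) then 1 else 0) * x i)"
      by (intro sum.cong) auto
    then show "opC (gen_mod d \<kappa> \<mu> \<xi> lam \<nu>) x j = (if j < d \<and> \<nu> (j + 1) then x j else 0)"
      unfolding eqc by (auto simp: gen_mod_def act_op_mat)
  qed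
qed

lemma zero_data_rel: "lin u y p \<Longrightarrow> lin u y q \<Longrightarrow> data_rel u y p q (\<lambda>_. 0) (\<lambda>_. 0)"
  "lin y u s \<Longrightarrow> lin y u t \<Longrightarrow> data_rel u y (\<lambda>_. 0) (\<lambda>_. 0) s t"
  unfolding data_rel_def using lin_zero[of u y p] lin_zero[of u y q] lin_zero[of y u s] lin_zero[of y u t] by simp_all

text \<open>Two ways of running through the grading, told apart by \<nu>: if \<nu> selects the even
  \<open>i\<close>, each block of four begins with X0; if it selects the odd \<open>i\<close>, each
  block ends with X0, and \<open>emb2\<close> applies.\<close>

abbreviation emb1 where "emb1 n \<equiv> emb n (\<lambda>j. j mod 4) (\<lambda>j. j div 4)"
abbreviation emb2 where "emb2 n \<equiv> emb n (\<lambda>j. (j + 1) mod 4) (\<lambda>j. j div 4)"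

text \<open>Index \<open>i\<close> of U and of Y is placed in the \<open>i\<close>-th block of four,
  and the hypothesis on \<open>n\<close> allows the last block to be incomplete. As
  \<open>p s = 0\<close>, the factor \<open>1 + ps\<close> disappears from the action of
  \<open>b\<close>.\<close>

lemma gen_mod_frame1:
  assumes char: "CHAR('k::field) = 2" and n: "\<And>j. j < n \<longleftrightarrow> j div 4 < (if j mod 4 = 0 then u else y)"
    and D: "data_rel u y p q s (t :: (nat \<Rightarrow> 'k) \<Rightarrow> _)" and ps: "\<And>x. p (s x) = 0"
    and X: "X = gen_mod n \<kappa> \<mu> \<xi> lam \<nu>"
    and ak: "\<And>x. opA X (emb1 n 0 x) = emb1 n 1 (p x)" "\<And>x. opA X (emb1 n 1 x) = emb1 n 2 x"
      "\<And>x. opA X (emb1 n 2 x) = emb1 n 3 x" "\<And>x. opA X (emb1 n 3 x) = emb1 n 0 (t x)"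
    and bk: "\<And>x. opB X (emb1 n 0 x) = emb1 n 3 (q x)" "\<And>x. opB X (emb1 n 1 x) = emb1 n 0 (s x)"
      "\<And>x. opB X (emb1 n 2 x) = emb1 n 1 x" "\<And>x. opB X (emb1 n 3 x) = emb1 n 2 x"
    and ck: "\<And>x. opC X (emb1 n 0 x) = 0" "\<And>x. opC X (emb1 n 1 x) = emb1 n 1 x"
      "\<And>x. opC X (emb1 n 2 x) = 0" "\<And>x. opC X (emb1 n 3 x) = emb1 n 3 x"
  shows "has_frame X u y p q s t"
proof (rule positional_frame[where n = n and cl = "\<lambda>j. j mod 4" and ix = "\<lambda>j. j div 4" and pos = "\<lambda>a i. 4 * i + a"])
  show "opB X (emb1 n 2 x) = emb1 n 1 (x + p (s x))" "opB X (emb1 n 3 x) = emb1 n 2 (x + p (s x))" for x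
    by (simp_all only: bk ps add_0_right)
  show "4 * i + a < n \<and> (4 * i + a) mod 4 = a \<and> (4 * i + a) div 4 = i" if "a < 4" "i < (if a = 0 then u else y)" for a i
    using that unfolding n by simp
  show "j mod 4 < 4 \<and> j div 4 < (if j mod 4 = 0 then u else y) \<and> 4 * (j div 4) + j mod 4 = j" if "j < n" for j
    using that unfolding n by simp
  show "well_formed X" "rdim X = n" unfolding X by (rule gen_mod_basic)+
qed (rule char D ak bk ck)+

lemma gen_mod_frame2:
  assumes char: "CHAR('k::field) = 2" and n: "\<And>j. j < n \<longleftrightarrow> j div 4 < (if j mod 4 = 3 then u else y)"
    and D: "data_rel u y p q s (t :: (nat \<Rightarrow> 'k) \<Rightarrow> _)" and ps: "\<And>x. p (s x) = 0"
    and X: "X = gen_mod n \<kappa> \<mu> \<xi> lam \<nu>"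
    and ak: "\<And>x. opA X (emb2 n 0 x) = emb2 n 1 (p x)" "\<And>x. opA X (emb2 n 1 x) = emb2 n 2 x"
      "\<And>x. opA X (emb2 n 2 x) = emb2 n 3 x" "\<And>x. opA X (emb2 n 3 x) = emb2 n 0 (t x)"
    and bk: "\<And>x. opB X (emb2 n 0 x) = emb2 n 3 (q x)" "\<And>x. opB X (emb2 n 1 x) = emb2 n 0 (s x)"
      "\<And>x. opB X (emb2 n 2 x) = emb2 n 1 x" "\<And>x. opB X (emb2 n 3 x) = emb2 n 2 x"
    and ck: "\<And>x. opC X (emb2 n 0 x) = 0" "\<And>x. opC X (emb2 n 1 x) = emb2 n 1 x"
      "\<And>x. opC X (emb2 n 2 x) = 0" "\<And>x. opC X (emb2 n 3 x) = emb2 n 3 x"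
  shows "has_frame X u y p q s t"
proof (rule positional_frame[where n = n and cl = "\<lambda>j. (j + 1) mod 4" and ix = "\<lambda>j. j div 4" and pos = "\<lambda>a i. 4 * i + (a + 3) mod 4"])
  show "opB X (emb2 n 2 x) = emb2 n 1 (x + p (s x))" "opB X (emb2 n 3 x) = emb2 n 2 (x + p (s x))" for x
    by (simp_all only: bk ps add_0_right)
  show "4 * i + (a + 3) mod 4 < n \<and> (4 * i + (a + 3) mod 4 + 1) mod 4 = a \<and> (4 * i + (a + 3) mod 4) div 4 = i"
    if "a < 4" "i < (if a = 0 then u else y)" for a i
  proof -
    have "a = 0 \<or> a = 1 \<or> a = 2 \<or> a = 3" using that by linarith
    then show ?thesis using that unfolding n by (elim disjE) (simp_all add: mod4_simps)
  qed
  show "(j + 1) mod 4 < 4 \<and> j div 4 < (if (j + 1) mod 4 = 0 then u else y) \<and> 4 * (j div 4) + ((j + 1) mod 4 + 3) mod 4 = j" if "j < n" for j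
  proof -
    have "((j + 1) mod 4 = 0) = (j mod 4 = 3)" "((j + 1) mod 4 + 3) mod 4 = j mod 4" by presburger+
    then show ?thesis using that unfolding n by simp
  qed
  show "well_formed X" "rdim X = n" unfolding X by (rule gen_mod_basic)+
qed (rule char D ak bk ck)+

section \<open>Strings and bands as standard pencils\<close>

text \<open>From the X0-vector of block \<open>i\<close>, \<open>a\<close> stays in the block and
  \<open>b\<close> leads to X3 of the block before: \<open>p\<close> is the restriction and
  \<open>q\<close> the left shift.\<close>

lemma U1_frame:
  assumes "CHAR('k::field) = 2"
  shows "has_frame (U_mod 1 r :: 'k rep) (Suc r) r (restr r) (shiftl r) (\<lambda>_. 0) (\<lambda>_. 0)"
proof -
  let ?n = "4 * r + 1"
  let ?X = "gen_mod ?n (\<lambda>i. \<not> (i mod 4 = 0 \<or> i = 4*r+1)) (\<lambda>i. \<not> (i mod 4 = 2 \<or> i = 1)) (\<lambda>i. False) 0 (\<lambda>i. even i) :: 'k rep"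
  have "has_frame ?X (Suc r) r (restr r) (shiftl r) (\<lambda>_. 0) (\<lambda>_. 0)"
  proof (rule gen_mod_frame1[where n = ?n, OF assms _ _ _ refl])
    show "(j < ?n) = (j div 4 < (if j mod 4 = 0 then Suc r else r))" for j
      by (rule mod4_cases[of j]) (auto simp: mod4_simps arith4)
    show "data_rel (Suc r) r (restr r) (shiftl r) (\<lambda>_. 0) (\<lambda>_. 0)" by (intro zero_data_rel lin_std lin_id)
  qed (rule lin_zero, rule lin_std lin_id | (rule ext_by_residue; auto simp: gen_mod_ops emb_def restr_def shiftl_def shiftr_def jord_def arith4 mod4_simps))+
  then show ?thesis by (simp add: U_mod_def string_mod_def)
qed

text \<open>Here X0 ends a block: \<open>a\<close> leads to the next block and \<open>b\<close>
  stays, so \<open>p\<close> is the right shift and \<open>q\<close> the inclusion.\<close>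

lemma U2_frame:
  assumes "CHAR('k::field) = 2"
  shows "has_frame (U_mod 2 r :: 'k rep) r (Suc r) (shiftr (Suc r)) (restr r) (\<lambda>_. 0) (\<lambda>_. 0)"
proof -
  let ?n = "4 * r + 3"
  let ?X = "gen_mod ?n (\<lambda>i. i mod 4 \<noteq> 3) (\<lambda>i. i mod 4 \<noteq> 1) (\<lambda>i. False) 0 (\<lambda>i. odd i) :: 'k rep"
  have "has_frame ?X r (Suc r) (shiftr (Suc r)) (restr r) (\<lambda>_. 0) (\<lambda>_. 0)"
  proof (rule gen_mod_frame2[where n = ?n, OF assms _ _ _ refl])
    show "(j < ?n) = (j div 4 < (if j mod 4 = 3 then r else Suc r))" for j
      by (rule mod4_cases[of j]) (auto simp: mod4_simps arith4)
    show "data_rel r (Suc r) (shiftr (Suc r)) (restr r) (\<lambda>_. 0) (\<lambda>_. 0)" by (intro zero_data_rel lin_std lin_id)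
  qed (rule lin_zero, rule lin_std lin_id | (rule ext_by_residue; auto simp: gen_mod_ops emb_def restr_def shiftl_def shiftr_def jord_def arith4 mod4_simps))+
  then show ?thesis by (simp add: U_mod_def string_mod_def)
qed

text \<open>The arrows at X0 now point towards it: \<open>a^3\<close> reaches the X0-vector of the
  same block, \<open>b\<close> that of the block before.\<close>

lemma U3_frame:
  assumes "CHAR('k::field) = 2"
  shows "has_frame (U_mod 3 r :: 'k rep) r (Suc r) (\<lambda>_. 0) (\<lambda>_. 0) (shiftl r) (restr r)"
proof -
  let ?n = "4 * r + 3"
  let ?X = "gen_mod ?n (\<lambda>i. \<not> (i mod 4 = 0 \<or> i = 4*r+3)) (\<lambda>i. \<not> (i mod 4 = 0 \<or> i = 1)) (\<lambda>i. False) 0 (\<lambda>i. odd i) :: 'k rep"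
  have "has_frame ?X r (Suc r) (\<lambda>_. 0) (\<lambda>_. 0) (shiftl r) (restr r)"
  proof (rule gen_mod_frame2[where n = ?n, OF assms _ _ _ refl])
    show "(j < ?n) = (j div 4 < (if j mod 4 = 3 then r else Suc r))" for j
      by (rule mod4_cases[of j]) (auto simp: mod4_simps arith4)
    show "data_rel r (Suc r) (\<lambda>_. 0) (\<lambda>_. 0) (shiftl r) (restr r)" by (intro zero_data_rel lin_std lin_id)
  qed (rule refl | (rule ext_by_residue; auto simp: gen_mod_ops emb_def restr_def shiftl_def shiftr_def jord_def arith4 mod4_simps))+
  then show ?thesis by (simp add: U_mod_def string_mod_def)
qed

lemma U4_frame:
  assumes "CHAR('k::field) = 2"
  shows "has_frame (U_mod 4 r :: 'k rep) (Suc r) r (\<lambda>_. 0) (\<lambda>_. 0) (restr r) (shiftr (Suc r))"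
proof -
  let ?n = "4 * r + 1"
  let ?X = "gen_mod ?n (\<lambda>i. i mod 4 \<noteq> 1) (\<lambda>i. i mod 4 \<noteq> 1) (\<lambda>i. False) 0 (\<lambda>i. even i) :: 'k rep"
  have "has_frame ?X (Suc r) r (\<lambda>_. 0) (\<lambda>_. 0) (restr r) (shiftr (Suc r))"
  proof (rule gen_mod_frame1[where n = ?n, OF assms _ _ _ refl])
    show "(j < ?n) = (j div 4 < (if j mod 4 = 0 then Suc r else r))" for j
      by (rule mod4_cases[of j]) (auto simp: mod4_simps arith4)
    show "data_rel (Suc r) r (\<lambda>_. 0) (\<lambda>_. 0) (restr r) (shiftr (Suc r))" by (intro zero_data_rel lin_std lin_id)
  qed (rule refl | (rule ext_by_residue; auto simp: gen_mod_ops emb_def restr_def shiftl_def shiftr_def jord_def arith4 mod4_simps))+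
  then show ?thesis by (simp add: U_mod_def string_mod_def)
qed

text \<open>The term with \<xi> lets \<open>b\<close> send the X0-vector of a block to
  \<open>lam\<close> times the X3-vector of the same block, besides that of the block before:
  \<open>q\<close> is a Jordan block.\<close>

lemma A_frame:
  assumes "CHAR('k::field) = 2"
  shows "has_frame (A_band lam n :: 'k rep) n n (restr n) (jord n lam) (\<lambda>_. 0) (\<lambda>_. 0)"
proof -
  let ?n = "4 * n"
  let ?X = "gen_mod ?n (\<lambda>i. i mod 4 \<noteq> 0) (\<lambda>i. \<not> (i mod 4 = 2 \<or> i = 1)) (\<lambda>i. i mod 4 = 1) lam (\<lambda>i. even i) :: 'k rep"
  have "has_frame ?X n n (restr n) (jord n lam) (\<lambda>_. 0) (\<lambda>_. 0)"
  proof (rule gen_mod_frame1[where n = ?n, OF assms _ _ _ refl])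
    show "(j < ?n) = (j div 4 < (if j mod 4 = 0 then n else n))" for j
      by (rule mod4_cases[of j]) (auto simp: mod4_simps arith4)
    show "data_rel n n (restr n) (jord n lam) (\<lambda>_. 0) (\<lambda>_. 0)" by (intro zero_data_rel lin_std lin_id)
  qed (rule lin_zero, rule lin_std lin_id | (rule ext_by_residue; auto simp: gen_mod_ops emb_def restr_def shiftl_def shiftr_def jord_def arith4 mod4_simps))+
  then show ?thesis by (simp add: A_band_def)
qed

lemma B_frame:
  assumes "CHAR('k::field) = 2"
  shows "has_frame (B_band lam n :: 'k rep) n n (\<lambda>_. 0) (\<lambda>_. 0) (jord n lam) (restr n)"
proof -
  let ?n = "4 * n"
  let ?X = "gen_mod ?n (\<lambda>i. i mod 4 \<noteq> 0) (\<lambda>i. \<not> (i mod 4 = 0 \<or> i = 1)) (\<lambda>i. i mod 4 = 1) lam (\<lambda>i. odd i) :: 'k rep"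
  have "has_frame ?X n n (\<lambda>_. 0) (\<lambda>_. 0) (jord n lam) (restr n)"
  proof (rule gen_mod_frame2[where n = ?n, OF assms _ _ _ refl])
    show "(j < ?n) = (j div 4 < (if j mod 4 = 3 then n else n))" for j
      by (rule mod4_cases[of j]) (auto simp: mod4_simps arith4)
    show "data_rel n n (\<lambda>_. 0) (\<lambda>_. 0) (jord n lam) (restr n)" by (intro zero_data_rel lin_std lin_id)
  qed (rule refl | (rule ext_by_residue; auto simp: gen_mod_ops emb_def restr_def shiftl_def shiftr_def jord_def arith4 mod4_simps))+
  then show ?thesis by (simp add: B_band_def)
qed

lemma V2_frame:
  assumes "CHAR('k::field) = 2"
  shows "has_frame (V_mod 2 t :: 'k rep) (Suc t) (Suc t) (shiftr (Suc t)) (restr (Suc t)) (\<lambda>_. 0) (\<lambda>_. 0)"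
proof -
  let ?n = "4 * (t + 1)"
  let ?X = "gen_mod ?n (\<lambda>i. \<not> (i mod 4 = 3 \<or> i = 4*(t+1))) (\<lambda>i. i mod 4 \<noteq> 1) (\<lambda>i. False) 0 (\<lambda>i. odd i) :: 'k rep"
  have "has_frame ?X (Suc t) (Suc t) (shiftr (Suc t)) (restr (Suc t)) (\<lambda>_. 0) (\<lambda>_. 0)"
  proof (rule gen_mod_frame2[where n = ?n, OF assms _ _ _ refl])
    show "(j < ?n) = (j div 4 < (if j mod 4 = 3 then Suc t else Suc t))" for j
      by (rule mod4_cases[of j]) (auto simp: mod4_simps arith4)
    show "data_rel (Suc t) (Suc t) (shiftr (Suc t)) (restr (Suc t)) (\<lambda>_. 0) (\<lambda>_. 0)" by (intro zero_data_rel lin_std lin_id)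
  qed (rule lin_zero, rule lin_std lin_id | (rule ext_by_residue; auto simp: gen_mod_ops emb_def restr_def shiftl_def shiftr_def jord_def arith4 mod4_simps))+
  then show ?thesis by (simp add: V_mod_def string_mod_def)
qed

lemma W2_frame:
  assumes "CHAR('k::field) = 2"
  shows "has_frame (W_mod 2 t :: 'k rep) (Suc t) (Suc t) (\<lambda>_. 0) (\<lambda>_. 0) (restr (Suc t)) (shiftr (Suc t))"
proof -
  let ?n = "4 * (t + 1)"
  let ?X = "gen_mod ?n (\<lambda>i. \<not> (i mod 4 = 1 \<or> i = 4*(t+1))) (\<lambda>i. \<not> (i mod 4 = 1 \<or> i = 1)) (\<lambda>i. False) 0 (\<lambda>i. even i) :: 'k rep"
  have "has_frame ?X (Suc t) (Suc t) (\<lambda>_. 0) (\<lambda>_. 0) (restr (Suc t)) (shiftr (Suc t))"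
  proof (rule gen_mod_frame1[where n = ?n, OF assms _ _ _ refl])
    show "(j < ?n) = (j div 4 < (if j mod 4 = 0 then Suc t else Suc t))" for j
      by (rule mod4_cases[of j]) (auto simp: mod4_simps arith4)
    show "data_rel (Suc t) (Suc t) (\<lambda>_. 0) (\<lambda>_. 0) (restr (Suc t)) (shiftr (Suc t))" by (intro zero_data_rel lin_std lin_id)
  qed (rule refl | (rule ext_by_residue; auto simp: gen_mod_ops emb_def restr_def shiftl_def shiftr_def jord_def arith4 mod4_simps))+
  then show ?thesis by (simp add: W_mod_def string_mod_def)
qed

section \<open>The modules M and N\<close>

lemma less_8_cases: "(j::nat) < 8 \<longleftrightarrow> j = 0 \<or> j = 1 \<or> j = 2 \<or> j = 3 \<or> j = 4 \<or> j = 5 \<or> j = 6 \<or> j = 7"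
  by auto

lemma ext_below_8:
  assumes "f 0 = g 0" "f 1 = g 1" "f 2 = g 2" "f 3 = g 3" "f 4 = g 4" "f 5 = g 5" "f 6 = g 6" "f 7 = g 7"
    "\<And>j. \<not> j < 8 \<Longrightarrow> f j = g j"
  shows "f = (g :: nat \<Rightarrow> 'a)"
proof (rule ext)
  fix j show "f j = g j"
  proof (cases "j < 8")
    case True
    then show ?thesis unfolding less_8_cases by (elim disjE) (simp_all only: assms)
  qed (rule assms)
qed

lemma sum_less_8: "(\<Sum>i<8. f i) = f 0 + f 1 + f 2 + f 3 + f 4 + f 5 + f 6 + f 7"
  for f :: "nat \<Rightarrow> 'a::comm_monoid_add"
  by (simp add: eval_nat_numeral)

lemma MN_basic: "well_formed M_mod" "rdim M_mod = 8" "well_formed N_mod" "rdim N_mod = 8"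
  by (auto simp: M_mod_def N_mod_def well_formed_def rdim_def op_mat_def)

lemma M_ops:
  "opA M_mod x = (\<lambda>j. if j \<in> {1,2,3,5,6,7} then x (j - 1) else 0)"
  "opB M_mod x = (\<lambda>j. if j \<in> {0,1,5,6} then x (j + 1) else if j \<in> {2,3} then x (j + 2) else 0)"
  "opC M_mod x = (\<lambda>j. if j \<in> {0,2,5,7} then x j else 0)"
  by (rule ext_below_8; auto simp: M_mod_def act_op_mat sum_less_8 simp flip: numeral_2_eq_2)+

lemma N_ops:
  "opA N_mod x = (\<lambda>j. if j \<in> {1,2,3,5,6,7} then x (j - 1) else 0)"
  "opB N_mod x = (\<lambda>j. if j \<in> {1,2} then x (j + 1) + x (j + 4) else if j \<in> {0,3} then x (j + 4)
     else if j \<in> {4,5} then x (j + 1) else 0)"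
  "opC N_mod x = (\<lambda>j. if j \<in> {1,3,4,6} then x j else 0)"
  by (rule ext_below_8; auto simp: N_mod_def act_op_mat sum_less_8 simp flip: numeral_2_eq_2)+

lemma less_4_cases: "(a::nat) < 4 \<longleftrightarrow> a = 0 \<or> a = 1 \<or> a = 2 \<or> a = 3"
  by auto

text \<open>The generator is \<open>w_1\<close> at position 4, so \<open>w_1, ..., w_4\<close> run
  through X0, X1, X2, X3 with index 0. The vectors \<open>v_1, ..., v_4\<close> run through X1, X2,
  X3, X0 with index 1, and \<open>v_4 = s p w_1\<close>.\<close>

lemma M_frame:
  assumes "CHAR('k::field) = 2"
  shows "has_frame (M_mod :: 'k rep) 2 2 (el 0 0) (el 1 0) (el 1 0) (el 1 1)"
proof (rule positional_frame[where n = 8 and cl = "\<lambda>j. if j < 4 then (j + 1) mod 4 else j mod 4" and ix = "\<lambda>j. if j < 4 then 1 else 0"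
      and pos = "\<lambda>a i. if i = 0 then 4 + a else if a = 0 then 3 else a - 1"])
  show "CHAR('k) = 2" by fact
  show "data_rel 2 2 (el 0 0) (el 1 0) (el 1 0) (el 1 1 :: (nat \<Rightarrow> 'k) \<Rightarrow> _)" by (rule top_data_rel)
next
  fix a i :: nat assume "a < 4" "i < (if a = 0 then 2 else 2)"
  then show "(if i = 0 then 4 + a else if a = 0 then 3 else a - 1) < 8 \<and>
      (if (if i = 0 then 4 + a else if a = 0 then 3 else a - 1) < 4
       then ((if i = 0 then 4 + a else if a = 0 then 3 else a - 1) + 1) mod 4
       else (if i = 0 then 4 + a else if a = 0 then 3 else a - 1) mod 4) = a \<and>
      (if (if i = 0 then 4 + a else if a = 0 then 3 else a - 1) < 4 then 1 else 0) = i"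
    by (auto simp: less_4_cases less_2_cases_simp)
next
  fix j :: nat assume "j < 8"
  then show "(if j < 4 then (j + 1) mod 4 else j mod 4) < 4 \<and>
      (if j < 4 then 1 else 0) < (if (if j < 4 then (j + 1) mod 4 else j mod 4) = 0 then 2 else (2::nat)) \<and>
      (if (if j < 4 then 1 else (0::nat)) = 0 then 4 + (if j < 4 then (j + 1) mod 4 else j mod 4)
       else if (if j < 4 then (j + 1) mod 4 else j mod 4) = 0 then 3 else (if j < 4 then (j + 1) mod 4 else j mod 4) - 1) = j"
    by (auto simp: less_8_cases simp flip: numeral_2_eq_2)
qed (rule MN_basic | (rule ext_below_8; auto simp: M_ops emb_def el_def))+

text \<open>The generator \<open>w_1\<close> at position 4 now lies in X1, and both
  \<open>v_1\<close> and \<open>w_4\<close> lie in X0. The summands \<open>v_2\<close> in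
  \<open>b w_2\<close> and \<open>v_3\<close> in \<open>b w_3\<close> are the term
  \<open>p s\<close> of the frame, which among the listed modules is nonzero only here.\<close>

lemma N_frame:
  assumes "CHAR('k::field) = 2"
  shows "has_frame (N_mod :: 'k rep) 2 2 (el 1 0) (el 1 1) (el 0 0) (el 1 0)"
proof (rule positional_frame[where n = 8 and cl = "\<lambda>j. if j < 4 then j else (j - 3) mod 4"
      and ix = "\<lambda>j. if j = 0 then 0 else if j < 4 \<or> j = 7 then 1 else 0"
      and pos = "\<lambda>a i. if a = 0 then 7 * i else if i = 0 then 3 + a else a"])
  show "CHAR('k) = 2" by fact
  show "data_rel 2 2 (el 1 0) (el 1 1) (el 0 0) (el 1 0 :: (nat \<Rightarrow> 'k) \<Rightarrow> _)"
    using top_data_rel data_swap(1) by blast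
next
  fix a i :: nat assume "a < 4" "i < (if a = 0 then 2 else 2)"
  then show "(if a = 0 then 7 * i else if i = 0 then 3 + a else a) < 8 \<and>
      (if (if a = 0 then 7 * i else if i = 0 then 3 + a else a) < 4 then (if a = 0 then 7 * i else if i = 0 then 3 + a else a)
       else ((if a = 0 then 7 * i else if i = 0 then 3 + a else a) - 3) mod 4) = a \<and>
      (if (if a = 0 then 7 * i else if i = 0 then 3 + a else a) = 0 then 0
       else if (if a = 0 then 7 * i else if i = 0 then 3 + a else a) < 4 \<or> (if a = 0 then 7 * i else if i = 0 then 3 + a else a) = 7 then 1 else 0) = i"
    by (auto simp: less_4_cases less_2_cases_simp)
next
  fix j :: nat assume "j < 8"
  then show "(if j < 4 then j else (j - 3) mod 4) < 4 \<and>
      (if j = 0 then 0 else if j < 4 \<or> j = 7 then 1 else 0) < (if (if j < 4 then j else (j - 3) mod 4) = 0 then 2 else (2::nat)) \<and>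
      (if (if j < 4 then j else (j - 3) mod 4) = 0 then 7 * (if j = 0 then 0 else if j < 4 \<or> j = 7 then 1 else 0)
       else if (if j = 0 then 0 else if j < 4 \<or> j = 7 then 1 else (0::nat)) = 0 then 3 + (if j < 4 then j else (j - 3) mod 4)
       else (if j < 4 then j else (j - 3) mod 4)) = j"
    by (auto simp: less_8_cases simp flip: numeral_2_eq_2)
qed (rule MN_basic | (rule ext_below_8; auto simp: N_ops emb_def el_def))+

section \<open>Simple modules and projective covers\<close>

lemma submod_as_predicate:
  fixes X :: "'k::field rep"
  assumes wf: "well_formed X" and W: "is_submod X W"
  defines "P \<equiv> \<lambda>x. vec (rdim X) x \<in> W"
  shows "P 0" "\<And>x z. P x \<Longrightarrow> P z \<Longrightarrow> P (x + z)" "\<And>s x. P x \<Longrightarrow> P (\<lambda>i. s * x i)"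
    "\<And>x. P x \<Longrightarrow> P (opA X x)" "\<And>x. P x \<Longrightarrow> P (opB X x)" "\<And>x. P x \<Longrightarrow> P (opC X x)"
    "\<And>x. P (restr (rdim X) x) \<Longrightarrow> P x"
    "(\<And>j. j < rdim X \<Longrightarrow> P (unit j)) \<Longrightarrow> W = carrier_vec (rdim X)"
    "W \<subseteq> carrier_vec (rdim X)"
proof -
  let ?n = "rdim X"
  obtain A B C where X: "X = (A, B, C)" by (cases X)
  define n where "n = rdim X"
  have c: "A \<in> carrier_mat n n" "B \<in> carrier_mat n n" "C \<in> carrier_mat n n"
    using well_formed_carrier[OF wf] unfolding X n_def by auto
  have W': "W \<subseteq> carrier_vec n" "0\<^sub>v n \<in> W" "\<And>v w. v \<in> W \<Longrightarrow> w \<in> W \<Longrightarrow> v + w \<in> W" "\<And>s v. v \<in> W \<Longrightarrow> s \<cdot>\<^sub>v v \<in> W"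
    "\<And>v. v \<in> W \<Longrightarrow> A *\<^sub>v v \<in> W" "\<And>v. v \<in> W \<Longrightarrow> B *\<^sub>v v \<in> W" "\<And>v. v \<in> W \<Longrightarrow> C *\<^sub>v v \<in> W"
    using W unfolding X n_def is_submod_def by auto
  show "W \<subseteq> carrier_vec (rdim X)" using W'(1) by (simp add: n_def)
  have v: "vec n (act M x) = M *\<^sub>v vec n x" if "M \<in> carrier_mat n n" for M x
    using that by (intro eq_vecI) (auto simp: act_def scalar_prod_def lessThan_atLeast0)
  have Pdef: "P x \<longleftrightarrow> vec n x \<in> W" for x by (simp add: P_def n_def)
  show "P 0"
  proof -
    have "vec n (0 :: nat \<Rightarrow> 'k) = 0\<^sub>v n" by (intro eq_vecI) auto
    then show ?thesis using W'(2) by (simp add: Pdef)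
  qed
  show add: "P (x + z)" if "P x" "P z" for x z
  proof -
    have "vec n (x + z) = vec n x + vec n z" by (intro eq_vecI) auto
    then show ?thesis using W'(3) that by (simp add: Pdef)
  qed
  show scale: "P (\<lambda>i. s * x i)" if "P x" for s x
  proof -
    have "vec n (\<lambda>i. s * x i) = s \<cdot>\<^sub>v vec n x" by (intro eq_vecI) auto
    then show ?thesis using W'(4) that by (simp add: Pdef)
  qed
  show "P (opA X x)" "P (opB X x)" "P (opC X x)" if "P x" for x
    using W'(5-7) that c by (simp_all add: Pdef X v)
  have vr: "vec n (restr n x) = vec n x" for x :: "nat \<Rightarrow> 'k" by (intro eq_vecI) (auto simp: restr_def)
  show "P x" if "P (restr (rdim X) x)" for x using that vr by (simp add: Pdef n_def)
  assume u: "\<And>j. j < rdim X \<Longrightarrow> P (unit j)"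
  have "P x" for x
  proof -
    have "P (restr l x)" if "l \<le> n" for l
      using that
    proof (induction l)
      case 0
      show ?case unfolding restr_simps by (rule \<open>P 0\<close>)
    next
      case (Suc l)
      have "restr (Suc l) x = restr l x + (\<lambda>i. x l * unit l i)"
        by (auto simp: restr_def fun_eq_iff less_Suc_eq)
      then show ?case using Suc u[of l] by (simp only: add scale n_def Suc_le_eq less_imp_le)
    qed
    from this[of n] show ?thesis using vr by (simp add: Pdef)
  qed
  then have PW: "vec n x \<in> W" for x by (simp add: Pdef)
  have "w \<in> W" if "w \<in> carrier_vec n" for w
  proof -
    have "vec n (\<lambda>i. w $ i) = w" using that by (intro eq_vecI) auto
    then show ?thesis using PW by metis
  qed
  then show "W = carrier_vec (rdim X)" using W'(1) by (auto simp: n_def)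
qed

lemma op_mat_cong:
  "(\<And>i j. i < d \<Longrightarrow> j < d \<Longrightarrow> f (Suc i) (Suc j) = g (Suc i) (Suc j)) \<Longrightarrow> op_mat d f = op_mat d g"
  by (auto simp: op_mat_def intro!: eq_matI)

lemma gen_mod_cong:
  assumes "\<And>i. 0 < i \<Longrightarrow> i \<le> d \<Longrightarrow> (i < d \<longrightarrow> \<kappa> i = \<kappa>' i) \<and> (1 < i \<longrightarrow> \<mu> i = \<mu>' i) \<and> \<nu> i = \<nu>' i"
    "\<And>i. lam = 0 \<and> lam' = 0 \<or> lam = lam' \<and> \<xi> i = \<xi>' i"
  shows "gen_mod d \<kappa> \<mu> \<xi> lam \<nu> = gen_mod d \<kappa>' \<mu>' \<xi>' lam' \<nu>'"
proof -
  have 1: "(if P \<and> \<xi> i then lam else 0) = (if P \<and> \<xi>' i then lam' else 0)" for P i using assms(2)[of i] by auto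
  show ?thesis unfolding gen_mod_def 1
    by (intro arg_cong2[of _ _ _ _ Pair] op_mat_cong arg_cong2[of _ _ _ _ "(+)"] refl) (use assms(1) in \<open>auto simp: of_bool_def\<close>)
qed

text \<open>The simple modules are the members \<open>r = 0\<close> of the U-families, which is why
  the list requires \<open>r \<ge> 1\<close>.\<close>

lemma V0_eq: "V0 = U_mod 1 0" "V0 = U_mod 4 0"
  by (auto simp: V0_def U_mod_def string_mod_def gen_mod_def op_mat_def intro!: eq_matI)

lemma V1_eq: "V1 = U_mod 2 0" "V1 = U_mod 3 0"
proof -
  have 3: "(i::nat) = 1 \<or> i = 2 \<or> i = 3" if "0 < i" "i \<le> 3" for i using that by auto
  show "V1 = U_mod 2 0" "V1 = U_mod 3 0"
    by (auto simp: V1_def U_mod_def string_mod_def intro!: gen_mod_cong dest!: 3)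
qed

text \<open>At eigenvalue 0 a band degenerates to a string; this is why the list requires
  \<open>lam \<noteq> 0\<close>.\<close>

lemma V1_W1_eq: "V_mod 1 t = A_band 0 (Suc t)" "W_mod 1 t = B_band 0 (Suc t)"
  by (auto simp: V_mod_def W_mod_def A_band_def B_band_def string_mod_def intro!: gen_mod_cong)

lemma V1_ops:
  "opA V1 x = (\<lambda>j. if j = 1 \<or> j = 2 then x (j - 1) else 0)"
  "opB V1 x = (\<lambda>j. if j = 0 \<or> j = 1 then x (j + 1) else 0)"
  "opC V1 x = (\<lambda>j. if j = 0 \<or> j = 2 then x j else 0)"
  "well_formed V1" "rdim V1 = 3"
proof -
  have "(i::nat) < 3 \<longleftrightarrow> i = 0 \<or> i = 1 \<or> i = 2" for i by auto
  then show "opA V1 x = (\<lambda>j. if j = 1 \<or> j = 2 then x (j - 1) else 0)"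
    "opB V1 x = (\<lambda>j. if j = 0 \<or> j = 1 then x (j + 1) else 0)"
    "opC V1 x = (\<lambda>j. if j = 0 \<or> j = 2 then x j else 0)"
    unfolding V1_def string_mod_def gen_mod_ops by (auto simp: fun_eq_iff)
qed (simp_all add: V1_def string_mod_def gen_mod_basic)

lemma V0_simple:
  assumes "CHAR('k::field) = 2"
  shows "simple_mod (V0 :: 'k rep)"
  unfolding simple_mod_def
proof (intro conjI allI impI)
  show "is_umod (V0 :: 'k rep)" using has_frame_umod[OF U1_frame[OF assms]] V0_eq(1) by metis
  show "rdim (V0 :: 'k rep) > 0" by (simp add: V0_def rdim_def)
  have r: "rdim (V0 :: 'k rep) = 1" by (simp add: V0_def rdim_def)
  fix W assume W: "is_submod (V0 :: 'k rep) W"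
  have wf: "well_formed (V0 :: 'k rep)" by (simp add: V0_def well_formed_def rdim_def)
  note P = submod_as_predicate[OF wf W, unfolded r]
  show "W = {0\<^sub>v (rdim (V0 :: 'k rep))} \<or> W = carrier_vec (rdim (V0 :: 'k rep))"
  proof (cases "W \<subseteq> {0\<^sub>v 1}")
    case True
    have "vec 1 (0 :: nat \<Rightarrow> 'k) = 0\<^sub>v 1" by (intro eq_vecI) auto
    then show ?thesis using True P(1) r by auto
  next
    case False
    then obtain w where w: "w \<in> W" "w \<noteq> 0\<^sub>v 1" by blast
    have wc: "w \<in> carrier_vec 1" using w(1) P(9) by blast
    have w0: "w $ 0 \<noteq> 0"
    proof
      assume "w $ 0 = 0"
      then have "w = 0\<^sub>v 1" using wc by (intro eq_vecI) auto
      then show False using w(2) by simp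
    qed
    have "vec 1 (\<lambda>i. w $ i) = w" using wc by (intro eq_vecI) auto
    then have "vec 1 (\<lambda>i. 1 / (w $ 0) * w $ i) \<in> W" using P(3)[of "\<lambda>i. w $ i" "1 / (w $ 0)"] w(1) by simp
    moreover have "vec 1 (\<lambda>i. 1 / (w $ 0) * w $ i) = vec 1 (unit 0)" using w0 by (intro eq_vecI) auto
    ultimately have "vec 1 (unit 0) \<in> W" by simp
    then have "W = carrier_vec 1" by (intro P(8)) simp
    then show ?thesis using r by simp
  qed
qed

text \<open>For \<open>x \<noteq> 0\<close> in a submodule, one of \<open>a c x\<close>,
  \<open>b c x\<close> and \<open>x - c x\<close> is a nonzero multiple of the middle basis vector,
  from which \<open>a\<close> and \<open>b\<close> produce the other two.\<close>

lemma V1_simple: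
  assumes "CHAR('k::field) = 2"
  shows "simple_mod (V1 :: 'k rep)"
  unfolding simple_mod_def
proof (intro conjI allI impI)
  show "is_umod (V1 :: 'k rep)" using has_frame_umod[OF U2_frame[OF assms]] V1_eq(1) by metis
  show "rdim (V1 :: 'k rep) > 0" by (simp add: V1_ops)
  fix W assume W: "is_submod (V1 :: 'k rep) W"
  define P where "P x \<longleftrightarrow> vec 3 x \<in> W" for x
  note S = submod_as_predicate[OF V1_ops(4) W, unfolded V1_ops(5), folded P_def]
  show "W = {0\<^sub>v (rdim (V1 :: 'k rep))} \<or> W = carrier_vec (rdim (V1 :: 'k rep))"
  proof (cases "W \<subseteq> {0\<^sub>v 3}")
    case True
    have "vec 3 (0 :: nat \<Rightarrow> 'k) = 0\<^sub>v 3" by (intro eq_vecI) auto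
    then have "W = {0\<^sub>v 3}" using True S(1) by (auto simp: P_def)
    then show ?thesis by (simp add: V1_ops(5))
  next
    case False
    then obtain w where w: "w \<in> W" "w \<noteq> 0\<^sub>v 3" by blast
    have wc: "w \<in> carrier_vec 3" using w(1) S(9) by blast
    define x where "x i = w $ i" for i
    have "vec 3 x = w" using wc by (intro eq_vecI) (auto simp: x_def)
    then have Px: "P x" using w(1) by (simp add: P_def)
    have nz: "x 0 \<noteq> 0 \<or> x 1 \<noteq> 0 \<or> x 2 \<noteq> 0"
    proof (rule ccontr)
      assume "\<not> ?thesis"
      then have "w $ i = 0" if "i < 3" for i
      proof -
        have "i = 0 \<or> i = 1 \<or> i = 2" using that by auto
        then show ?thesis using \<open>\<not> (x 0 \<noteq> 0 \<or> x 1 \<noteq> 0 \<or> x 2 \<noteq> 0)\<close> by (auto simp: x_def)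
      qed
      then have "w = 0\<^sub>v 3" using wc by (intro eq_vecI) auto
      then show False using w(2) by simp
    qed
    have un: "P (unit 1)" if "P z" "restr 3 z = (\<lambda>i. c * unit 1 i)" "c \<noteq> 0" for z c
    proof -
      have "restr 3 (\<lambda>i. 1 / c * z i) = restr 3 (unit 1)"
        unfolding restr_scale that(2) using that(3) by (auto simp: restr_def fun_eq_iff)
      moreover have "P (\<lambda>i. 1 / c * z i)" using S(3) that(1) .
      moreover have "P z \<Longrightarrow> P (restr 3 z)" for z :: "nat \<Rightarrow> 'k" using S(7)[of "restr 3 z"] S(7)
      proof -
        assume "P z"
        have "vec 3 (restr 3 z) = vec 3 z" by (intro eq_vecI) (auto simp: restr_def)
        then show ?thesis using \<open>P z\<close> by (simp add: P_def)
      qed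
      ultimately show ?thesis using S(7) by metis
    qed
    have "P (unit 1)" using nz
    proof (elim disjE)
      assume "x 0 \<noteq> 0"
      then show ?thesis
        by (intro un[of "opA V1 (opC V1 x)" "x 0"] S(4,6) Px) (auto simp: V1_ops restr_def fun_eq_iff)
    next
      assume "x 2 \<noteq> 0"
      then show ?thesis
        by (intro un[of "opB V1 (opC V1 x)" "x 2"] S(5,6) Px) (auto simp: V1_ops restr_def fun_eq_iff simp flip: numeral_2_eq_2)
    next
      assume "x 1 \<noteq> 0"
      then show ?thesis
        by (intro un[of "x + (\<lambda>i. - 1 * opC V1 x i)" "x 1"] S(2,3,6) Px)
          (auto simp: V1_ops restr_def fun_eq_iff less_Suc_eq numeral_3_eq_3)
    qed
    then have "P (opA V1 (unit 1))" "P (opB V1 (unit 1))" using S(4,5) by blast+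
    moreover have "opA V1 (unit 1) = (unit 2 :: nat \<Rightarrow> 'k)" "opB V1 (unit 1) = (unit 0 :: nat \<Rightarrow> 'k)"
      by (auto simp: V1_ops fun_eq_iff)
    ultimately have "P (unit j)" if "j < 3" for j
    proof -
      have "j = 0 \<or> j = 1 \<or> j = 2" using that by auto
      then show ?thesis using \<open>P (unit 1)\<close> \<open>P (opA V1 (unit 1))\<close> \<open>P (opB V1 (unit 1))\<close>
          \<open>opA V1 (unit 1) = unit 2\<close> \<open>opB V1 (unit 1) = unit 0\<close> by auto
    qed
    then show ?thesis using S(8) V1_ops(5) by metis
  qed
qed

lemma mat_of_mult_vec:
  assumes "lin m n f" shows "mat_of m n f *\<^sub>v vec m x = vec n (f x)"
proof (rule eq_vecI)
  fix i assume "i < dim_vec (vec n (f x))"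
  then have i: "i < n" by simp
  have "act (mat_of m n f) x i = f x i" using act_mat_of[OF assms] by simp
  then show "(mat_of m n f *\<^sub>v vec m x) $ i = vec n (f x) $ i"
    using i by (simp add: act_def mat_of_def scalar_prod_def lessThan_atLeast0)
qed (simp add: mat_of_def)

text \<open>A submodule \<open>W\<close> with \<open>W + ker f = P\<close> contains some
  \<open>x\<close> with \<open>f x = f x0\<close>. It is everything as soon as each such
  \<open>x\<close> generates \<open>P\<close>; that is the hypothesis on predicates \<open>Q\<close>
  closed under the module operations.\<close>

lemma projective_coverI:
  fixes P S :: "'k::field rep"
  assumes proj: "projective_mod P" and S: "is_umod S" and f: "hm P S f" and g: "\<And>w. f (g w) = restr (rdim S) w"
    and gen: "\<And>Q x. Q x \<Longrightarrow> restr (rdim P) x = x \<Longrightarrow> f x = f x0 \<Longrightarrow> Q 0 \<Longrightarrow> (\<And>x z. Q x \<Longrightarrow> Q z \<Longrightarrow> Q (x + z)) \<Longrightarrow>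
       (\<And>s x. Q x \<Longrightarrow> Q (\<lambda>i. s * x i)) \<Longrightarrow> (\<And>x. Q x \<Longrightarrow> Q (opA P x)) \<Longrightarrow> (\<And>x. Q x \<Longrightarrow> Q (opB P x)) \<Longrightarrow>
       (\<And>x. Q x \<Longrightarrow> Q (opC P x)) \<Longrightarrow> (\<And>j. j < rdim P \<Longrightarrow> Q (unit j))"
  shows "projective_cover P S"
proof -
  have wf: "well_formed P" and lf: "lin (rdim P) (rdim S) f" using f unfolding hm_def by auto
  let ?F = "mat_of (rdim P) (rdim S) f"
  have vv: "w = vec n (\<lambda>i. w $ i)" if "w \<in> carrier_vec n" for w :: "'k vec" and n using that by (intro eq_vecI) auto
  have "surj_mat ?F" unfolding surj_mat_def
  proof
    fix w :: "'k vec" assume "w \<in> carrier_vec (dim_row ?F)"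
    then have w: "w \<in> carrier_vec (rdim S)" by (simp add: mat_of_def)
    have "?F *\<^sub>v vec (rdim P) (g (\<lambda>i. w $ i)) = vec (rdim S) (\<lambda>i. w $ i)"
      unfolding mat_of_mult_vec[OF lf] g by (intro eq_vecI) (auto simp: restr_def)
    then show "\<exists>v\<in>carrier_vec (dim_col ?F). ?F *\<^sub>v v = w" using vv[OF w]
      by (intro bexI[of _ "vec (rdim P) (g (\<lambda>i. w $ i))"]) (auto simp: mat_of_def)
  qed
  moreover have "W = carrier_vec (rdim P)" if W: "is_submod P W"
    "\<And>v. v \<in> carrier_vec (rdim P) \<Longrightarrow> \<exists>w\<in>W. \<exists>k\<in>carrier_vec (rdim P). ?F *\<^sub>v k = 0\<^sub>v (rdim S) \<and> v = w + k" for W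
  proof -
    note s = submod_as_predicate[OF wf W(1)]
    obtain w k where w: "w \<in> W" "k \<in> carrier_vec (rdim P)" "?F *\<^sub>v k = 0\<^sub>v (rdim S)" "vec (rdim P) x0 = w + k"
      using W(2)[of "vec (rdim P) x0"] by auto
    have wc: "w \<in> carrier_vec (rdim P)" using w(1) s(9) by blast
    define x y where "x i = (if i < rdim P then w $ i else 0)" and "y i = (if i < rdim P then k $ i else 0)" for i
    have x: "vec (rdim P) x = w" "vec (rdim P) y = k" using wc w(2) by (auto simp: x_def y_def)
    have "vec (rdim S) (f y) = 0\<^sub>v (rdim S)" using w(3) unfolding x(2)[symmetric] mat_of_mult_vec[OF lf] .
    then have "f y i = 0" if "i < rdim S" for i using that by (metis index_vec index_zero_vec(1))
    then have "restr (rdim S) (f y) = 0" by (auto simp: restr_def fun_eq_iff)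
    then have fy: "f y = 0" by (simp add: restr_lin[OF lf])
    have "restr (rdim P) x0 = x + y"
    proof (rule ext)
      fix i show "restr (rdim P) x0 i = (x + y) i"
        using arg_cong[OF w(4), of "\<lambda>v. v $ i"] wc w(2) by (cases "i < rdim P") (auto simp: restr_def x_def y_def)
    qed
    then have "f x0 = f (x + y)" using lin_restr[OF lf] by metis
    then have fx: "f x = f x0" by (simp add: lin_add[OF lf] fy)
    have xr: "restr (rdim P) x = x" by (auto simp: x_def restr_def)
    show ?thesis
      by (rule s(8), rule gen[of "\<lambda>x. vec (rdim P) x \<in> W" x]) (use w(1) x(1) xr fx s(1-6) in simp_all)
  qed
  ultimately show ?thesis unfolding projective_cover_def using proj S hm_imp_is_hom[OF f] by blast
qed

lemma M_cover:
  assumes "CHAR('k::field) = 2"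
  shows "projective_cover (M_mod :: 'k rep) V0"
proof -
  define f where "f x = (\<lambda>i::nat. if i = 0 then x (4::nat) else 0)" for x :: "nat \<Rightarrow> 'k"
  have V0: "well_formed (V0 :: 'k rep)" "rdim (V0 :: 'k rep) = 1" by (auto simp: V0_def well_formed_def rdim_def)
  have V0ops: "opA (V0 :: 'k rep) x = 0" "opB (V0 :: 'k rep) x = 0" "opC (V0 :: 'k rep) x = 0" for x
    by (auto simp: V0_def)
  show ?thesis
  proof (rule projective_coverI[where f = f and g = "\<lambda>w i. if i = 4 then w 0 else 0" and ?x0.0 = "unit 4"])
    show "projective_mod (M_mod :: 'k rep)" using frame_projective[OF assms M_frame[OF assms] top_proj] .
    show "is_umod (V0 :: 'k rep)" using has_frame_umod[OF U1_frame[OF assms]] V0_eq(1) by metis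
    have "lin 8 1 f" by (rule linI) (auto simp: f_def restr_def fun_eq_iff)
    then show "hm (M_mod :: 'k rep) V0 f"
      unfolding hm_def using V0 by (auto simp: MN_basic V0ops M_ops f_def fun_eq_iff)
    show "f (\<lambda>i. if i = 4 then w 0 else 0) = restr (rdim (V0 :: 'k rep)) w" for w
      by (auto simp: f_def V0 restr_def fun_eq_iff)
    fix Q and x :: "nat \<Rightarrow> 'k" and j
    let ?a = "opA (M_mod :: 'k rep)" and ?b = "opB (M_mod :: 'k rep)" and ?c = "opC (M_mod :: 'k rep)"
    assume Qx: "Q x" and xr: "restr (rdim (M_mod :: 'k rep)) x = x" and fx: "f x = f (unit 4)" and add: "\<And>x z. Q x \<Longrightarrow> Q z \<Longrightarrow> Q (x + z)"
      and scale: "\<And>s x. Q x \<Longrightarrow> Q (\<lambda>i. s * x i)" and ops: "\<And>x. Q x \<Longrightarrow> Q (?a x)" "\<And>x. Q x \<Longrightarrow> Q (?b x)" "\<And>x. Q x \<Longrightarrow> Q (?c x)"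
      and j: "j < rdim (M_mod :: 'k rep)"
    have x4: "x 4 = 1" using fun_cong[OF fx, of 0] by (simp add: f_def)
    have x8: "x i = 0" if "\<not> i < 8" for i using fun_cong[OF xr, of i] that by (simp add: restr_def MN_basic)
    \<comment> \<open>\<open>(1 - abab)(1 - c)\<close> projects onto X0, where \<open>x\<close> has
      the component \<open>w_1\<close> plus a multiple of \<open>v_4\<close>. Since
      \<open>ab\<close> sends this component to \<open>v_4\<close>, the multiple can be
      subtracted.\<close>
    define z where "z = x + (\<lambda>i. - 1 * ?c x i)"
    define z' where "z' = z + (\<lambda>i. - 1 * ?a (?b (?a (?b z))) i)"
    have Qz': "Q z'" unfolding z'_def z_def by (intro ops add scale Qx)
    have "?a (?b z') = unit 3"
      unfolding z'_def z_def by (rule ext_below_8; simp add: M_ops x4)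
    then have Q3: "Q (unit 3)" using Qz' ops by metis
    have "unit 4 = z' + (\<lambda>i. - x 3 * unit 3 i)"
      unfolding z'_def z_def by (rule ext_below_8; simp add: M_ops x4 x8)
    then have Q4: "Q (unit 4)" using add[OF Qz' scale[OF Q3]] by metis
    have e: "?a (unit 4) = unit 5" "?a (unit 5) = unit 6" "?a (unit 6) = unit 7" "?b (unit 4) = unit 2" "?b (unit 2) = unit 1" "?b (unit 1) = unit 0"
      by (rule ext_below_8; simp add: M_ops)+
    have "Q (unit 5)" "Q (unit 2)" using ops Q4 e by metis+
    moreover from this have "Q (unit 6)" "Q (unit 1)" using ops e by metis+
    moreover from this have "Q (unit 7)" "Q (unit 0)" using ops e by metis+
    ultimately show "Q (unit j)" using j Q3 Q4 by (auto simp: MN_basic less_8_cases)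
  qed
qed

lemma N_cover:
  assumes "CHAR('k::field) = 2"
  shows "projective_cover (N_mod :: 'k rep) V1"
proof -
  define f where "f x = (\<lambda>i::nat. if i < 3 then x (4 + i) else 0)" for x :: "nat \<Rightarrow> 'k"
  show ?thesis
  proof (rule projective_coverI[where f = f and g = "\<lambda>w i. if 4 \<le> i \<and> i < 7 then w (i - 4) else 0" and ?x0.0 = "unit 4"])
    show "projective_mod (N_mod :: 'k rep)"
      using frame_projective[OF assms N_frame[OF assms] data_proj_swap[OF top_proj]] .
    show "is_umod (V1 :: 'k rep)" using has_frame_umod[OF U2_frame[OF assms]] V1_eq(1) by metis
    have "lin 8 3 f" by (rule linI) (auto simp: f_def restr_def fun_eq_iff)
    then show "hm (N_mod :: 'k rep) V1 f"
      unfolding hm_def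
      by (simp add: MN_basic V1_ops N_ops f_def) (auto simp: fun_eq_iff)
    show "f (\<lambda>i. if 4 \<le> i \<and> i < 7 then w (i - 4) else 0) = restr (rdim (V1 :: 'k rep)) w" for w
      by (auto simp: f_def V1_ops restr_def fun_eq_iff)
    fix Q and x :: "nat \<Rightarrow> 'k" and j
    let ?a = "opA (N_mod :: 'k rep)" and ?b = "opB (N_mod :: 'k rep)" and ?c = "opC (N_mod :: 'k rep)"
    assume Qx: "Q x" and xr: "restr (rdim (N_mod :: 'k rep)) x = x" and fx: "f x = f (unit 4)" and add: "\<And>x z. Q x \<Longrightarrow> Q z \<Longrightarrow> Q (x + z)"
      and scale: "\<And>s x. Q x \<Longrightarrow> Q (\<lambda>i. s * x i)" and ops: "\<And>x. Q x \<Longrightarrow> Q (?a x)" "\<And>x. Q x \<Longrightarrow> Q (?b x)" "\<And>x. Q x \<Longrightarrow> Q (?c x)"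
      and j: "j < rdim (N_mod :: 'k rep)"
    have x4: "x 4 = 1" "x 5 = 0" "x 6 = 0" using fun_cong[OF fx, of 0] fun_cong[OF fx, of 1] fun_cong[OF fx, of 2] by (auto simp: f_def)
    have x8: "x i = 0" if "\<not> i < 8" for i using fun_cong[OF xr, of i] that by (simp add: restr_def MN_basic)
    \<comment> \<open>\<open>(1 - abab) c\<close> projects onto X1, where \<open>x\<close> has the
      component \<open>w_1\<close> plus a multiple of \<open>v_2\<close>; \<open>ab\<close>, being
      \<open>p s\<close> there, sends it to \<open>v_2\<close>.\<close>
    define z where "z = ?c x"
    define z' where "z' = z + (\<lambda>i. - 1 * ?a (?b (?a (?b z))) i)"
    have Qz': "Q z'" unfolding z'_def z_def by (intro ops add scale Qx)
    have "?a (?b z') = unit 1"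
      unfolding z'_def z_def by (rule ext_below_8; simp add: N_ops x4)
    then have Q1: "Q (unit 1)" using Qz' ops by metis
    have "unit 4 = z' + (\<lambda>i. - x 1 * unit 1 i)"
      unfolding z'_def z_def by (rule ext_below_8; simp add: N_ops x4 x8)
    then have Q4: "Q (unit 4)" using add[OF Qz' scale[OF Q1]] by metis
    have e: "?a (unit 4) = unit 5" "?a (unit 5) = unit 6" "?a (unit 6) = unit 7" "?b (unit 4) = unit 0" "?a (unit 1) = unit 2" "?a (unit 2) = unit 3"
      by (rule ext_below_8; simp add: N_ops)+
    have "Q (unit 5)" "Q (unit 0)" "Q (unit 2)" using ops Q1 Q4 e by metis+
    moreover from this have "Q (unit 6)" "Q (unit 3)" using ops e by metis+
    moreover from this have "Q (unit 7)" using ops e by metis+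
    ultimately show "Q (unit j)" using j Q1 Q4 by (auto simp: MN_basic less_8_cases)
  qed
qed

section \<open>The classification\<close>

theorem theorem4p1:
  assumes "CHAR('k::alg_closed_field) = 2"
  shows "simple_mod (V0 :: 'k rep) \<and> simple_mod (V1 :: 'k rep) \<and>
         projective_cover (M_mod :: 'k rep) V0 \<and> projective_cover (N_mod :: 'k rep) V1 \<and>
         (\<forall>X :: 'k rep. indecomposable X \<longleftrightarrow>
            (mod_iso X V0 \<or> mod_iso X V1 \<or> mod_iso X M_mod \<or> mod_iso X N_mod \<or>
             (\<exists>i \<in> {1,2,3,4}. \<exists>r \<ge> 1. mod_iso X (U_mod i r)) \<or>
             (\<exists>j \<in> {1,2}. \<exists>t. mod_iso X (V_mod j t) \<or> mod_iso X (W_mod j t)) \<or>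
             (\<exists>n \<ge> 1. \<exists>lam. lam \<noteq> 0 \<and> (mod_iso X (A_band lam n) \<or> mod_iso X (B_band lam n)))))"
proof (intro conjI allI)
  note char = assms
  show "simple_mod (V0 :: 'k rep)" "simple_mod (V1 :: 'k rep)" using V0_simple[OF char] V1_simple[OF char] .
  show "projective_cover (M_mod :: 'k rep) V0" "projective_cover (N_mod :: 'k rep) V1"
    using M_cover[OF char] N_cover[OF char] .
  fix X :: "'k rep"
  let ?listed = "mod_iso X V0 \<or> mod_iso X V1 \<or> mod_iso X M_mod \<or> mod_iso X N_mod \<or>
             (\<exists>i \<in> {1,2,3,4}. \<exists>r \<ge> 1. mod_iso X (U_mod i r)) \<or>
             (\<exists>j \<in> {1,2}. \<exists>t. mod_iso X (V_mod j t) \<or> mod_iso X (W_mod j t)) \<or>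
             (\<exists>n \<ge> 1. \<exists>lam. lam \<noteq> 0 \<and> (mod_iso X (A_band lam n) \<or> mod_iso X (B_band lam n)))"
  have U: ?listed if "mod_iso X (U_mod i r)" "i \<in> {1,2,3,4}" for i r
  proof (cases "r = 0")
    case True
    then have "mod_iso X V0 \<or> mod_iso X V1" using that unfolding V0_eq V1_eq by (metis V0_eq V1_eq empty_iff insert_iff)
    then show ?thesis by blast
  next
    case False
    then have "r \<ge> 1" by simp
    then show ?thesis using that by blast
  qed
  have band: ?listed if "mod_iso X (A_band lam n) \<or> mod_iso X (B_band lam n)" and n1: "n \<ge> 1" for lam n
  proof (cases "lam = 0")
    case True
    obtain t where "n = Suc t" using n1 by (cases n) auto
    then have "mod_iso X (V_mod 1 t) \<or> mod_iso X (W_mod 1 t)" using that(1) True V1_W1_eq by metis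
    then show ?thesis by blast
  qed (use that n1 in blast)
  have st: ?listed if "mod_iso X (V_mod 2 t) \<or> mod_iso X (W_mod 2 t)" for t using that by blast
  show "indecomposable X \<longleftrightarrow> ?listed"
  proof
    assume "indecomposable X"
    from indecomposable_cases[OF char this] show ?listed
    proof (elim disjE exE conjE)
      assume "\<forall>L. has_frame L 2 2 (el 0 0) (el 1 0) (el 1 0) (el 1 1) \<longrightarrow> mod_iso X L"
      then have "mod_iso X M_mod" using M_frame[OF char] by blast
      then show ?thesis by blast
    next
      assume "\<forall>L. has_frame L 2 2 (el 1 0) (el 1 1) (el 0 0) (el 1 0) \<longrightarrow> mod_iso X L"
      then have "mod_iso X N_mod" using N_frame[OF char] by blast
      then show ?thesis by blast
    next
      fix u y and p q :: "(nat \<Rightarrow> 'k) \<Rightarrow> nat \<Rightarrow> 'k"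
      assume std: "std_pencil u y p q" and iso: "\<forall>L. has_frame L u y p q (\<lambda>_. 0) (\<lambda>_. 0) \<longrightarrow> mod_iso X L"
      from std show ?thesis
      proof cases
        case 1
        then have "mod_iso X (U_mod 1 y)" using iso U1_frame[OF char] by blast
        then show ?thesis by (rule U) simp
      next
        case 2
        then have "mod_iso X (U_mod 2 u)" using iso U2_frame[OF char] by blast
        then show ?thesis by (rule U) simp
      next
        case (3 lam)
        then have "mod_iso X (A_band lam y)" "y \<ge> 1" using iso A_frame[OF char] by blast+
        then show ?thesis using band by blast
      next
        case 4
        then obtain t where "y = Suc t" by (cases y) auto
        then have "mod_iso X (V_mod 2 t)" using 4 iso V2_frame[OF char] by blast
        then show ?thesis using st by blast
      qed
    next
      fix u y and p q :: "(nat \<Rightarrow> 'k) \<Rightarrow> nat \<Rightarrow> 'k"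
      assume std: "std_pencil u y p q" and iso: "\<forall>L. has_frame L y u (\<lambda>_. 0) (\<lambda>_. 0) q p \<longrightarrow> mod_iso X L"
      from std show ?thesis
      proof cases
        case 1
        then have "mod_iso X (U_mod 3 y)" using iso U3_frame[OF char] by blast
        then show ?thesis by (rule U) simp
      next
        case 2
        then have "mod_iso X (U_mod 4 u)" using iso U4_frame[OF char] by blast
        then show ?thesis by (rule U) simp
      next
        case (3 lam)
        then have "mod_iso X (B_band lam y)" "y \<ge> 1" using iso B_frame[OF char] by blast+
        then show ?thesis using band by blast
      next
        case 4
        then obtain t where "y = Suc t" by (cases y) auto
        then have "mod_iso X (W_mod 2 t)" using 4 iso W2_frame[OF char] by blast
        then show ?thesis using st by blast
      qed
    qed
  next
    \<comment> \<open>\<open>phi\<close> serves the modules whose pencil sits in (p, q),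
      \<open>psi\<close> those where it sits in (t, s).\<close>
    note phi = frame_indecomposable[OF _ std_pencil_data_indec(1)]
      and psi = frame_indecomposable[OF _ std_pencil_data_indec(2)]
    have iU: "indecomposable (U_mod i r :: 'k rep)" if "i \<in> {1,2,3,4}" for i r
      using that phi[OF U1_frame[OF char] std_pencil.intros(1)] phi[OF U2_frame[OF char] std_pencil.intros(2)]
        psi[OF U3_frame[OF char] std_pencil.intros(1)] psi[OF U4_frame[OF char] std_pencil.intros(2)] by blast
    have iB: "indecomposable (A_band lam n :: 'k rep)" "indecomposable (B_band lam n :: 'k rep)" if "n \<ge> 1" for lam n
      using phi[OF A_frame[OF char] std_pencil.intros(3)[OF that]] psi[OF B_frame[OF char] std_pencil.intros(3)[OF that]] by auto
    have "indecomposable (V_mod 2 t :: 'k rep)" "indecomposable (W_mod 2 t :: 'k rep)" for t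
      using phi[OF V2_frame[OF char] std_pencil.intros(4)] psi[OF W2_frame[OF char] std_pencil.intros(4)] by auto
    moreover have "indecomposable (V_mod 1 t :: 'k rep)" "indecomposable (W_mod 1 t :: 'k rep)" for t
      unfolding V1_W1_eq by (rule iB, simp)+
    ultimately have iV: "indecomposable (V_mod j t :: 'k rep) \<and> indecomposable (W_mod j t :: 'k rep)" if "j \<in> {1,2}" for j t
      using that by blast
    have iM: "indecomposable (M_mod :: 'k rep)" using frame_indecomposable[OF M_frame[OF char] top_indec] .
    have "data_indec 2 2 (el 1 0) (el 1 1) (el 0 0) (el 1 0 :: (nat \<Rightarrow> 'k) \<Rightarrow> _)"
      using top_indec data_swap(4) by blast
    then have iN: "indecomposable (N_mod :: 'k rep)" using frame_indecomposable[OF N_frame[OF char]] by blast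
    have iS: "indecomposable (V0 :: 'k rep)" "indecomposable (V1 :: 'k rep)" 
      unfolding V0_eq(1) V1_eq(1) by (rule iU, simp)+
    assume ?listed
    then obtain L :: "'k rep" where "mod_iso X L" "indecomposable L"
      using iU iB iV iM iN iS by blast
    then show "indecomposable X" by (rule indecomposable_iso)
  qed
qed

end
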